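(* Let $K$ be a field, $S=K[t_1,\dots,t_s]$, let $I\subset S$ be a Geramita ideal and let $\mathfrak p$ be an associated prime of $S/I$. If $I$ is not prime, then $$\mathrm s(I)\le \mathrm v_{\mathfrak p}(I)\le \mathrm{reg}(S/I),$$ with equality everywhere if $S/I$ is a level ring.
   Context: $S=\bigoplus_{d\ge0}S_d$ has the standard grading; $K$ is arbitrary. A Geramita ideal is a graded ideal $I\subsetneq S$ that is unmixed (all its associated primes have the same height), with $\dim(S/I)=1$, and all of whose associated primes are generated by linear forms. Let $0\to\bigoplus_jS(-j)^{b_{g,j}}\to\cdots\to\bigoplus_jS(-j)^{b_{1,j}}\to S\to S/I\to0$ be the minimal graded free resolution of $S/I$, of length $g$ (the projective dimension). The Castelnuovo–Mumford regularity is $\mathrm{reg}(S/I)=\max\{j-i : b_{i,j}\ne0\}$ and the minimum socle degree is $\mathrm s(I)=\min\{j-g : b_{g,j}\neq0\}$. The ring $S/I$ is level if it is Cohen–Macaulay and there is a unique $j$ with $b_{g,j}\ne0$. The local v-number at $\mathfrak p\in\mathrm{Ass}(S/I)$ is $\mathrm v_{\mathfrak p}(I)=\min\{d\ge1 : \exists f\in S_d\text{ with }(I:f)=\mathfrak p\}$. *)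

theory Defs
  imports
    "HOL-Library.Poly_Mapping"
    "HOL-Library.Extended_Nat"
    "HOL-Algebra.QuotRing"
    "Jordan_Normal_Form.Matrix_Kernel"
begin

section \<open>The polynomial ring and its standard grading\<close>

text \<open>
  The polynomial ring \<open>K[t\<^sub>1,\<dots>,t\<^sub>s]\<close> is the type of finitely supported functions from exponent
  vectors to \<open>K\<close>; the variables are indexed by a finite type \<open>'n\<close>, so \<open>s\<close> is \<open>CARD('n)\<close>.
  As a HOL-Algebra ring it is \<^term>\<open>class_ring\<close>.
\<close>

type_synonym ('n, 'k) mpol = "('n \<Rightarrow>\<^sub>0 nat) \<Rightarrow>\<^sub>0 'k"

definition variable :: "'n::finite \<Rightarrow> ('n, 'k::field) mpol" where
  "variable i = Poly_Mapping.single (Poly_Mapping.single i 1) 1"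

definition total_deg :: "('n::finite \<Rightarrow>\<^sub>0 nat) \<Rightarrow> nat" where
  "total_deg m = (\<Sum>i\<in>UNIV. Poly_Mapping.lookup m i)"

text \<open>
  The graded piece \<open>S\<^sub>d\<close> is indexed by integers, so that \<open>S\<^sub>d = {0}\<close> for \<open>d < 0\<close>; this is
  what the twists of a graded resolution need.
\<close>

definition graded_piece :: "int \<Rightarrow> ('n::finite, 'k::field) mpol set" where
  "graded_piece d = {f. \<forall>m\<in>Poly_Mapping.keys f. int (total_deg m) = d}"

definition hom_component :: "nat \<Rightarrow> ('n::finite, 'k::field) mpol \<Rightarrow> ('n, 'k) mpol" where
  "hom_component d f =
     (\<Sum>m | m \<in> Poly_Mapping.keys f \<and> total_deg m = d.
        Poly_Mapping.single m (Poly_Mapping.lookup f m))"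

definition irrelevant_ideal :: "('n::finite, 'k::field) mpol set" where
  "irrelevant_ideal = Idl\<^bsub>class_ring\<^esub> (range variable)"

definition graded_ideal :: "('n::finite, 'k::field) mpol set \<Rightarrow> bool" where
  "graded_ideal I \<longleftrightarrow> ideal I class_ring \<and> (\<forall>f\<in>I. \<forall>d. hom_component d f \<in> I)"


section \<open>Height, Krull dimension and associated primes\<close>

definition prime_chain :: "('a, 'b) ring_scheme \<Rightarrow> nat \<Rightarrow> (nat \<Rightarrow> 'a set) \<Rightarrow> bool" where
  "prime_chain R n P \<longleftrightarrow> (\<forall>i\<le>n. primeideal (P i) R) \<and> (\<forall>i<n. P i \<subset> P (Suc i))"

definition prime_height :: "('a, 'b) ring_scheme \<Rightarrow> 'a set \<Rightarrow> enat" where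
  "prime_height R p = Sup {enat n | n. \<exists>P. prime_chain R n P \<and> P n = p}"

definition krull_dim :: "('a, 'b) ring_scheme \<Rightarrow> enat" where
  "krull_dim R = Sup {enat n | n. \<exists>P. prime_chain R n P}"

definition colon :: "'a::comm_ring_1 set \<Rightarrow> 'a \<Rightarrow> 'a set" where
  "colon I f = {h. h * f \<in> I}"

text \<open>The associated primes of the module \<open>S/I\<close>: \<open>(I : f)\<close> is the annihilator of \<open>f + I\<close>.\<close>

definition Ass :: "'a::comm_ring_1 set \<Rightarrow> 'a set set" where
  "Ass I = {p. primeideal p class_ring \<and> (\<exists>f. p = colon I f)}"

definition unmixed :: "'a::comm_ring_1 set \<Rightarrow> bool" where
  "unmixed I \<longleftrightarrow>
     (\<forall>p\<in>Ass I. \<forall>q\<in>Ass I. prime_height class_ring p = prime_height class_ring q)"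

definition geramita_ideal :: "('n::finite, 'k::field) mpol set \<Rightarrow> bool" where
  "geramita_ideal I \<longleftrightarrow>
     graded_ideal I \<and> I \<noteq> UNIV \<and> unmixed I \<and> krull_dim (class_ring Quot I) = 1 \<and>
     (\<forall>p\<in>Ass I. \<exists>L. L \<subseteq> graded_piece 1 \<and> p = Idl\<^bsub>class_ring\<^esub> L)"

definition local_v_number ::
    "('n::finite, 'k::field) mpol set \<Rightarrow> ('n, 'k) mpol set \<Rightarrow> nat" where
  "local_v_number p I = (LEAST d. 1 \<le> d \<and> (\<exists>f\<in>graded_piece (int d). colon I f = p))"


section \<open>Minimal graded free resolutions\<close>

text \<open>
  A complex \<open>0 \<rightarrow> F\<^sub>g \<rightarrow> \<dots> \<rightarrow> F\<^sub>1 \<rightarrow> F\<^sub>0 = S \<rightarrow> S/I \<rightarrow> 0\<close> of graded free modules is given by the lists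
  \<open>F i\<close> of the degrees of the basis elements of \<open>F\<^sub>i\<close>, so that
  \<open>F\<^sub>i\<close> is the direct sum of the \<open>S(-j)\<close> for \<open>j\<close> in \<open>F i\<close>,
  together with the matrices \<open>\<phi> (i + 1)\<close> of the maps from \<open>F\<^sub>i\<^sub>+\<^sub>1\<close> to \<open>F\<^sub>i\<close> in these bases;
  the value \<open>\<phi> 0\<close> is irrelevant.
  The modules \<open>F\<^sub>i\<close> with \<open>i > g\<close> are zero, i.e. \<open>F i = []\<close>, hence exactness at
  \<open>F\<^sub>g\<close> is injectivity of \<open>\<phi> g\<close>.
\<close>

definition mat_image :: "'a::comm_ring_1 mat \<Rightarrow> 'a vec set" where
  "mat_image A = {A *\<^sub>v v | v. v \<in> carrier_vec (dim_col A)}"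

definition minimal_graded_free_resolution ::
    "('n::finite, 'k::field) mpol set \<Rightarrow> nat \<Rightarrow> (nat \<Rightarrow> int list) \<Rightarrow>
     (nat \<Rightarrow> ('n, 'k) mpol mat) \<Rightarrow> bool" where
  "minimal_graded_free_resolution I g F \<phi> \<longleftrightarrow>
     F 0 = [0] \<and>
     (\<forall>i. F i \<noteq> [] \<longleftrightarrow> i \<le> g) \<and>
     (\<forall>i. \<phi> (Suc i) \<in> carrier_mat (length (F i)) (length (F (Suc i)))) \<and>
     \<comment> \<open>the maps preserve degrees\<close>
     (\<forall>i. \<forall>r < length (F i). \<forall>c < length (F (Suc i)).
        \<phi> (Suc i) $$ (r, c) \<in> graded_piece (F (Suc i) ! c - F i ! r)) \<and>
     \<comment> \<open>exactness at \<open>S\<close>: the cokernel of \<open>F\<^sub>1 \<rightarrow> S\<close> is \<open>S/I\<close>\<close>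
     (\<lambda>v. v $ 0) ` mat_image (\<phi> 1) = I \<and>
     (\<forall>i. mat_kernel (\<phi> (Suc i)) = mat_image (\<phi> (Suc (Suc i)))) \<and>
     \<comment> \<open>minimality: the image of \<open>F\<^sub>i\<^sub>+\<^sub>1\<close> lies in the irrelevant ideal times \<open>F\<^sub>i\<close>\<close>
     (\<forall>i. \<forall>r < length (F i). \<forall>c < length (F (Suc i)).
        \<phi> (Suc i) $$ (r, c) \<in> irrelevant_ideal)"

definition betti :: "(nat \<Rightarrow> int list) \<Rightarrow> nat \<Rightarrow> int \<Rightarrow> nat" where
  "betti F i j = count_list (F i) j"

definition regularity :: "(nat \<Rightarrow> int list) \<Rightarrow> int" where
  "regularity F = Max {j - int i | i j. betti F i j \<noteq> 0}"

definition min_socle_degree :: "nat \<Rightarrow> (nat \<Rightarrow> int list) \<Rightarrow> int" where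
  "min_socle_degree g F = Min {j - int g | j. betti F g j \<noteq> 0}"


section \<open>Cohen-Macaulay and level rings\<close>

definition regular_sequence ::
    "('n::finite, 'k::field) mpol set \<Rightarrow> ('n, 'k) mpol list \<Rightarrow> bool" where
  "regular_sequence I fs \<longleftrightarrow>
     (\<forall>i < length fs. \<forall>h.
        fs ! i * h \<in> Idl\<^bsub>class_ring\<^esub> (I \<union> set (take i fs)) \<longrightarrow>
        h \<in> Idl\<^bsub>class_ring\<^esub> (I \<union> set (take i fs))) \<and>
     Idl\<^bsub>class_ring\<^esub> (I \<union> set fs) \<noteq> UNIV"

definition depth_quot :: "('n::finite, 'k::field) mpol set \<Rightarrow> enat" where
  "depth_quot I =
     Sup {enat (length fs) | fs. set fs \<subseteq> irrelevant_ideal \<and> regular_sequence I fs}"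

definition cohen_macaulay :: "('n::finite, 'k::field) mpol set \<Rightarrow> bool" where
  "cohen_macaulay I \<longleftrightarrow> depth_quot I = krull_dim (class_ring Quot I)"

definition level ::
    "('n::finite, 'k::field) mpol set \<Rightarrow> nat \<Rightarrow> (nat \<Rightarrow> int list) \<Rightarrow> bool" where
  "level I g F \<longleftrightarrow> cohen_macaulay I \<and> (\<exists>!j. betti F g j \<noteq> 0)"

end

theory Submission
  imports Defs "HOL-Library.Function_Algebras" "HOL-Library.Product_Plus"
    "HOL-Computational_Algebra.Primes"
begin

text \<open>
  Put \<open>S = K[t\<^sub>1,\<dots>,t\<^sub>s]\<close>, let \<open>\<mm>\<close> be the irrelevant ideal, \<open>d = v\<^sub>p(I)\<close>, and let \<open>f\<close> be a form of
  degree \<open>d\<close> with \<open>(I : f) = p\<close>. Unmixedness and \<open>dim S/I = 1\<close> give \<open>\<mm> \<notin> Ass(S/I)\<close>; so \<open>p\<close> is generated by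
  \<open>s - 1\<close> linear forms \<open>l\<^sub>1,\<dots>,l\<^sub>s\<^sub>-\<^sub>1\<close>, which a variable \<open>x\<close> outside \<open>p\<close> completes to a basis of the linear forms.
  Since \<open>p\<close> kills \<open>f\<close> in \<open>S/I\<close>, iterating the connecting homomorphisms of
  \<open>Tor(S/I, S/(l\<^sub>1,\<dots>,l\<^sub>k))\<close> produces a class of degree \<open>d + s - 1\<close> in \<open>Tor\<^sub>s\<^sub>-\<^sub>1(S/I, K)\<close>. This class
  vanishes only if \<open>f - xu \<in> I\<close> for a form \<open>u\<close> with \<open>p u \<subseteq> I\<close>; then \<open>(I : u) = p\<close>, against the minimality of \<open>d\<close>
  (or \<open>u\<close> is constant and \<open>I = p\<close> is prime). As \<open>depth S/I > 0\<close>, the resolution has length \<open>s - 1\<close>, so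
  \<open>d + s - 1\<close> is one of its last shifts, which gives both inequalities.

  If \<open>d + s - 1\<close> is the only last shift, choose a form \<open>h\<close> of degree \<open>e\<close>, regular on \<open>S/I\<close>; such a form exists over
  every field, but over a finite one not always with \<open>e = 1\<close>. The mapping cone of \<open>h\<close> is a minimal
  resolution of the Artinian ring \<open>A = S/(I, h)\<close>. Its last shifts are those of \<open>S/I\<close> moved by \<open>e\<close>, so the
  socle of \<open>A\<close> lives in degree \<open>d - 1 + e\<close> only, and this is the top degree of \<open>A\<close>, that is, \<open>reg A\<close>. Hence \<open>reg S/I \<le> d\<close>.
\<close>

section \<open>Bigraded complexes reduced by a regular sequence\<close>

text \<open>The shift \<open>d + s - 1\<close> is forced: each connecting homomorphism lowers
  homological and internal degree by one, and \<open>s - 1\<close> of them lead down to the class of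
  \<open>f\<close> in degree \<open>d\<close>. They are injective because the homology modulo the
  first \<open>k\<close> linear forms vanishes in homological degrees above \<open>k\<close>. The
  form \<open>x\<close> is taken last: killing it passes from \<open>S/p\<close> to
  \<open>K\<close>, and the only loss there is the obstruction \<open>u\<close>. Minimality of
  \<open>d\<close> excludes \<open>u\<close> only if its degree is at least 1, since v-numbers start
  in degree 1; a constant \<open>u\<close> is excluded because \<open>I\<close> is not prime.
  Primary decomposition is replaced by one fact: some product of associated primes lies in
  \<open>I\<close>. It yields the regular form \<open>h\<close>, the Artinian quotient, and the
  exclusion of the irrelevant ideal. Primes generated by linear forms are handled as kernels of
  substitutions, which makes primeness and regularity immediate. Heights are extended naturals, so
  comparing the heights of nested primes needs finiteness; hence the bound on chains of primes. The
  complex is abstract because it is instantiated twice, by the resolution and by the cone of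
  \<open>h\<close>, over different types.\<close>

text \<open>
  The sets \<open>C i j\<close> are the graded pieces of the modules of a complex, and \<open>l\<^sub>0, l\<^sub>1, \<dots>\<close> are commuting operators
  of degree one. The homology of the complex modulo \<open>(l\<^sub>0,\<dots>,l\<^sub>k\<^sub>-\<^sub>1)\<close> is represented without quotients:
  \<open>B k i j\<close> is the piece of \<open>(l\<^sub>0,\<dots>,l\<^sub>k\<^sub>-\<^sub>1) C\<close>, and the homology is \<open>Z k i j\<close> modulo \<open>Bd k i j\<close>.
\<close>

locale graded_complex =
  fixes C :: "nat \<Rightarrow> int \<Rightarrow> 'c::ab_group_add set"
    and D :: "nat \<Rightarrow> 'c \<Rightarrow> 'c"
    and l :: "nat \<Rightarrow> 'c \<Rightarrow> 'c"
  assumes zero_C: "0 \<in> C i j"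
    and diff_C: "x \<in> C i j \<Longrightarrow> y \<in> C i j \<Longrightarrow> x - y \<in> C i j"
    and D_C: "x \<in> C (Suc i) j \<Longrightarrow> D i x \<in> C i j"
    and l_C: "x \<in> C i j \<Longrightarrow> l r x \<in> C i (j + 1)"
    and D_diff: "D i (x - y) = D i x - D i y"
    and l_diff: "l r (x - y) = l r x - l r y"
    and D_l: "D i (l r x) = l r (D i x)"
    and l_l: "l q (l r x) = l r (l q x)"
begin

lemma minus_C: "x \<in> C i j \<Longrightarrow> - x \<in> C i j"
  using diff_C[OF zero_C, of x i j] by simp

lemma add_C: "x \<in> C i j \<Longrightarrow> y \<in> C i j \<Longrightarrow> x + y \<in> C i j"
  using diff_C[OF _ minus_C, of x i j y] by simp

lemma D_zero [simp]: "D i 0 = 0" using D_diff[of i 0 0] by simp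
lemma l_zero [simp]: "l r 0 = 0" using l_diff[of r 0 0] by simp
lemma D_minus: "D i (- x) = - D i x" using D_diff[of i 0 x] by simp
lemma l_minus: "l r (- x) = - l r x" using l_diff[of r 0 x] by simp
lemma D_add: "D i (x + y) = D i x + D i y" using D_diff[of i x "- y"] by (simp add: D_minus)
lemma l_add: "l r (x + y) = l r x + l r y" using l_diff[of r x "- y"] by (simp add: l_minus)

primrec B :: "nat \<Rightarrow> nat \<Rightarrow> int \<Rightarrow> 'c set" where
  "B 0 i j = {0}"
| "B (Suc k) i j = {b + l k w | b w. b \<in> B k i j \<and> w \<in> C i (j - 1)}"

text \<open>\<open>D i\<close> starts at \<open>C (Suc i)\<close>, so nothing leaves
  \<open>C 0\<close> and every element there is a cycle; quantifying over \<open>i'\<close>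
  expresses this without a predecessor.\<close>

definition Z :: "nat \<Rightarrow> nat \<Rightarrow> int \<Rightarrow> 'c set" where
  "Z k i j = {z \<in> C i j. \<forall>i'. i = Suc i' \<longrightarrow> D i' z \<in> B k i' j}"

definition Bd :: "nat \<Rightarrow> nat \<Rightarrow> int \<Rightarrow> 'c set" where
  "Bd k i j = {D i u + b | u b. u \<in> C (Suc i) j \<and> b \<in> B k i j}"

lemma l_C': "x \<in> C i (j - 1) \<Longrightarrow> l r x \<in> C i j"
  using l_C[of x i "j - 1" r] by simp

lemma B_sub_C: "b \<in> B k i j \<Longrightarrow> b \<in> C i j"
  by (induction k arbitrary: b) (auto simp: zero_C intro: add_C l_C')

lemma B_SucI: "x = b + l k w \<Longrightarrow> b \<in> B k i j \<Longrightarrow> w \<in> C i (j - 1) \<Longrightarrow> x \<in> B (Suc k) i j"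
  by auto

lemma zero_B: "0 \<in> B k i j"
proof (induction k)
  case (Suc k)
  show ?case by (rule B_SucI[OF _ Suc zero_C]) simp
qed simp

lemma diff_B: "a \<in> B k i j \<Longrightarrow> b \<in> B k i j \<Longrightarrow> a - b \<in> B k i j"
proof (induction k arbitrary: a b)
  case (Suc k)
  then obtain a' w b' v where *: "a = a' + l k w" "b = b' + l k v" "a' \<in> B k i j" "b' \<in> B k i j"
    "w \<in> C i (j - 1)" "v \<in> C i (j - 1)" by auto
  have "a - b = (a' - b') + l k (w - v)" by (simp add: * l_diff)
  then show ?case by (rule B_SucI[OF _ Suc.IH[OF *(3,4)] diff_C[OF *(5,6)]])
qed simp

lemma minus_B: "x \<in> B k i j \<Longrightarrow> - x \<in> B k i j"
  using diff_B[OF zero_B, of x k i j] by simp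

lemma add_B: "x \<in> B k i j \<Longrightarrow> y \<in> B k i j \<Longrightarrow> x + y \<in> B k i j"
  using diff_B[OF _ minus_B, of x k i j y] by simp

lemma D_B: "b \<in> B k (Suc i) j \<Longrightarrow> D i b \<in> B k i j"
proof (induction k arbitrary: b)
  case (Suc k)
  then obtain a w where *: "b = a + l k w" "a \<in> B k (Suc i) j" "w \<in> C (Suc i) (j - 1)" by auto
  show ?case by (rule B_SucI[OF _ Suc.IH[OF *(2)] D_C[OF *(3)]]) (simp add: *(1) D_add D_l)
qed simp

lemma l_B: "b \<in> B k i j \<Longrightarrow> l r b \<in> B k i (j + 1)"
proof (induction k arbitrary: b)
  case (Suc k)
  then obtain a w where *: "b = a + l k w" "a \<in> B k i j" "w \<in> C i (j - 1)" by auto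
  have "l r w \<in> C i (j + 1 - 1)" using l_C[OF *(3), of r] by simp
  show ?case by (rule B_SucI[OF _ Suc.IH[OF *(2)] \<open>l r w \<in> C i (j + 1 - 1)\<close>]) (simp add: *(1) l_add l_l[of r k])
qed simp

lemma l_B': "b \<in> B k i (j - 1) \<Longrightarrow> l r b \<in> B k i j"
  using l_B[of b k i "j - 1" r] by simp

lemma B_Suc: "b \<in> B k i j \<Longrightarrow> b \<in> B (Suc k) i j"
  by (rule B_SucI[OF _ _ zero_C]) auto

lemma l_in_B_Suc: "w \<in> C i (j - 1) \<Longrightarrow> l k w \<in> B (Suc k) i j"
  by (rule B_SucI[OF _ zero_B]) auto

lemma diff_Bd: "x \<in> Bd k i j \<Longrightarrow> y \<in> Bd k i j \<Longrightarrow> x - y \<in> Bd k i j"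
proof -
  assume "x \<in> Bd k i j" "y \<in> Bd k i j"
  then obtain u b v c where *: "x = D i u + b" "y = D i v + c" "u \<in> C (Suc i) j" "v \<in> C (Suc i) j"
    "b \<in> B k i j" "c \<in> B k i j" unfolding Bd_def by auto
  have "x - y = D i (u - v) + (b - c)" by (simp add: * D_diff)
  then show ?thesis unfolding Bd_def using * diff_C diff_B by blast
qed

lemma B_sub_Bd: "b \<in> B k i j \<Longrightarrow> b \<in> Bd k i j"
proof -
  assume "b \<in> B k i j"
  then have "b = D i 0 + b \<and> 0 \<in> C (Suc i) j \<and> b \<in> B k i j" using zero_C by simp
  then show ?thesis unfolding Bd_def by blast
qed

lemma minus_Bd: "x \<in> Bd k i j \<Longrightarrow> - x \<in> Bd k i j"
  using diff_Bd[OF B_sub_Bd[OF zero_B], of x k i j] by simp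

lemma add_Bd: "x \<in> Bd k i j \<Longrightarrow> y \<in> Bd k i j \<Longrightarrow> x + y \<in> Bd k i j"
  using diff_Bd[OF _ minus_Bd, of x k i j y] by simp

lemma D_in_Bd: "u \<in> C (Suc i) j \<Longrightarrow> D i u \<in> Bd k i j"
  unfolding Bd_def using zero_B[of k i j] by force

lemma Bd_Suc: "z \<in> Bd k i j \<Longrightarrow> z \<in> Bd (Suc k) i j"
  unfolding Bd_def using B_Suc by blast

lemma l_in_Bd_Suc: "w \<in> C i (j - 1) \<Longrightarrow> l k w \<in> Bd (Suc k) i j"
  by (rule B_sub_Bd[OF l_in_B_Suc])

lemma Z_sub_C: "z \<in> Z k i j \<Longrightarrow> z \<in> C i j"
  unfolding Z_def by auto

lemma diff_Z: "x \<in> Z k i j \<Longrightarrow> y \<in> Z k i j \<Longrightarrow> x - y \<in> Z k i j"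
  unfolding Z_def by (auto simp: D_diff diff_C diff_B)

lemma Z_0: "Z k 0 j = C 0 j"
  unfolding Z_def by auto

lemma Z_Suc_iff: "z \<in> Z k (Suc i) j \<longleftrightarrow> z \<in> C (Suc i) j \<and> D i z \<in> B k i j"
  unfolding Z_def by auto

lemma Z_Suc_mono: "z \<in> Z k i j \<Longrightarrow> z \<in> Z (Suc k) i j"
  unfolding Z_def using B_Suc by blast

end

section \<open>Homology modulo initial segments of a regular sequence\<close>

locale regular_complex = graded_complex +
  fixes s :: nat
  assumes DD: "x \<in> C (Suc (Suc i)) j \<Longrightarrow> D i (D (Suc i) x) = 0"
    and exact: "x \<in> C (Suc i) j \<Longrightarrow> D i x = 0 \<Longrightarrow> \<exists>y\<in>C (Suc (Suc i)) j. x = D (Suc i) y"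
    and regular: "k < s \<Longrightarrow> x \<in> C i j \<Longrightarrow> l k x \<in> B k i (j + 1) \<Longrightarrow> x \<in> B k i j"
begin

lemma Bd_sub_Z: "z \<in> Bd k i j \<Longrightarrow> z \<in> Z k i j"
proof -
  assume "z \<in> Bd k i j"
  then obtain u b where *: "z = D i u + b" "u \<in> C (Suc i) j" "b \<in> B k i j" unfolding Bd_def by auto
  then show ?thesis
    unfolding Z_def by (auto simp: D_add DD intro: add_C D_C B_sub_C D_B)
qed

text \<open>The connecting homomorphism of multiplication by \<open>l k\<close>.\<close>

lemma connecting:
  assumes "k < s" "z \<in> Z (Suc k) (Suc i) j"
  obtains w b where "D i z = l k w + b" "b \<in> B k i j" "w \<in> Z k i (j - 1)" "l k w \<in> Bd k i j"
proof -
  from assms(2) obtain w b where *: "D i z = l k w + b" "b \<in> B k i j" "w \<in> C i (j - 1)"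
    by (auto simp: Z_Suc_iff add.commute)
  have zC: "z \<in> C (Suc i) j" using assms(2) Z_sub_C by blast
  \<comment> \<open>Applying \<open>D\<close> once more kills the left side of
    \<open>D i z = l k w + b\<close>, so \<open>l k (D w) = - D b\<close> lies in
    \<open>B k\<close>, and regularity divides out \<open>l k\<close>.\<close>
  have "D i' w \<in> B k i' (j - 1)" if "i = Suc i'" for i'
  proof -
    have "0 = D i' (l k w + b)" using DD[of z i' j] zC *(1) that by simp
    then have "l k (D i' w) = - D i' b" by (simp add: D_add D_l eq_neg_iff_add_eq_0)
    then have "l k (D i' w) \<in> B k i' (j - 1 + 1)"
      using minus_B D_B *(2) that by simp
    then show ?thesis using regular[OF assms(1), of "D i' w"] D_C *(3) that by blast
  qed
  then have w: "w \<in> Z k i (j - 1)" using *(3) by (auto simp: Z_def)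
  have "l k w = D i z + (- b)" using *(1) by simp
  then have "l k w \<in> Bd k i j"
    unfolding Bd_def using zC minus_B *(2) by blast
  with that[OF *(1,2) w] show ?thesis .
qed

text \<open>This is a piece of the long exact sequence of multiplication by \<open>l k\<close>: the
  homology modulo \<open>k + 1\<close> forms sits between the homology modulo \<open>k\<close> forms
  in the same bidegree and the one with both degrees lowered by one.\<close>

lemma acyclic_Suc:
  assumes k: "k < s"
    and prev: "\<And>z. z \<in> Z k i (j - 1) \<Longrightarrow> z \<in> Bd k i (j - 1)"
    and cur: "\<And>z. z \<in> Z k (Suc i) j \<Longrightarrow> z \<in> Bd k (Suc i) j"
    and z: "z \<in> Z (Suc k) (Suc i) j"
  shows "z \<in> Bd (Suc k) (Suc i) j"
proof -
  obtain w b where *: "D i z = l k w + b" "b \<in> B k i j" "w \<in> Z k i (j - 1)"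
    using connecting[OF k z] by metis
  obtain u b' where w: "w = D i u + b'" "u \<in> C (Suc i) (j - 1)" "b' \<in> B k i (j - 1)"
    using prev[OF *(3)] unfolding Bd_def by auto
  have "D i (z - l k u) = l k b' + b" by (simp add: D_diff D_l *(1) w(1) l_add)
  also have "\<dots> \<in> B k i j" using l_B' add_B w(3) *(2) by blast
  finally have "z - l k u \<in> Z k (Suc i) j"
    using z w(2) Z_sub_C l_C' by (auto simp: Z_Suc_iff intro!: diff_C)
  then have "z - l k u \<in> Bd (Suc k) (Suc i) j" using cur Bd_Suc by blast
  then show ?thesis using add_Bd[OF _ l_in_Bd_Suc[OF w(2)], of "z - l k u" k] by simp
qed

text \<open>The resolution itself has homology only in degree 0, and by the long exact sequence each
  further form lets it reach at most one degree higher.\<close>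

lemma acyclic_above_length: "k \<le> s \<Longrightarrow> k < i \<Longrightarrow> z \<in> Z k i j \<Longrightarrow> z \<in> Bd k i j"
proof (induction k arbitrary: i j z)
  case 0
  then obtain i' where "i = Suc i'" using gr0_implies_Suc by blast
  with 0 show ?case using exact by (auto simp: Z_Suc_iff intro: D_in_Bd)
next
  case (Suc k)
  then obtain i' where i: "i = Suc i'" "k < i'" by (metis Suc_lessE)
  show ?case unfolding i
    by (rule acyclic_Suc) (use Suc i in auto)
qed

text \<open>The connecting homomorphism lowers \<open>i\<close> and \<open>j\<close> together, so
  the region \<open>j > a + i\<close> is stable under the induction on \<open>k\<close>. With all
  \<open>s\<close> forms this bounds the degrees of the generators by the top degree of the cokernel
  of \<open>D 0\<close>.\<close>

lemma acyclic_above_degree: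
  assumes top: "\<And>j z. j > a \<Longrightarrow> z \<in> C 0 j \<Longrightarrow> \<exists>u\<in>C (Suc 0) j. z = D 0 u"
  shows "k \<le> s \<Longrightarrow> j > a + int i \<Longrightarrow> z \<in> Z k i j \<Longrightarrow> z \<in> Bd k i j"
proof (induction k arbitrary: i j z)
  case 0
  show ?case
  proof (cases i)
    case 0
    with top[of j z] "0.prems" show ?thesis by (auto simp: Z_0 intro: D_in_Bd)
  next
    case (Suc i')
    with 0 show ?thesis using exact by (auto simp: Z_Suc_iff intro: D_in_Bd)
  qed
next
  case (Suc k)
  show ?case
  proof (cases i)
    case 0
    with Suc show ?thesis using Bd_Suc by (auto simp: Z_0)
  next
    case (Suc i')
    show ?thesis unfolding Suc
      by (rule acyclic_Suc) (use Suc.IH Suc.prems Suc in auto)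
  qed
qed

text \<open>The iterated connecting homomorphisms, as a relation between the cycles \<open>Z k k (n + k)\<close> and the
  elements of \<open>C 0 n\<close> that \<open>l\<^sub>0,\<dots>,l\<^sub>k\<^sub>-\<^sub>1\<close> map to boundaries.\<close>

primrec rho :: "nat \<Rightarrow> int \<Rightarrow> 'a \<Rightarrow> 'a \<Rightarrow> bool" where
  "rho 0 n z m \<longleftrightarrow> z = m \<and> z \<in> C 0 n"
| "rho (Suc k) n z m \<longleftrightarrow> z \<in> C (Suc k) (n + int (Suc k)) \<and>
     (\<exists>w b. D k z = l k w + b \<and> b \<in> B k k (n + int (Suc k)) \<and> rho k n w m)"

definition N :: "nat \<Rightarrow> int \<Rightarrow> 'a set" where
  "N k n = {m \<in> C 0 n. \<forall>r<k. \<exists>u\<in>C (Suc 0) (n + 1). l r m = D 0 u}"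

lemma rho_sub_C: "rho k n z m \<Longrightarrow> z \<in> C k (n + int k)"
  by (cases k) auto

lemma rho_diff: "rho k n z m \<Longrightarrow> rho k n z' m' \<Longrightarrow> rho k n (z - z') (m - m')"
proof (induction k arbitrary: z z')
  case (Suc k)
  then obtain w b w' b' where *: "D k z = l k w + b" "b \<in> B k k (n + int (Suc k))" "rho k n w m"
    "D k z' = l k w' + b'" "b' \<in> B k k (n + int (Suc k))" "rho k n w' m'" by auto
  have "D k (z - z') = l k (w - w') + (b - b')" by (simp add: * D_diff l_diff)
  then show ?case using Suc.IH[OF *(3,6)] diff_B[OF *(2,5)] Suc.prems diff_C by auto
qed (auto intro: diff_C)

text \<open>Connecting homomorphisms are linear over the ring; this is what lets the condition that
  \<open>l k\<close> kills a class be moved between homological degree \<open>k\<close> and degree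
  0.\<close>

lemma rho_l: "rho k n z m \<Longrightarrow> rho k (n + 1) (l r z) (l r m)"
proof (induction k arbitrary: z)
  case (Suc k)
  then obtain w b where *: "D k z = l k w + b" "b \<in> B k k (n + int (Suc k))" "rho k n w m" by auto
  have eq: "n + 1 + int (Suc k) = n + int (Suc k) + 1" by simp
  have "D k (l r z) = l k (l r w) + l r b" by (simp add: D_l * l_add l_l)
  moreover have "l r b \<in> B k k (n + 1 + int (Suc k))" unfolding eq by (rule l_B[OF *(2)])
  moreover have "l r z \<in> C (Suc k) (n + 1 + int (Suc k))" unfolding eq
    using Suc.prems l_C rho.simps(2) by blast
  ultimately show ?case unfolding rho.simps using Suc.IH[OF *(3)] by blast
qed (auto intro: l_C)

text \<open>Each connecting homomorphism is injective, since the term before it in the long exact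
  sequence, the homology in degree \<open>k + 1\<close> modulo only \<open>k\<close> forms, is
  zero.\<close>

lemma rho_boundary_iff:
  "k \<le> s \<Longrightarrow> rho k n z m \<Longrightarrow> z \<in> Bd k k (n + int k) \<longleftrightarrow> (\<exists>u\<in>C (Suc 0) n. m = D 0 u)"
proof (induction k arbitrary: z)
  case 0
  then show ?case by (auto simp: Bd_def)
next
  case (Suc k)
  let ?j = "n + int (Suc k)"
  have ks: "k < s" and j: "?j - 1 = n + int k" using Suc.prems by auto
  from Suc.prems(2) obtain w b where *: "D k z = l k w + b" "b \<in> B k k ?j" "rho k n w m"
    "z \<in> C (Suc k) ?j" by auto
  have IH: "w \<in> Bd k k (n + int k) \<longleftrightarrow> (\<exists>u\<in>C (Suc 0) n. m = D 0 u)"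
    using Suc.IH[OF _ *(3)] ks by auto
  have wC: "w \<in> C k (n + int k)" using rho_sub_C *(3) by blast
  have "z \<in> Bd (Suc k) (Suc k) ?j \<longleftrightarrow> w \<in> Bd k k (n + int k)"
  proof
    assume "z \<in> Bd (Suc k) (Suc k) ?j"
    then obtain u c b' where z: "z = D (Suc k) u + (b' + l k c)" "u \<in> C (Suc (Suc k)) ?j"
      "b' \<in> B k (Suc k) ?j" "c \<in> C (Suc k) (?j - 1)" unfolding Bd_def by auto
    have "l k w + b = D k b' + l k (D k c)" using *(1) z(1) DD[OF z(2)] by (simp add: D_add D_l)
    then have "l k (w - D k c) = D k b' - b" unfolding l_diff by (simp add: algebra_simps)
    moreover have "D k b' - b \<in> B k k (n + int k + 1)" using diff_B[OF D_B[OF z(3)] *(2)]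
      by (simp add: algebra_simps)
    moreover have "D k c \<in> C k (n + int k)" using D_C z(4) j by simp
    ultimately have "w - D k c \<in> B k k (n + int k)"
      using regular[OF ks diff_C[OF wC]] by simp
    then have "D k c + (w - D k c) \<in> Bd k k (n + int k)" using z(4) unfolding Bd_def j by blast
    then show "w \<in> Bd k k (n + int k)" by simp
  next
    assume "w \<in> Bd k k (n + int k)"
    then obtain u b' where w: "w = D k u + b'" "u \<in> C (Suc k) (?j - 1)" "b' \<in> B k k (?j - 1)"
      unfolding Bd_def j by auto
    have "D k (z - l k u) = b + l k b'" by (simp add: D_diff D_l *(1) w(1) l_add)
    also have "\<dots> \<in> B k k ?j" using l_B'[OF w(3)] *(2) add_B by blast
    finally have "z - l k u \<in> Z k (Suc k) ?j"
      using *(4) w(2) l_C' by (auto simp: Z_Suc_iff intro!: diff_C)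
    then have "z - l k u \<in> Bd (Suc k) (Suc k) ?j"
      using acyclic_above_length[of k "Suc k"] ks Bd_Suc by auto
    then show "z \<in> Bd (Suc k) (Suc k) ?j"
      using add_Bd[OF _ l_in_Bd_Suc[OF w(2)], of "z - l k u" k] by simp
  qed
  then show ?case using IH by simp
qed

text \<open>The image of a connecting homomorphism is killed by \<open>l k\<close>. Transported to
  degree 0 by \<open>rho_l\<close> and \<open>rho_boundary_iff\<close>, this is the one new
  condition that separates \<open>N (Suc k)\<close> from \<open>N k\<close>.\<close>

lemma rho_exists_right: "k \<le> s \<Longrightarrow> z \<in> Z k k (n + int k) \<Longrightarrow> \<exists>m\<in>N k n. rho k n z m"
proof (induction k arbitrary: z)
  case 0
  then show ?case by (auto simp: N_def Z_0)
next
  case (Suc k)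
  let ?j = "n + int (Suc k)"
  have ks: "k < s" and j: "?j - 1 = n + int k" using Suc.prems by auto
  obtain w b where *: "D k z = l k w + b" "b \<in> B k k ?j" "w \<in> Z k k (?j - 1)" "l k w \<in> Bd k k ?j"
    using connecting[OF ks Suc.prems(2)] by metis
  obtain m where m: "m \<in> N k n" "rho k n w m" using Suc.IH *(3) ks j by auto
  have "rho k (n + 1) (l k w) (l k m)" by (rule rho_l[OF m(2)])
  moreover have "l k w \<in> Bd k k (n + 1 + int k)" using *(4) by (simp add: algebra_simps)
  ultimately have "\<exists>u\<in>C (Suc 0) (n + 1). l k m = D 0 u"
    using rho_boundary_iff[of k "n + 1" "l k w" "l k m"] ks by simp
  then have "m \<in> N (Suc k) n" using m(1) by (auto simp: N_def less_Suc_eq)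
  moreover have "rho (Suc k) n z m" using * m(2) Suc.prems(2) Z_sub_C by auto
  ultimately show ?case by blast
qed

text \<open>Exactness in the other direction: a class killed by \<open>l k\<close> is hit by the
  connecting homomorphism, so the conditions defining \<open>N\<close> can be used up one at a
  time.\<close>

lemma rho_exists_left: "k \<le> s \<Longrightarrow> m \<in> N k n \<Longrightarrow> \<exists>z\<in>Z k k (n + int k). rho k n z m"
proof (induction k)
  case 0
  then show ?case by (auto simp: N_def Z_0)
next
  case (Suc k)
  let ?j = "n + int (Suc k)"
  have ks: "k < s" using Suc.prems by auto
  have "m \<in> N k n" using Suc.prems by (auto simp: N_def)
  then obtain w where w: "w \<in> Z k k (n + int k)" "rho k n w m" using Suc.IH ks by auto
  have "\<exists>u\<in>C (Suc 0) (n + 1). l k m = D 0 u" using Suc.prems by (auto simp: N_def)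
  then have "l k w \<in> Bd k k (n + 1 + int k)"
    using rho_boundary_iff[OF _ rho_l[OF w(2), of k]] ks by simp
  then obtain z b where z: "l k w = D k z + b" "z \<in> C (Suc k) ?j" "b \<in> B k k ?j"
    unfolding Bd_def by (auto simp: algebra_simps)
  have Dz: "D k z = l k w + (- b)" using z(1) by simp
  have "rho (Suc k) n z m" unfolding rho.simps using Dz z(2) minus_B[OF z(3)] w(2) by blast
  moreover have "- b + l k w \<in> B (Suc k) k ?j"
    using minus_B[OF z(3)] Z_sub_C[OF w(1)] by (intro B_SucI[OF refl]) auto
  then have "z \<in> Z (Suc k) (Suc k) ?j" using z(2) Dz by (simp add: Z_Suc_iff add.commute)
  ultimately show ?case by blast
qed

text \<open>With all \<open>s\<close> forms, \<open>N s n\<close> modulo the image of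
  \<open>D 0\<close> is the degree \<open>n\<close> part of the socle of the cokernel; this is the
  familiar identification of the socle with the last Tor module over the field.\<close>

lemma top_homology_socle:
  assumes "z \<in> Z s s (n + int s)" "z \<notin> Bd s s (n + int s)"
  obtains m where "m \<in> N s n" "\<not> (\<exists>u\<in>C (Suc 0) n. m = D 0 u)"
  using rho_exists_right[OF _ assms(1)] rho_boundary_iff[of s n z] assms(2) by auto

lemma socle_top_homology:
  assumes "m \<in> N s n" "\<not> (\<exists>u\<in>C (Suc 0) n. m = D 0 u)"
  obtains z where "z \<in> Z s s (n + int s)" "z \<notin> Bd s s (n + int s)"
  using rho_exists_left[OF _ assms(1)] rho_boundary_iff[of s n _ m] assms(2) by auto

text \<open>Lift \<open>f\<close> to a class \<open>z\<close> modulo the first \<open>k\<close>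
  forms. Its image modulo the last form vanishes only if \<open>z\<close> equals \<open>l k\<close>
  times a class \<open>c\<close> up to boundaries, and \<open>c\<close> corresponds to a
  \<open>u\<close> one degree below \<open>f\<close>.\<close>

lemma colon_homology:
  assumes s: "s = Suc k" and f: "f \<in> N k n"
    and nf: "\<And>u. u \<in> N k (n - 1) \<Longrightarrow> \<not> (\<exists>v\<in>C (Suc 0) n. f - l k u = D 0 v)"
  obtains z where "z \<in> Z s k (n + int k)" "z \<notin> Bd s k (n + int k)"
proof -
  let ?j = "n + int k"
  have ks: "k \<le> s" "k < s" using s by auto
  obtain z where z: "z \<in> Z k k ?j" "rho k n z f" using rho_exists_left[OF ks(1) f] by blast
  have "z \<notin> Bd s k ?j"
  proof
    assume "z \<in> Bd s k ?j"
    then obtain v c b where v: "z = D k v + (b + l k c)" "v \<in> C (Suc k) ?j" "b \<in> B k k ?j"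
      "c \<in> C k (?j - 1)" unfolding s Bd_def by auto
    have "D k v + b \<in> Bd k k ?j" using v(2,3) unfolding Bd_def by blast
    moreover have zc: "z - l k c = D k v + b" using v(1) by simp
    ultimately have bd: "z - l k c \<in> Bd k k ?j" by simp
    have "l k c = z - (D k v + b)" using v(1) by simp
    then have lc: "l k c \<in> Z k k ?j"
      using diff_Z[OF z(1) Bd_sub_Z] bd zc by metis
    \<comment> \<open>Since \<open>l k c\<close> is a cycle modulo \<open>B k\<close> and
      \<open>l k\<close> is regular there, \<open>c\<close> is a cycle as well.\<close>
    have "D i' c \<in> B k i' (?j - 1)" if "k = Suc i'" for i'
    proof (rule regular[OF ks(2)])
      show "D i' c \<in> C i' (?j - 1)" using D_C v(4) that by blast
      have "D i' (l k c) \<in> B k i' ?j" using lc that unfolding Z_def by blast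
      then show "l k (D i' c) \<in> B k i' (?j - 1 + 1)" by (simp add: D_l del: B.simps)
    qed
    then have "c \<in> Z k k (n - 1 + int k)" using v(4) by (auto simp: Z_def algebra_simps)
    then obtain u where u: "u \<in> N k (n - 1)" "rho k (n - 1) c u" using rho_exists_right[OF ks(1)] by blast
    have "rho k n (l k c) (l k u)" using rho_l[OF u(2), of k] by simp
    then have "rho k n (z - l k c) (f - l k u)" using rho_diff z(2) by blast
    then show False using rho_boundary_iff[OF ks(1)] bd nf[OF u(1)] by blast
  qed
  moreover have "z \<in> Z s k ?j" unfolding s by (rule Z_Suc_mono[OF z(1)])
  ultimately show ?thesis using that by blast
qed

end

section \<open>The cone of a parameter\<close>

locale minimal_complex = regular_complex C D l s
  for C :: "nat \<Rightarrow> int \<Rightarrow> 'c::ab_group_add set" and D l s +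
  assumes minimal: "x \<in> C (Suc i) j \<Longrightarrow> D i x \<in> B s i j"
begin

text \<open>All differentials vanish modulo the \<open>s\<close> forms, so the homology there is the
  reduced module itself: a nonzero class is a minimal generator.\<close>

lemma minimal_Bd: "z \<in> Bd s i j \<longleftrightarrow> z \<in> B s i j"
  using minimal add_B B_sub_Bd unfolding Bd_def by blast

lemma minimal_Z: "z \<in> Z s i j \<longleftrightarrow> z \<in> C i j"
  using minimal unfolding Z_def by auto

end

text \<open>Two of the assumptions carry the construction: \<open>h_regular\<close>, injectivity of
  \<open>h\<close> on the cokernel of \<open>D 0\<close>, makes the cone exact, and
  \<open>h_B\<close> keeps it minimal.\<close>

locale parameter_complex = minimal_complex C D l s
  for C :: "nat \<Rightarrow> int \<Rightarrow> 'c::ab_group_add set" and D l s +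
  fixes h :: "'c \<Rightarrow> 'c" and e :: int
  assumes h_diff: "h (x - y) = h x - h y"
    and h_D: "h (D i x) = D i (h x)"
    and h_l: "h (l r x) = l r (h x)"
    and h_C: "x \<in> C i j \<Longrightarrow> h x \<in> C i (j + e)"
    and h_B: "x \<in> C i j \<Longrightarrow> h x \<in> B s i (j + e)"
    and h_regular: "x \<in> C 0 j \<Longrightarrow> u \<in> C (Suc 0) (j + e) \<Longrightarrow> h x = D 0 u \<Longrightarrow> \<exists>v\<in>C (Suc 0) j. x = D 0 v"
begin

lemma h_zero [simp]: "h 0 = 0" using h_diff[of 0 0] by simp
lemma h_minus: "h (- x) = - h x" using h_diff[of 0 x] by simp

text \<open>The twist by \<open>e\<close> makes \<open>h\<close> a map of degree zero into the first
  summand. The set \<open>{0}\<close> stands for the missing module in homological degree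
  -1.\<close>

definition cone_C :: "nat \<Rightarrow> int \<Rightarrow> ('c \<times> 'c) set" where
  "cone_C i j = C i j \<times> (case i of 0 \<Rightarrow> {0} | Suc i' \<Rightarrow> C i' (j - e))"

definition cone_D :: "nat \<Rightarrow> 'c \<times> 'c \<Rightarrow> 'c \<times> 'c" where
  "cone_D i z = (D i (fst z) + h (snd z), case i of 0 \<Rightarrow> 0 | Suc i' \<Rightarrow> - D i' (snd z))"

definition cone_l :: "nat \<Rightarrow> 'c \<times> 'c \<Rightarrow> 'c \<times> 'c" where
  "cone_l r z = (l r (fst z), l r (snd z))"

lemma h_C': "x \<in> C i (j - e) \<Longrightarrow> h x \<in> C i j"
  using h_C[of x i "j - e"] by simp

sublocale cone: graded_complex cone_C cone_D cone_l
proof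
  show "0 \<in> cone_C i j" for i j
    by (auto simp: cone_C_def zero_C zero_prod_def split: nat.split)
  show "x - y \<in> cone_C i j" if "x \<in> cone_C i j" "y \<in> cone_C i j" for x y i j
    using that by (cases x; cases y; cases i) (auto simp: cone_C_def diff_C)
  show "cone_D i x \<in> cone_C i j" if "x \<in> cone_C (Suc i) j" for x i j
    using that by (cases i) (auto simp: cone_C_def cone_D_def intro!: add_C minus_C D_C h_C')
  show "cone_l r x \<in> cone_C i (j + 1)" if "x \<in> cone_C i j" for x i j r
  proof -
    have eq: "j + 1 - e = (j - e) + 1" by simp
    show ?thesis using that unfolding cone_C_def cone_l_def eq by (cases i) (auto intro: l_C)
  qed
  show "cone_D i (x - y) = cone_D i x - cone_D i y" for i x y
    by (cases i) (auto simp: cone_D_def D_diff h_diff)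
  show "cone_l r (x - y) = cone_l r x - cone_l r y" for r x y
    by (auto simp: cone_l_def l_diff)
  show "cone_D i (cone_l r x) = cone_l r (cone_D i x)" for i r x
    by (cases i) (auto simp: cone_D_def cone_l_def D_l h_l l_add l_minus)
  show "cone_l q (cone_l r x) = cone_l r (cone_l q x)" for q r x
    by (simp add: cone_l_def l_l[of q r])
qed

lemma cone_B: "cone.B k i j = B k i j \<times> (case i of 0 \<Rightarrow> {0} | Suc i' \<Rightarrow> B k i' (j - e))"
proof (induction k)
  case 0
  then show ?case by (auto simp: zero_prod_def split: nat.split)
next
  case (Suc k)
  show ?case
  proof (cases i)
    case 0
    show ?thesis
    proof (intro Set.set_eqI iffI)
      fix z assume "z \<in> cone.B (Suc k) i j"
      then obtain b w where "z = b + cone_l k w" "b \<in> cone.B k i j" "w \<in> cone_C i (j - 1)" by auto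
      then show "z \<in> B (Suc k) i j \<times> (case i of 0 \<Rightarrow> {0} | Suc i' \<Rightarrow> B (Suc k) i' (j - e))"
        using Suc[unfolded 0] unfolding 0 by (cases b; cases w) (force simp: cone_C_def[of 0] cone_l_def[of k])
    next
      fix z assume "z \<in> B (Suc k) i j \<times> (case i of 0 \<Rightarrow> {0} | Suc i' \<Rightarrow> B (Suc k) i' (j - e))"
      then obtain b w where z: "z = (b + l k w, 0)" "b \<in> B k i j" "w \<in> C i (j - 1)" using 0 by auto
      show "z \<in> cone.B (Suc k) i j"
        by (rule cone.B_SucI[of _ "(b, 0)" k "(w, 0)"]) (use z Suc 0 in \<open>auto simp: cone_C_def[of 0] cone_l_def[of k]\<close>)
    qed
  next
    case (Suc i')
    note i = this
    show ?thesis
    proof (intro Set.set_eqI iffI)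
      fix z assume "z \<in> cone.B (Suc k) i j"
      then obtain b w where "z = b + cone_l k w" "b \<in> cone.B k i j" "w \<in> cone_C i (j - 1)" by auto
      then show "z \<in> B (Suc k) i j \<times> (case i of 0 \<Rightarrow> {0} | Suc i' \<Rightarrow> B (Suc k) i' (j - e))"
        using Suc.IH[unfolded i] unfolding i
        by (cases b; cases w) (force simp: cone_C_def[of "Suc i'"] cone_l_def[of k] algebra_simps)
    next
      fix z assume "z \<in> B (Suc k) i j \<times> (case i of 0 \<Rightarrow> {0} | Suc i' \<Rightarrow> B (Suc k) i' (j - e))"
      then obtain b w b' w' where z: "z = (b + l k w, b' + l k w')" "b \<in> B k i j" "w \<in> C i (j - 1)"
        "b' \<in> B k i' (j - e)" "w' \<in> C i' (j - e - 1)" using i by auto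
      show "z \<in> cone.B (Suc k) i j"
        by (rule cone.B_SucI[of _ "(b, b')" k "(w, w')"])
          (use z Suc.IH i in \<open>auto simp: cone_C_def[of "Suc i'"] cone_l_def[of k] algebra_simps\<close>)
    qed
  qed
qed

sublocale cone: minimal_complex cone_C cone_D cone_l s
proof
  show "cone_D i (cone_D (Suc i) x) = 0" if "x \<in> cone_C (Suc (Suc i)) j" for x i j
    using that by (cases i) (auto simp: cone_C_def cone_D_def zero_prod_def D_add D_minus DD h_D h_minus)
  show "\<exists>y\<in>cone_C (Suc (Suc i)) j. x = cone_D (Suc i) y"
    if "x \<in> cone_C (Suc i) j" "cone_D i x = 0" for x i j
  proof -
    obtain a b where x: "x = (a, b)" by (cases x)
    have a: "a \<in> C (Suc i) j" and b: "b \<in> C i (j - e)" and eq: "D i a + h b = 0"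
      using that by (auto simp: x cone_C_def cone_D_def zero_prod_def)
    \<comment> \<open>The second component is a boundary \<open>D i v\<close>, in degree 0 by
      regularity of \<open>h\<close> and above it by exactness. Then \<open>a + h v\<close> is a
      cycle of the original complex.\<close>
    obtain v where v: "v \<in> C (Suc i) (j - e)" "b = D i v"
    proof (cases i)
      case 0
      have "h b = D 0 (- a)" using eq by (simp add: D_minus 0 eq_neg_iff_add_eq_0 add.commute)
      then show ?thesis using h_regular[of b "j - e" "- a"] minus_C a b that 0 by auto
    next
      case (Suc i')
      then have "D i' b = 0" using \<open>cone_D i x = 0\<close> by (simp add: x cone_D_def zero_prod_def)
      then show ?thesis using exact[of b i' "j - e"] b that Suc by auto
    qed
    have "D i (a + h v) = 0" using eq by (simp add: D_add h_D[symmetric] v(2))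
    moreover have "a + h v \<in> C (Suc i) j" using add_C a h_C' v(1) by blast
    ultimately obtain u where u: "u \<in> C (Suc (Suc i)) j" "a + h v = D (Suc i) u" using exact by blast
    have "x = cone_D (Suc i) (u, - v)"
      by (simp add: x cone_D_def u(2)[symmetric] h_minus D_minus v(2))
    moreover have "(u, - v) \<in> cone_C (Suc (Suc i)) j" using u v(1) minus_C by (auto simp: cone_C_def)
    ultimately show ?thesis by blast
  qed
  show "x \<in> cone.B k i j" if "k < s" "x \<in> cone_C i j" "cone_l k x \<in> cone.B k i (j + 1)" for k x i j
    using that regular[of k "fst x" i j] regular[of k "snd x" "i - 1" "j - e"]
    by (cases i; cases x) (auto simp: cone_B cone_C_def cone_l_def algebra_simps)
  show "cone_D i x \<in> cone.B s i j" if "x \<in> cone_C (Suc i) j" for x i j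
    using that h_B[of "snd x" i "j - e"]
    by (cases i; cases x) (auto simp: cone_B cone_C_def cone_D_def intro!: add_B minus_B minimal)
qed

text \<open>The cone resolves an Artinian quotient: its top degree is a socle degree, hence is read off the
  last Betti numbers, and it bounds the degrees of all the others.\<close>

lemma generator_degree_bound:
  assumes s: "s = Suc k"
    and len: "\<And>j. C s j \<subseteq> B s s j"
    and last: "\<And>j z. z \<in> C k j \<Longrightarrow> z \<notin> B s k j \<Longrightarrow> j = int k + d"
    and artinian: "\<And>j x. j \<ge> M \<Longrightarrow> x \<in> C 0 j \<Longrightarrow> \<exists>u\<in>C (Suc 0) j. \<exists>y\<in>C 0 (j - e). x = D 0 u + h y"
    and z: "z \<in> C i j" "z \<notin> B s i j"
  shows "j - int i \<le> d"
proof -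
  define im where "im n x \<longleftrightarrow> (\<exists>u\<in>cone_C (Suc 0) n. x = cone_D 0 u)" for n x
  have imI: "im n (x, 0)" if "u \<in> C (Suc 0) n" "y \<in> C 0 (n - e)" "x = D 0 u + h y" for n x u y
    unfolding im_def by (rule bexI[of _ "(u, y)"]) (use that in \<open>auto simp: cone_C_def cone_D_def\<close>)
  have art: "im n x" if nM: "n \<ge> M" and xC: "x \<in> cone_C 0 n" for n x
  proof -
    obtain a where a: "x = (a, 0)" "a \<in> C 0 n" using xC by (auto simp: cone_C_def)
    obtain u y where "u \<in> C (Suc 0) n" "y \<in> C 0 (n - e)" "a = D 0 u + h y" using artinian[OF nM a(2)] by blast
    then show ?thesis unfolding a(1) by (rule imI)
  qed
  have top: "im n x" if n: "n > d - 1 + e" "x \<in> cone_C 0 n" for n x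
  proof (rule ccontr)
    assume "\<not> im n x"
    \<comment> \<open>Bad degrees lie below \<open>M\<close>, so there is a largest one,
      \<open>n1\<close>. The forms \<open>l r\<close> send its witness into degree
      \<open>n1 + 1\<close>, where everything is a boundary; the witness is thus a socle
      element.\<close>
    define bad where "bad n \<longleftrightarrow> n > d - 1 + e \<and> (\<exists>x\<in>cone_C 0 n. \<not> im n x)" for n
    have "bad n" using n \<open>\<not> im n x\<close> unfolding bad_def by blast
    have lt: "n' < M" if "bad n'" for n' using that art[of n'] unfolding bad_def by force
    have "finite {n'. n \<le> n' \<and> bad n'}"
      by (rule finite_subset[of _ "{n..M}"]) (auto dest: lt)
    moreover have "n \<in> {n'. n \<le> n' \<and> bad n'}" using \<open>bad n\<close> by simp
    ultimately obtain n1 where n1: "n \<le> n1" "bad n1" "\<And>n'. n \<le> n' \<Longrightarrow> bad n' \<Longrightarrow> n' \<le> n1"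
      using Max_in[of "{n'. n \<le> n' \<and> bad n'}"] Max_ge[of "{n'. n \<le> n' \<and> bad n'}"] by blast
    obtain x1 where x1: "x1 \<in> cone_C 0 n1" "\<not> im n1 x1" using n1(2) unfolding bad_def by blast
    have "\<not> bad (n1 + 1)" using n1(1) n1(3)[of "n1 + 1"] by linarith
    then have "im (n1 + 1) y" if "y \<in> cone_C 0 (n1 + 1)" for y
      using that n1(2) unfolding bad_def by force
    then have "x1 \<in> cone.N s n1"
      unfolding cone.N_def using x1(1) cone.l_C[OF x1(1)] unfolding im_def by blast
    then obtain w where w: "w \<in> cone.Z s s (n1 + int s)" "w \<notin> cone.Bd s s (n1 + int s)"
      using cone.socle_top_homology[of x1 n1] x1(2) unfolding im_def by blast
    then have w': "w \<in> cone_C s (n1 + int s)" "w \<notin> cone.B s s (n1 + int s)"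
      using cone.minimal_Z cone.minimal_Bd by auto
    \<comment> \<open>\<open>C s\<close> has no generators, so the class lives in the shifted copy
      of \<open>C k\<close>. Its generators sit in degree \<open>k + d\<close> only, and
      \<open>s = k + 1\<close> then gives \<open>n1 = d - 1 + e\<close>.\<close>
    then have "snd w \<in> C k (n1 + int s - e)" "snd w \<notin> B s k (n1 + int s - e)"
      using len[of "n1 + int s"] unfolding cone_B cone_C_def s by (cases w; auto)+
    then have "n1 + int s - e = int k + d" by (rule last)
    then show False using n1(2) s unfolding bad_def by simp
  qed
  \<comment> \<open>A generator of \<open>C i\<close> in degree \<open>j\<close> reappears in the
    cone in bidegree \<open>(i + 1, j + e)\<close>. The bound
    \<open>j + e \<le> (d - 1 + e) + (i + 1)\<close> is the claim.\<close>
  have zc: "(0, z) \<in> cone_C (Suc i) (j + e)" using z(1) zero_C by (simp add: cone_C_def)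
  have "(0, z) \<notin> cone.B s (Suc i) (j + e)" using z(2) by (simp add: cone_B)
  then have "(0, z) \<notin> cone.Bd s (Suc i) (j + e)" "(0, z) \<in> cone.Z s (Suc i) (j + e)"
    using cone.minimal_Bd cone.minimal_Z zc by auto
  moreover have "(0, z) \<in> cone.Bd s (Suc i) (j + e)"
    if "j + e > d - 1 + e + int (Suc i)" "(0, z) \<in> cone.Z s (Suc i) (j + e)"
    by (rule cone.acyclic_above_degree[OF _ order_refl that]) (use top im_def in blast)
  ultimately show ?thesis by force
qed

end

section \<open>Ideals\<close>

abbreviation cideal :: "'a::comm_ring_1 set \<Rightarrow> bool" where
  "cideal J \<equiv> ideal J class_ring"

abbreviation cprime :: "'a::comm_ring_1 set \<Rightarrow> bool" where
  "cprime P \<equiv> primeideal P class_ring"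

abbreviation gen :: "'a::comm_ring_1 set \<Rightarrow> 'a set" where
  "gen A \<equiv> Idl\<^bsub>class_ring\<^esub> A"

lemma cideal_iff:
  "cideal J \<longleftrightarrow> 0 \<in> J \<and> (\<forall>x\<in>J. \<forall>y\<in>J. x + y \<in> J) \<and> (\<forall>x\<in>J. \<forall>r. r * x \<in> J)"
proof
  assume "cideal J"
  then interpret ideal J class_ring .
  show "0 \<in> J \<and> (\<forall>x\<in>J. \<forall>y\<in>J. x + y \<in> J) \<and> (\<forall>x\<in>J. \<forall>r. r * x \<in> J)"
    using zero_closed a_closed I_l_closed by auto
next
  assume J: "0 \<in> J \<and> (\<forall>x\<in>J. \<forall>y\<in>J. x + y \<in> J) \<and> (\<forall>x\<in>J. \<forall>r. r * x \<in> J)"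
  then have neg: "- x \<in> J" if "x \<in> J" for x using that by (metis mult_minus1)
  show "cideal J"
  proof (rule idealI)
    show "ring (class_ring :: 'a ring)" by (rule class_ring.ring_axioms)
    show "subgroup J (add_monoid (class_ring :: 'a ring))"
    proof (rule group.subgroupI)
      show "group (add_monoid (class_ring :: 'a ring))" by (rule abelian_group.a_group[OF class_ring.is_abelian_group])
      show "inv\<^bsub>add_monoid class_ring\<^esub> a \<in> J" if "a \<in> J" for a
      proof -
        have "\<ominus>\<^bsub>class_ring\<^esub> a = - a" by (metis matrix_vs_simps(14))
        then show ?thesis using neg that unfolding a_inv_def by simp
      qed
    qed (use J in auto)
  qed (use J in \<open>auto simp: mult.commute\<close>)
qed

lemma cideal_0: "cideal J \<Longrightarrow> 0 \<in> J"
  and cideal_add: "cideal J \<Longrightarrow> x \<in> J \<Longrightarrow> y \<in> J \<Longrightarrow> x + y \<in> J"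
  and cideal_mult: "cideal J \<Longrightarrow> x \<in> J \<Longrightarrow> r * x \<in> J"
  by (auto simp: cideal_iff)

lemma cideal_mult': "cideal J \<Longrightarrow> x \<in> J \<Longrightarrow> x * r \<in> J"
  using cideal_mult[of J x r] by (simp add: mult.commute)

lemma cideal_uminus: "cideal J \<Longrightarrow> x \<in> J \<Longrightarrow> - x \<in> J"
  using cideal_mult[of J x "- 1"] by simp

lemma cideal_diff: "cideal J \<Longrightarrow> x \<in> J \<Longrightarrow> y \<in> J \<Longrightarrow> x - y \<in> J"
  using cideal_add[of J x "- y"] cideal_uminus[of J y] by simp

lemma cideal_sum: "cideal J \<Longrightarrow> (\<And>i. i \<in> A \<Longrightarrow> f i \<in> J) \<Longrightarrow> sum f A \<in> J"
  by (induction A rule: infinite_finite_induct) (auto intro: cideal_0 cideal_add)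

lemma cideal_one: "cideal J \<Longrightarrow> 1 \<in> J \<Longrightarrow> J = UNIV"
  using cideal_mult[of J 1] by auto

lemma cideal_cong: "cideal J \<Longrightarrow> a - b \<in> J \<Longrightarrow> a \<in> J \<longleftrightarrow> b \<in> J"
  using cideal_add[of J "a - b" b] cideal_diff[of J a "a - b"] by auto

lemma cprime_iff:
  "cprime P \<longleftrightarrow> cideal P \<and> 1 \<notin> P \<and> (\<forall>a b. a * b \<in> P \<longrightarrow> a \<in> P \<or> b \<in> P)"
proof
  assume P: "cprime P"
  then interpret primeideal P class_ring .
  show "cideal P \<and> 1 \<notin> P \<and> (\<forall>a b. a * b \<in> P \<longrightarrow> a \<in> P \<or> b \<in> P)"
    using I_prime I_notcarr is_ideal cideal_one[of P] by auto
next
  assume "cideal P \<and> 1 \<notin> P \<and> (\<forall>a b. a * b \<in> P \<longrightarrow> a \<in> P \<or> b \<in> P)"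
  then show "cprime P"
    by (intro primeidealI) (auto intro: class_cring.is_cring)
qed

lemma cprime_ideal: "cprime P \<Longrightarrow> cideal P"
  by (simp add: cprime_iff)

lemma cprime_power: "cprime P \<Longrightarrow> a ^ n \<in> P \<Longrightarrow> a \<in> P"
  by (induction n) (auto simp: cprime_iff)

lemma cideal_gen: "cideal (gen A)"
  by (rule ring.genideal_ideal[OF class_ring.ring_axioms]) simp

lemma gen_incl: "a \<in> A \<Longrightarrow> a \<in> gen A"
  using ring.genideal_self[OF class_ring.ring_axioms, of A] by auto

lemma gen_minimal: "cideal J \<Longrightarrow> A \<subseteq> J \<Longrightarrow> gen A \<subseteq> J"
  by (rule ring.genideal_minimal[OF class_ring.ring_axioms])

lemma cideal_sum_principal:
  assumes "cideal J"
  shows "cideal {r * a + j | r j. j \<in> J}"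
  unfolding cideal_iff
proof (intro conjI ballI allI)
  have "0 = 0 * a + 0" by simp
  then show "0 \<in> {r * a + j | r j. j \<in> J}" using cideal_0[OF assms] by blast
next
  fix x y assume "x \<in> {r * a + j | r j. j \<in> J}" "y \<in> {r * a + j | r j. j \<in> J}"
  then obtain r j r' j' where *: "x = r * a + j" "y = r' * a + j'" "j \<in> J" "j' \<in> J" by blast
  have "x + y = (r + r') * a + (j + j')" by (simp add: * algebra_simps)
  then show "x + y \<in> {r * a + j | r j. j \<in> J}" using cideal_add[OF assms *(3,4)] by blast
next
  fix x t assume "x \<in> {r * a + j | r j. j \<in> J}"
  then obtain r j where *: "x = r * a + j" "j \<in> J" by blast
  have "t * x = (t * r) * a + t * j" by (simp add: * algebra_simps)
  then show "t * x \<in> {r * a + j | r j. j \<in> J}" using cideal_mult[OF assms *(2)] by blast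
qed

lemma cideal_colon: "cideal J \<Longrightarrow> cideal (colon J f)"
  unfolding colon_def cideal_iff by (auto simp: distrib_right mult.assoc)

lemma colon_UNIV_iff: "cideal J \<Longrightarrow> colon J f = UNIV \<longleftrightarrow> f \<in> J"
  unfolding colon_def using cideal_mult by (metis (mono_tags) UNIV_I UNIV_eq_I mem_Collect_eq mult_1)

lemma colon_incl: "cideal J \<Longrightarrow> J \<subseteq> colon J f"
  unfolding colon_def using cideal_mult' by blast

section \<open>Polynomials\<close>

abbreviation cst :: "'k::field \<Rightarrow> ('n::finite, 'k) mpol" where
  "cst c \<equiv> Poly_Mapping.single 0 c"

lemma mpol_eq_sum:
  fixes f :: "('n::finite, 'k::field) mpol"
  assumes "finite X" "Poly_Mapping.keys f \<subseteq> X"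
  shows "f = (\<Sum>m\<in>X. Poly_Mapping.single m (Poly_Mapping.lookup f m))"
proof (rule poly_mapping_eqI)
  fix k
  have "Poly_Mapping.lookup (\<Sum>m\<in>X. Poly_Mapping.single m (Poly_Mapping.lookup f m)) k =
      (\<Sum>m\<in>X. if m = k then Poly_Mapping.lookup f m else 0)"
    by (simp add: lookup_sum lookup_single when_def)
  also have "\<dots> = Poly_Mapping.lookup f k"
    using assms by (auto simp: in_keys_iff)
  finally show "Poly_Mapping.lookup f k = Poly_Mapping.lookup
      (\<Sum>m\<in>X. Poly_Mapping.single m (Poly_Mapping.lookup f m)) k" by simp
qed

lemmas mpol_eq_sum_keys = mpol_eq_sum[OF finite_keys order_refl]

lemma mpol_mult_sum:
  fixes f g :: "('n::finite, 'k::field) mpol"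
  shows "f * g = (\<Sum>a\<in>Poly_Mapping.keys f. \<Sum>b\<in>Poly_Mapping.keys g.
    Poly_Mapping.single (a + b) (Poly_Mapping.lookup f a * Poly_Mapping.lookup g b))"
proof -
  have "f * g = (\<Sum>a\<in>Poly_Mapping.keys f. Poly_Mapping.single a (Poly_Mapping.lookup f a)) *
      (\<Sum>b\<in>Poly_Mapping.keys g. Poly_Mapping.single b (Poly_Mapping.lookup g b))"
    using mpol_eq_sum_keys[of f] mpol_eq_sum_keys[of g] by simp
  then show ?thesis by (simp add: sum_product mult_single)
qed

lemma lookup_mult_sum:
  fixes f g :: "('n::finite, 'k::field) mpol"
  shows "Poly_Mapping.lookup (f * g) k = (\<Sum>a\<in>Poly_Mapping.keys f. \<Sum>b\<in>Poly_Mapping.keys g.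
    if a + b = k then Poly_Mapping.lookup f a * Poly_Mapping.lookup g b else 0)"
  unfolding mpol_mult_sum lookup_sum by (simp add: lookup_single when_def)

lemma single_sum_exponent:
  "finite A \<Longrightarrow> Poly_Mapping.single (\<Sum>i\<in>A. e i) (1::'k::field) =
     (\<Prod>i\<in>A. Poly_Mapping.single (e i :: 'n::finite \<Rightarrow>\<^sub>0 nat) 1)"
proof (induction A rule: finite_induct)
  case (insert x F)
  then show ?case using mult_single[of "e x" "1::'k" "sum e F" 1] by simp
qed simp

lemma variable_power:
  "(variable i :: ('n::finite, 'k::field) mpol) ^ e =
     Poly_Mapping.single (Poly_Mapping.single i e) 1"
  by (induction e) (auto simp: variable_def mult_single single_add[symmetric])

lemma single_eq_prod:
  fixes m :: "'n::finite \<Rightarrow>\<^sub>0 nat"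
  shows "Poly_Mapping.single m (c::'k::field) =
    cst c * (\<Prod>i\<in>UNIV. variable i ^ Poly_Mapping.lookup m i)"
proof -
  have "m = (\<Sum>i\<in>UNIV. Poly_Mapping.single i (Poly_Mapping.lookup m i))"
    by (rule poly_mapping_eqI) (simp add: lookup_sum lookup_single when_def)
  then have "Poly_Mapping.single m (1::'k) =
      (\<Prod>i\<in>UNIV. Poly_Mapping.single (Poly_Mapping.single i (Poly_Mapping.lookup m i)) 1)"
    using single_sum_exponent[OF finite, of "\<lambda>i. Poly_Mapping.single i (Poly_Mapping.lookup m i)" UNIV]
    by simp
  then have "cst c * (\<Prod>i\<in>UNIV. variable i ^ Poly_Mapping.lookup m i) = cst c * Poly_Mapping.single m 1"
    by (simp add: variable_power)
  then show ?thesis by (simp add: mult_single)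
qed

lemma mpol_induct [case_names cst var add mult]:
  fixes f :: "('n::finite, 'k::field) mpol"
  assumes cst: "\<And>c. P (cst c)" and var: "\<And>i. P (variable i)"
    and add: "\<And>f g. P f \<Longrightarrow> P g \<Longrightarrow> P (f + g)" and mult: "\<And>f g. P f \<Longrightarrow> P g \<Longrightarrow> P (f * g)"
  shows "P f"
proof -
  have one: "P 1" using cst[of 1] by simp
  have zero: "P 0" using cst[of 0] by simp
  have pow: "P (variable i ^ e)" for i e
    by (induction e) (auto intro: one mult var)
  have prod: "P (\<Prod>i\<in>A. variable i ^ e i)" for A :: "'n set" and e
    by (induction A rule: infinite_finite_induct) (auto intro: one mult pow)
  have "P (Poly_Mapping.single m c)" for m c
    unfolding single_eq_prod[of m c] by (intro mult cst prod)
  then have "P (\<Sum>m\<in>X. Poly_Mapping.single m (Poly_Mapping.lookup f m))" for X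
    by (induction X rule: infinite_finite_induct) (simp_all add: zero add)
  then show ?thesis using mpol_eq_sum_keys[of f] by metis
qed

definition subst :: "('n::finite \<Rightarrow> ('n, 'k::field) mpol) \<Rightarrow> ('n, 'k) mpol \<Rightarrow> ('n, 'k) mpol" where
  "subst a f = (\<Sum>m\<in>Poly_Mapping.keys f.
     cst (Poly_Mapping.lookup f m) * (\<Prod>i\<in>UNIV. a i ^ Poly_Mapping.lookup m i))"

lemma subst_eq:
  assumes "finite X" "Poly_Mapping.keys f \<subseteq> X"
  shows "subst a f = (\<Sum>m\<in>X. cst (Poly_Mapping.lookup f m) * (\<Prod>i\<in>UNIV. a i ^ Poly_Mapping.lookup m i))"
  unfolding subst_def by (rule sum.mono_neutral_left) (use assms in \<open>auto simp: in_keys_iff\<close>)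

lemma subst_add: "subst a (f + g) = subst a f + subst a g"
proof -
  let ?X = "Poly_Mapping.keys f \<union> Poly_Mapping.keys g"
  have "finite ?X" "Poly_Mapping.keys (f + g) \<subseteq> ?X" by (auto simp: keys_add)
  then show ?thesis
    using subst_eq[of ?X f a] subst_eq[of ?X g a] subst_eq[of ?X "f + g" a]
    by (simp add: lookup_add single_add distrib_right sum.distrib)
qed

lemma subst_single: "subst a (Poly_Mapping.single m c) = cst c * (\<Prod>i\<in>UNIV. a i ^ Poly_Mapping.lookup m i)"
  by (cases "c = 0") (auto simp: subst_def)

lemma subst_cst [simp]: "subst a (cst c) = cst c"
  by (simp add: subst_single)

lemma subst_0 [simp]: "subst a 0 = 0"
  using subst_cst[of a 0] by simp

lemma subst_1 [simp]: "subst a 1 = 1"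
  using subst_cst[of a 1] by simp

lemma subst_sum: "subst a (sum f A) = (\<Sum>x\<in>A. subst a (f x))"
  by (induction A rule: infinite_finite_induct) (auto simp: subst_add)

lemma subst_mult: "subst a (f * g) = subst a f * subst a g"
proof -
  have *: "subst a (Poly_Mapping.single m (c * d) ) = subst a (Poly_Mapping.single m1 c) * subst a (Poly_Mapping.single m2 d)"
    if "m = m1 + m2" for m m1 m2 c d
  proof -
    have "cst (c * d) = cst c * (cst d :: ('a, 'b) mpol)" by (simp add: mult_single)
    then show ?thesis unfolding subst_single that by (simp add: lookup_add power_add prod.distrib)
  qed
  have "subst a (f * g) = (\<Sum>m1\<in>Poly_Mapping.keys f. \<Sum>m2\<in>Poly_Mapping.keys g.
      subst a (Poly_Mapping.single m1 (Poly_Mapping.lookup f m1)) *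
      subst a (Poly_Mapping.single m2 (Poly_Mapping.lookup g m2)))"
    unfolding mpol_mult_sum[of f g] subst_sum *[OF refl] ..
  also have "\<dots> = subst a f * subst a g"
    unfolding subst_def[of a f] subst_def[of a g] sum_product subst_single ..
  finally show ?thesis .
qed

lemma subst_variable [simp]: "subst a (variable i) = a i"
proof -
  have "(\<Prod>j\<in>UNIV. a j ^ Poly_Mapping.lookup (Poly_Mapping.single i (Suc 0)) j) =
      (\<Prod>j\<in>UNIV. if j = i then a j else 1)"
    by (intro prod.cong) (auto simp: lookup_single)
  then show ?thesis by (simp add: variable_def subst_single)
qed

lemma subst_uminus: "subst a (- f) = - subst a f"
  using subst_add[of a f "- f"] by (simp add: eq_neg_iff_add_eq_0 add.commute)

lemma subst_diff: "subst a (f - g) = subst a f - subst a g"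
  using subst_add[of a f "- g"] by (simp add: subst_uminus)

text \<open>The substitution is the identity modulo \<open>J\<close> on the algebra generators,
  hence everywhere. If it also kills generators of \<open>J\<close>, then \<open>J\<close> is
  exactly its kernel.\<close>

lemma subst_congruent:
  assumes J: "cideal J" and a: "\<And>i. variable i - a i \<in> J"
  shows "f - subst a f \<in> J"
proof (induction f rule: mpol_induct)
  case (add f g)
  have "f + g - subst a (f + g) = (f - subst a f) + (g - subst a g)" by (simp add: subst_add)
  then show ?case using cideal_add[OF J add] by presburger
next
  case (mult f g)
  have "f * g - subst a (f * g) = g * (f - subst a f) + subst a f * (g - subst a g)"
    by (simp add: subst_mult algebra_simps)
  then show ?case using cideal_add[OF J] cideal_mult[OF J] mult by presburger
qed (use a cideal_0[OF J] in auto)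

subsection \<open>A monomial order\<close>

text \<open>Comparing the numbers \<open>\<Prod>\<^sub>i p\<^sub>i\<^bsup>m\<^sub>i\<^esup>\<close> for distinct primes \<open>p\<^sub>i\<close> orders the monomials: this is a
  multiplicative well-order by unique factorization.\<close>

lemma monomial_key_exists:
  "\<exists>key :: ('n::finite \<Rightarrow>\<^sub>0 nat) \<Rightarrow> nat. inj key \<and> (\<forall>a b. key (a + b) = key a * key b) \<and> (\<forall>a. key a > 0)"
proof -
  obtain A where A: "A \<subseteq> {p::nat. prime p}" "card A = card (UNIV :: 'n set)" "finite A"
    using infinite_arbitrarily_large[OF primes_infinite] by blast
  then obtain p :: "'n \<Rightarrow> nat" where p: "bij_betw p UNIV A"
    by (metis finite finite_same_card_bij)
  define key :: "('n \<Rightarrow>\<^sub>0 nat) \<Rightarrow> nat" where "key m = (\<Prod>i\<in>UNIV. p i ^ Poly_Mapping.lookup m i)" for m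
  have prime: "prime (p i)" for i using p A unfolding bij_betw_def by auto
  have inj: "inj p" using p unfolding bij_betw_def by auto
  have mult: "multiplicity (p i) (key m) = Poly_Mapping.lookup m i" for m i
  proof -
    have "key m = (\<Prod>q\<in>A. q ^ Poly_Mapping.lookup m (inv_into UNIV p q))"
      unfolding key_def using prod.reindex_bij_betw[OF p, of "\<lambda>q. q ^ Poly_Mapping.lookup m (inv_into UNIV p q)"]
      by (simp add: inv_into_f_f[OF inj])
    moreover have "multiplicity (p i) (\<Prod>q\<in>A. q ^ Poly_Mapping.lookup m (inv_into UNIV p q)) =
        (if p i \<in> A then Poly_Mapping.lookup m (inv_into UNIV p (p i)) else 0)"
      by (rule multiplicity_prod_prime_powers) (use A prime in auto)
    ultimately show ?thesis using p by (auto simp: inv_into_f_f[OF inj] bij_betw_def)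
  qed
  have "inj key"
  proof (rule injI)
    fix a b assume "key a = key b"
    then show "a = b" using mult[of _ a] mult[of _ b] by (intro poly_mapping_eqI) metis
  qed
  moreover have "key (a + b) = key a * key b" for a b
    by (simp add: key_def lookup_add power_add prod.distrib)
  moreover have "key a > 0" for a
    unfolding key_def using prime prime_gt_0_nat by (intro prod_pos) auto
  ultimately show ?thesis by blast
qed

definition monomial_key :: "('n::finite \<Rightarrow>\<^sub>0 nat) \<Rightarrow> nat" where
  "monomial_key = (SOME key. inj key \<and> (\<forall>a b. key (a + b) = key a * key b) \<and> (\<forall>a. key a > 0))"

lemma monomial_key:
  "inj monomial_key" "monomial_key (a + b) = monomial_key a * monomial_key b" "monomial_key a > 0"
  using someI_ex[OF monomial_key_exists] unfolding monomial_key_def by blast+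

definition lead :: "('n::finite, 'k::field) mpol \<Rightarrow> 'n \<Rightarrow>\<^sub>0 nat" where
  "lead f = arg_max_on monomial_key (Poly_Mapping.keys f)"

lemma lead_in_keys: "f \<noteq> 0 \<Longrightarrow> lead f \<in> Poly_Mapping.keys f"
  and lead_max: "m \<in> Poly_Mapping.keys f \<Longrightarrow> monomial_key m \<le> monomial_key (lead f)"
proof -
  have *: "\<exists>a\<in>Poly_Mapping.keys f. \<forall>m\<in>Poly_Mapping.keys f. monomial_key m \<le> monomial_key a" if "f \<noteq> 0"
  proof -
    let ?M = "monomial_key ` Poly_Mapping.keys f"
    have "Max ?M \<in> ?M" using that by (intro Max_in) auto
    then obtain a where "a \<in> Poly_Mapping.keys f" "Max ?M = monomial_key a" by auto
    then show ?thesis using Max_ge[of ?M] by (metis finite_imageI finite_keys imageI)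
  qed
  have "lead f \<in> Poly_Mapping.keys f \<and> (\<forall>m\<in>Poly_Mapping.keys f. monomial_key m \<le> monomial_key (lead f))"
    if "f \<noteq> 0"
    unfolding lead_def arg_max_on_def arg_max_def is_arg_max_linorder
    by (rule someI2_ex) (use *[OF that] in auto)
  then show "f \<noteq> 0 \<Longrightarrow> lead f \<in> Poly_Mapping.keys f"
    "m \<in> Poly_Mapping.keys f \<Longrightarrow> monomial_key m \<le> monomial_key (lead f)" by (auto, force)
qed

text \<open>Keys are multiplicative and positive, so a pair with a smaller first key cannot reach
  the product of the two largest keys: only the two leading exponents contribute.\<close>

lemma lookup_mult_lead:
  assumes "f \<noteq> 0" "g \<noteq> 0"
  shows "Poly_Mapping.lookup (f * g) (lead f + lead g) =
    Poly_Mapping.lookup f (lead f) * Poly_Mapping.lookup g (lead g)"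
proof -
  have eq: "a = lead f \<and> b = lead g"
    if "a \<in> Poly_Mapping.keys f" "b \<in> Poly_Mapping.keys g" "a + b = lead f + lead g" for a b
  proof -
    have le: "monomial_key a \<le> monomial_key (lead f)" "monomial_key b \<le> monomial_key (lead g)"
      using lead_max that by auto
    have prod: "monomial_key a * monomial_key b = monomial_key (lead f) * monomial_key (lead g)"
      using that(3) monomial_key(2) by metis
    have "monomial_key a = monomial_key (lead f)"
    proof (rule ccontr)
      assume "monomial_key a \<noteq> monomial_key (lead f)"
      then have "monomial_key a * monomial_key b < monomial_key (lead f) * monomial_key (lead g)"
        using le monomial_key(3) by (intro mult_less_le_imp_less) auto
      then show False using prod by simp
    qed
    then have "a = lead f" using injD[OF monomial_key(1)] by blast
    then show ?thesis using that(3) by simp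
  qed
  have "Poly_Mapping.lookup (f * g) (lead f + lead g) =
    (\<Sum>a\<in>Poly_Mapping.keys f. \<Sum>b\<in>Poly_Mapping.keys g. if a = lead f \<and> b = lead g
       then Poly_Mapping.lookup f a * Poly_Mapping.lookup g b else 0)"
    unfolding lookup_mult_sum by (intro sum.cong refl) (use eq in auto)
  also have "\<dots> = (\<Sum>a\<in>Poly_Mapping.keys f. if a = lead f then (\<Sum>b\<in>Poly_Mapping.keys g. if b = lead g
       then Poly_Mapping.lookup f a * Poly_Mapping.lookup g b else 0) else 0)"
    by (intro sum.cong refl) auto
  also have "\<dots> = Poly_Mapping.lookup f (lead f) * Poly_Mapping.lookup g (lead g)"
    using lead_in_keys[OF assms(1)] lead_in_keys[OF assms(2)] by simp
  finally show ?thesis .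
qed

lemma mpol_mult_eq_0:
  fixes f g :: "('n::finite, 'k::field) mpol"
  shows "f * g = 0 \<longleftrightarrow> f = 0 \<or> g = 0"
proof (rule iffI, rule ccontr)
  assume "f * g = 0" and fg: "\<not> (f = 0 \<or> g = 0)"
  then have "Poly_Mapping.lookup f (lead f) * Poly_Mapping.lookup g (lead g) = 0"
    using lookup_mult_lead[of f g] by simp
  then show False using fg lead_in_keys by (auto simp: in_keys_iff)
qed auto

text \<open>A substitution is an endomorphism of a domain. All primes generated by linear forms are
  presented in this way below.\<close>

lemma cprime_subst_kernel: "cprime {f. subst a f = 0}"
  unfolding cprime_iff cideal_iff by (auto simp: subst_add subst_mult mpol_mult_eq_0)

subsection \<open>The grading\<close>

lemma total_deg_add: "total_deg (a + b) = total_deg a + total_deg b"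
  by (simp add: total_deg_def lookup_add sum.distrib)

lemma total_deg_0_iff: "total_deg m = 0 \<longleftrightarrow> m = 0"
  by (auto simp: total_deg_def intro: poly_mapping_eqI)

lemma total_deg_single: "total_deg (Poly_Mapping.single i e) = e"
  by (simp add: total_deg_def lookup_single when_def)

lemma graded_piece_0: "0 \<in> graded_piece d"
  by (simp add: graded_piece_def)

lemma graded_piece_add: "f \<in> graded_piece d \<Longrightarrow> g \<in> graded_piece d \<Longrightarrow> f + g \<in> graded_piece d"
  using keys_add[of f g] by (auto simp: graded_piece_def)

lemma graded_piece_uminus: "f \<in> graded_piece d \<Longrightarrow> - f \<in> graded_piece d"
  by (auto simp: graded_piece_def in_keys_iff)

lemma graded_piece_diff: "f \<in> graded_piece d \<Longrightarrow> g \<in> graded_piece d \<Longrightarrow> f - g \<in> graded_piece d"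
  using graded_piece_add[of f d "- g"] graded_piece_uminus[of g d] by simp

lemma graded_piece_mult: "f \<in> graded_piece d \<Longrightarrow> g \<in> graded_piece e \<Longrightarrow> f * g \<in> graded_piece (d + e)"
  using keys_mult[of f g] by (fastforce simp: graded_piece_def total_deg_add)

lemma graded_piece_sum: "(\<And>i. i \<in> A \<Longrightarrow> f i \<in> graded_piece d) \<Longrightarrow> sum f A \<in> graded_piece d"
  by (induction A rule: infinite_finite_induct) (auto intro: graded_piece_0 graded_piece_add)

lemma graded_piece_cst: "cst c \<in> graded_piece 0"
  by (cases "c = 0") (auto simp: graded_piece_def total_deg_0_iff)

lemma graded_piece_variable: "variable i \<in> graded_piece 1"
  by (simp add: graded_piece_def variable_def total_deg_single)

lemma graded_piece_power: "f \<in> graded_piece d \<Longrightarrow> f ^ n \<in> graded_piece (d * int n)"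
proof (induction n)
  case 0
  show ?case using graded_piece_cst[of 1] by simp
next
  case (Suc n)
  then show ?case using graded_piece_mult[of f d "f ^ n" "d * int n"] by (simp add: algebra_simps)
qed

lemma graded_piece_neg: "d < 0 \<Longrightarrow> f \<in> graded_piece d \<Longrightarrow> f = 0"
  unfolding graded_piece_def using keys_eq_empty[of f] by fastforce

lemma graded_piece_zero_cst: "f \<in> graded_piece 0 \<Longrightarrow> f = cst (Poly_Mapping.lookup f 0)"
  by (rule poly_mapping_eqI)
    (auto simp: graded_piece_def total_deg_0_iff lookup_single when_def in_keys_iff)

text \<open>An integer index is needed for differences such as \<open>d - e\<close>, which occur in
  products and in the twists of a resolution; negative degrees give 0.\<close>

definition hpart :: "int \<Rightarrow> ('n::finite, 'k::field) mpol \<Rightarrow> ('n, 'k) mpol" where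
  "hpart d f = (\<Sum>m | m \<in> Poly_Mapping.keys f \<and> int (total_deg m) = d.
        Poly_Mapping.single m (Poly_Mapping.lookup f m))"

lemma hom_component_hpart: "hom_component d f = hpart (int d) f"
  by (simp add: hom_component_def hpart_def)

lemma lookup_hpart:
  "Poly_Mapping.lookup (hpart d f) m = (if int (total_deg m) = d then Poly_Mapping.lookup f m else 0)"
  unfolding hpart_def lookup_sum
  by (simp add: lookup_single when_def) (auto simp: in_keys_iff sum.delta' sum.delta)

lemma hpart_graded: "hpart d f \<in> graded_piece d"
  by (auto simp: graded_piece_def in_keys_iff lookup_hpart split: if_splits)

lemma hpart_same: "f \<in> graded_piece d \<Longrightarrow> hpart d f = f"
  by (rule poly_mapping_eqI) (auto simp: lookup_hpart graded_piece_def in_keys_iff)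

lemma hpart_other: "f \<in> graded_piece e \<Longrightarrow> d \<noteq> e \<Longrightarrow> hpart d f = 0"
  by (rule poly_mapping_eqI) (auto simp: lookup_hpart graded_piece_def in_keys_iff)

lemma hpart_add: "hpart d (f + g) = hpart d f + hpart d g"
  by (rule poly_mapping_eqI) (auto simp: lookup_hpart lookup_add)

lemma hpart_0 [simp]: "hpart d 0 = 0"
  by (rule poly_mapping_eqI) (auto simp: lookup_hpart)

lemma hpart_sum: "hpart d (sum f A) = (\<Sum>x\<in>A. hpart d (f x))"
  by (induction A rule: infinite_finite_induct) (auto simp: hpart_add)

lemma sum_hpart:
  obtains E where "finite E" "f = (\<Sum>e\<in>E. hpart (int e) f)"
proof -
  define E where "E = total_deg ` Poly_Mapping.keys f"
  have "f = (\<Sum>e\<in>E. hpart (int e) f)"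
    by (rule poly_mapping_eqI) (auto simp: E_def lookup_sum lookup_hpart in_keys_iff)
  then show ?thesis using that[of E] by (simp add: E_def)
qed

lemma hpart_mult:
  assumes "a \<in> graded_piece e"
  shows "hpart d (a * f) = a * hpart (d - e) f"
proof -
  obtain E where E: "finite E" "f = (\<Sum>n\<in>E. hpart (int n) f)" by (rule sum_hpart)
  have "hpart d (a * hpart (int n) f) = a * hpart (d - e) (hpart (int n) f)" for n
  proof (cases "int n = d - e")
    case True
    then have "a * hpart (int n) f \<in> graded_piece d"
      using graded_piece_mult[OF assms hpart_graded, of "int n" f] by simp
    then show ?thesis using True hpart_same hpart_graded by metis
  next
    case False
    then show ?thesis
      using graded_piece_mult[OF assms hpart_graded, of "int n" f]
      by (simp add: hpart_other[OF hpart_graded] hpart_other)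
  qed
  then have "hpart d (a * (\<Sum>n\<in>E. hpart (int n) f)) = a * hpart (d - e) (\<Sum>n\<in>E. hpart (int n) f)"
    by (simp add: sum_distrib_left hpart_sum)
  then show ?thesis using E(2) by simp
qed

lemma graded_ideal_hpart: "graded_ideal I \<Longrightarrow> f \<in> I \<Longrightarrow> hpart d f \<in> I"
proof (cases "d \<ge> 0")
  case True
  assume "graded_ideal I" "f \<in> I"
  then have "hpart (int (nat d)) f \<in> I" unfolding graded_ideal_def hom_component_hpart by blast
  then show ?thesis using True by simp
next
  case False
  assume "graded_ideal I"
  then show ?thesis using graded_piece_neg[OF _ hpart_graded, of d f] False
    by (simp add: graded_ideal_def cideal_0)
qed

lemma linear_form:
  assumes "f \<in> graded_piece 1"
  obtains c where "f = (\<Sum>i\<in>UNIV. cst (c i) * variable i)"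
proof -
  define X where "X = range (\<lambda>i::'a. Poly_Mapping.single i (1::nat))"
  have "m \<in> X" if m: "m \<in> Poly_Mapping.keys f" for m
  proof -
    have deg: "total_deg m = 1" using assms m by (auto simp: graded_piece_def)
    then obtain i where i: "Poly_Mapping.lookup m i \<noteq> 0" unfolding total_deg_def
      by (metis sum.neutral zero_neq_one)
    have split: "total_deg m = Poly_Mapping.lookup m i + (\<Sum>j\<in>UNIV - {i}. Poly_Mapping.lookup m j)"
      unfolding total_deg_def by (rule sum.remove) auto
    then have "Poly_Mapping.lookup m i = 1" "(\<Sum>j\<in>UNIV - {i}. Poly_Mapping.lookup m j) = 0"
      using i deg by linarith+
    then have "m = Poly_Mapping.single i 1"
      by (intro poly_mapping_eqI) (auto simp: lookup_single when_def)
    then show ?thesis unfolding X_def by auto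
  qed
  then have "f = (\<Sum>m\<in>X. Poly_Mapping.single m (Poly_Mapping.lookup f m))"
    by (intro mpol_eq_sum) (auto simp: X_def)
  also have "\<dots> = (\<Sum>i\<in>UNIV. Poly_Mapping.single (Poly_Mapping.single i 1) (Poly_Mapping.lookup f (Poly_Mapping.single i 1)))"
    unfolding X_def by (subst sum.reindex) (auto intro!: inj_onI dest: arg_cong[where f = Poly_Mapping.keys])
  also have "\<dots> = (\<Sum>i\<in>UNIV. cst (Poly_Mapping.lookup f (Poly_Mapping.single i 1)) * variable i)"
    by (simp add: variable_def mult_single)
  finally show ?thesis using that[of "\<lambda>i. Poly_Mapping.lookup f (Poly_Mapping.single i 1)"] by simp
qed

lemma irrelevant_iff:
  fixes f :: "('n::finite, 'k::field) mpol"
  shows "f \<in> irrelevant_ideal \<longleftrightarrow> Poly_Mapping.lookup f 0 = 0"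
proof -
  have eq: "subst (\<lambda>i. 0) f = cst (Poly_Mapping.lookup f 0)" for f :: "('n, 'k) mpol"
  proof -
    have "(\<Prod>i\<in>UNIV. (0::('n, 'k) mpol) ^ Poly_Mapping.lookup m i) = (if m = 0 then 1 else 0)"
      for m :: "'n \<Rightarrow>\<^sub>0 nat"
    proof (cases "m = 0")
      case False
      then obtain i where "Poly_Mapping.lookup m i \<noteq> 0" by (metis lookup_zero poly_mapping_eqI)
      then have "(0::('n, 'k) mpol) ^ Poly_Mapping.lookup m i = 0" by (simp add: power_0_left)
      then have "(\<Prod>i\<in>UNIV. (0::('n, 'k) mpol) ^ Poly_Mapping.lookup m i) = 0"
        by (intro prod_zero[OF finite] bexI[of _ i]) simp_all
      then show ?thesis using False by simp
    qed auto
    then show ?thesis unfolding subst_def by (auto simp: in_keys_iff if_distrib[of "(*) _"] cong: if_cong)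
  qed
  have "irrelevant_ideal = {f :: ('n, 'k) mpol. subst (\<lambda>i. 0) f = 0}"
  proof
    show "irrelevant_ideal \<subseteq> {f :: ('n, 'k) mpol. subst (\<lambda>i. 0) f = 0}"
      unfolding irrelevant_ideal_def
      by (rule gen_minimal) (auto simp: cprime_ideal[OF cprime_subst_kernel])
    show "{f :: ('n, 'k) mpol. subst (\<lambda>i. 0) f = 0} \<subseteq> irrelevant_ideal"
    proof clarify
      fix f :: "('n, 'k) mpol" assume "subst (\<lambda>i. 0) f = 0"
      then show "f \<in> irrelevant_ideal"
        using subst_congruent[of irrelevant_ideal "\<lambda>i. 0" f]
        by (auto simp: irrelevant_ideal_def intro: cideal_gen gen_incl)
    qed
  qed
  moreover have "cst c = (0::('n, 'k) mpol) \<longleftrightarrow> c = 0" for c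
    by (metis lookup_single_eq lookup_zero single_zero)
  ultimately show ?thesis unfolding eq by auto
qed

section \<open>Noetherian arguments\<close>

lemma nat_seq_mono_subseq:
  fixes u :: "nat \<Rightarrow> nat"
  obtains r :: "nat \<Rightarrow> nat" where "strict_mono r" "mono (\<lambda>n. u (r n))"
proof -
  obtain g where g: "strict_mono g" "monoseq (\<lambda>n. u (g n))" using seq_monosub[of u] by blast
  show ?thesis
  proof (cases "incseq (\<lambda>n. u (g n))")
    case True
    show ?thesis by (rule that[OF g(1) True])
  next
    case False
    then have dec: "decseq (\<lambda>n. u (g n))" using g(2) monoseq_iff by blast
    obtain N where N: "\<And>n. u (g N) \<le> u (g n)"
      using ex_has_least_nat[of "\<lambda>_. True" 0 "\<lambda>n. u (g n)"] by auto
    have const: "u (g (n + N)) = u (g N)" for n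
      using N[of "n + N"] decseqD[OF dec, of N "n + N"] by simp
    show ?thesis
    proof (rule that[of "\<lambda>n. g (n + N)"])
      show "strict_mono (\<lambda>n. g (n + N))" using g(1) by (simp add: strict_mono_def)
      show "mono (\<lambda>n. u (g (n + N)))" by (simp add: const mono_def)
    qed
  qed
qed

text \<open>One coordinate after another is made monotone by passing to a subsequence; the first two
  terms of the last subsequence are comparable in every coordinate.\<close>

lemma dickson:
  fixes u :: "nat \<Rightarrow> 'n::finite \<Rightarrow> nat"
  obtains i j where "i < j" "\<And>x. u i x \<le> u j x"
proof -
  have "\<exists>r :: nat \<Rightarrow> nat. strict_mono r \<and> (\<forall>x\<in>A. mono (\<lambda>n. u (r n) x))" if "finite A" for A :: "'n set"
    using that
  proof (induction A rule: finite_induct)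
    case empty
    have "strict_mono (\<lambda>n::nat. n)" by (simp add: strict_mono_def)
    then show ?case by blast
  next
    case (insert x A)
    then obtain r :: "nat \<Rightarrow> nat" where r: "strict_mono r" "\<And>x. x \<in> A \<Longrightarrow> mono (\<lambda>n. u (r n) x)" by blast
    obtain t :: "nat \<Rightarrow> nat" where t: "strict_mono t" "mono (\<lambda>n. u (r (t n)) x)"
      using nat_seq_mono_subseq[of "\<lambda>n. u (r n) x"] by blast
    have "mono (\<lambda>n. u (r (t n)) y)" if "y \<in> A" for y
      using r(2)[OF that] strict_mono_mono[OF t(1)] by (simp add: mono_def)
    then have "\<forall>y\<in>insert x A. mono (\<lambda>n. u (r (t n)) y)" using t(2) by blast
    moreover have "strict_mono (\<lambda>n. r (t n))" using r(1) t(1) by (simp add: strict_mono_def)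
    ultimately have "strict_mono (\<lambda>n. r (t n)) \<and> (\<forall>y\<in>insert x A. mono (\<lambda>n. u (r (t n)) y))" by (rule conjI[rotated])
    then show ?case by (rule exI[of _ "\<lambda>n. r (t n)"])
  qed
  then obtain r :: "nat \<Rightarrow> nat" where "strict_mono r" "\<And>x. mono (\<lambda>n. u (r n) x)" using finite[of "UNIV :: 'n set"] by (metis UNIV_I)
  then have "r 0 < r 1" "\<And>x. u (r 0) x \<le> u (r 1) x" by (auto simp: strict_mono_def mono_def)
  then show ?thesis by (rule that)
qed

lemma lead_single: "c \<noteq> 0 \<Longrightarrow> lead (Poly_Mapping.single e c) = e"
  using lead_in_keys[of "Poly_Mapping.single e c"] by (metis keys_single keys_zero insert_not_empty singletonD)

text \<open>Choose in each step of the chain a new element with least leading key. By Dickson's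
  lemma one leading exponent divides a later one, and cancelling the later leading term produces a
  new element of that step with a smaller key.\<close>

lemma ideal_chain_stabilizes:
  fixes J :: "nat \<Rightarrow> ('n::finite, 'k::field) mpol set"
  assumes ideal: "\<And>n. cideal (J n)" and strict: "\<And>n. J n \<subset> J (Suc n)"
  shows False
proof -
  have "\<exists>f. f \<in> J (Suc n) - J n \<and> (\<forall>g. g \<in> J (Suc n) - J n \<longrightarrow> monomial_key (lead f) \<le> monomial_key (lead g))" for n
  proof -
    obtain f0 where "f0 \<in> J (Suc n) - J n" using strict by blast
    then show ?thesis by (rule ex_has_least_nat)
  qed
  then obtain f where f: "\<And>n. f n \<in> J (Suc n)" "\<And>n. f n \<notin> J n"
    and least: "\<And>n g. g \<in> J (Suc n) - J n \<Longrightarrow> monomial_key (lead (f n)) \<le> monomial_key (lead g)"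
    by (metis Diff_iff)
  have fne: "f n \<noteq> 0" for n using f(2)[of n] cideal_0[OF ideal[of n]] by metis
  have mono: "J i \<subseteq> J j" if "i \<le> j" for i j
    using lift_Suc_mono_le[of J, OF _ that] strict by blast
  obtain i j where ij: "i < j" "\<And>x. Poly_Mapping.lookup (lead (f i)) x \<le> Poly_Mapping.lookup (lead (f j)) x"
    using dickson[of "\<lambda>n. Poly_Mapping.lookup (lead (f n))"] by blast
  define e where "e = lead (f j) - lead (f i)"
  have e: "lead (f j) = e + lead (f i)"
    by (rule poly_mapping_eqI) (use ij(2) in \<open>auto simp: e_def lookup_minus lookup_add\<close>)
  define c where "c = Poly_Mapping.lookup (f j) (lead (f j)) / Poly_Mapping.lookup (f i) (lead (f i))"
  have nz: "Poly_Mapping.lookup (f n) (lead (f n)) \<noteq> 0" for n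
    using lead_in_keys[OF fne] by (simp add: in_keys_iff)
  then have c0: "c \<noteq> 0" by (simp add: c_def)
  then have sne: "Poly_Mapping.single e c \<noteq> 0" by (metis lookup_single_eq lookup_zero)
  define g where "g = f j - Poly_Mapping.single e c * f i"
  have "f i \<in> J j" using mono[of "Suc i" j] ij(1) f(1)[of i] by auto
  then have fi: "Poly_Mapping.single e c * f i \<in> J j" by (rule cideal_mult[OF ideal])
  have "g \<in> J (Suc j)" using cideal_diff[OF ideal f(1)] mono[of j "Suc j"] fi unfolding g_def by auto
  moreover have gj: "g \<notin> J j" using cideal_add[OF ideal _ fi, of g] f(2)[of j] by (auto simp: g_def)
  ultimately have le: "monomial_key (lead (f j)) \<le> monomial_key (lead g)" using least by blast
  have gne: "g \<noteq> 0" using gj cideal_0[OF ideal[of j]] by metis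
  have "Poly_Mapping.lookup (Poly_Mapping.single e c * f i) (lead (f j)) = c * Poly_Mapping.lookup (f i) (lead (f i))"
    using lookup_mult_lead[OF sne fne[of i]] by (simp add: lead_single[OF c0] e)
  then have "Poly_Mapping.lookup g (lead (f j)) = 0"
    using nz[of i] by (simp add: g_def lookup_minus c_def)
  then have ne: "lead g \<noteq> lead (f j)" using lead_in_keys[OF gne] by (auto simp: in_keys_iff)
  have "monomial_key m \<le> monomial_key (lead (f j))" if "m \<in> Poly_Mapping.keys (f j)" for m
    using lead_max[OF that] .
  moreover have "monomial_key m \<le> monomial_key (lead (f j))"
    if "m \<in> Poly_Mapping.keys (Poly_Mapping.single e c * f i)" for m
  proof -
    from that obtain m' where "m = e + m'" "m' \<in> Poly_Mapping.keys (f i)"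
      using keys_mult[of "Poly_Mapping.single e c" "f i"] by (auto split: if_splits)
    then show ?thesis using lead_max[of m' "f i"] by (simp add: e monomial_key(2))
  qed
  ultimately have "monomial_key (lead g) \<le> monomial_key (lead (f j))"
    using lead_in_keys[OF gne] keys_diff[of "f j" "Poly_Mapping.single e c * f i"] unfolding g_def by blast
  then have "lead g = lead (f j)" using le injD[OF monomial_key(1)] by (metis le_antisym)
  then show False using ne by simp
qed

lemma maximal_ideal_exists:
  fixes \<F> :: "('n::finite, 'k::field) mpol set set"
  assumes "\<F> \<noteq> {}" "\<And>J. J \<in> \<F> \<Longrightarrow> cideal J"
  shows "\<exists>J\<in>\<F>. \<forall>J'\<in>\<F>. J \<subseteq> J' \<longrightarrow> J' = J"
proof (rule ccontr)
  assume "\<not> ?thesis"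
  then have *: "\<exists>J'. J' \<in> \<F> \<and> J \<subset> J'" if "J \<in> \<F>" for J using that by blast
  obtain J where "\<And>n. J n \<in> \<F>" "\<And>n. J n \<subset> J (Suc n)"
    using dependent_nat_choice[of "\<lambda>_ J. J \<in> \<F>" "\<lambda>_ J J'. J \<subset> J'"] assms(1) * by (metis ex_in_conv)
  then show False using ideal_chain_stabilizes[of J] assms(2) by blast
qed

text \<open>A maximal member among the proper ideals \<open>colon J u\<close> is prime: if
  \<open>a\<close> lies outside it, replacing \<open>u\<close> by \<open>a * u\<close> cannot
  enlarge it.\<close>

lemma Ass_nonempty:
  fixes J :: "('n::finite, 'k::field) mpol set"
  assumes J: "cideal J" "J \<noteq> UNIV"
  obtains p where "p \<in> Ass J"
proof -
  let ?F = "{colon J u | u. u \<notin> J}"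
  obtain u0 where "u0 \<notin> J" using J(2) by blast
  then have "?F \<noteq> {}" by blast
  moreover have "cideal C" if "C \<in> ?F" for C using that cideal_colon[OF J(1)] by blast
  ultimately have "\<exists>C\<in>?F. \<forall>C'\<in>?F. C \<subseteq> C' \<longrightarrow> C' = C" by (rule maximal_ideal_exists)
  then obtain C where C: "C \<in> ?F" "\<forall>C'\<in>?F. C \<subseteq> C' \<longrightarrow> C' = C" by (rule bexE)
  then obtain u where u: "C = colon J u" "u \<notin> J" by blast
  have "cprime C" unfolding cprime_iff
  proof (intro conjI allI impI)
    show "cideal C" using cideal_colon[OF J(1)] u(1) by simp
    show "1 \<notin> C" using u by (simp add: colon_def)
    fix a b assume ab: "a * b \<in> C"
    show "a \<in> C \<or> b \<in> C"
    proof (cases "a \<in> C")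
      case False
      then have "a * u \<notin> J" using u by (simp add: colon_def)
      moreover have "C \<subseteq> colon J (a * u)"
      proof
        fix x assume "x \<in> C"
        then have "a * (x * u) \<in> J" using cideal_mult[OF J(1)] by (simp add: u(1) colon_def)
        then show "x \<in> colon J (a * u)" by (simp add: colon_def ac_simps)
      qed
      ultimately have "colon J (a * u) = C" using C(2) by blast
      moreover have "b \<in> colon J (a * u)" using ab u(1) by (simp add: colon_def ac_simps)
      ultimately show ?thesis by simp
    qed simp
  qed
  then show ?thesis using that[of C] u(1) unfolding Ass_def by blast
qed

section \<open>Products of associated primes contained in an ideal\<close>

definition colon_set :: "'a::comm_ring_1 set \<Rightarrow> 'a set \<Rightarrow> 'a set" where
  "colon_set J T = {h. \<forall>t\<in>T. t * h \<in> J}"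

lemma cideal_colon_set: "cideal J \<Longrightarrow> cideal (colon_set J T)"
  unfolding colon_set_def cideal_iff by (auto simp: distrib_left mult.left_commute)

lemma colon_set_gen: "cideal J \<Longrightarrow> colon_set J (gen G) = colon_set J G"
proof
  assume J: "cideal J"
  show "colon_set J (gen G) \<subseteq> colon_set J G" using gen_incl[of _ G] by (auto simp: colon_set_def)
  show "colon_set J G \<subseteq> colon_set J (gen G)"
  proof
    fix h assume "h \<in> colon_set J G"
    then have "G \<subseteq> colon J h" by (auto simp: colon_set_def colon_def)
    then show "h \<in> colon_set J (gen G)"
      using gen_minimal[OF cideal_colon[OF J]] by (auto simp: colon_set_def colon_def)
  qed
qed

text \<open>Multiplication by the elements of \<open>G\<close> embeds the quotient by
  \<open>colon_set J G\<close> into finitely many copies of the quotient by \<open>J\<close>. A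
  prime that is a finite intersection of colon ideals equals one of them, which is where finiteness
  of \<open>G\<close> enters.\<close>

lemma Ass_colon_set:
  assumes J: "cideal J" and "finite G"
  shows "Ass (colon_set J G) \<subseteq> Ass J"
proof
  fix p assume "p \<in> Ass (colon_set J G)"
  then obtain f where p: "cprime p" "p = colon (colon_set J G) f" unfolding Ass_def by blast
  have p_iff: "a \<in> p \<longleftrightarrow> (\<forall>t\<in>G. a \<in> colon J (t * f))" for a
    unfolding p(2) by (simp add: colon_def colon_set_def mult.left_commute)
  have "\<exists>t\<in>G. colon J (t * f) \<subseteq> p"
  proof (rule ccontr)
    assume "\<not> (\<exists>t\<in>G. colon J (t * f) \<subseteq> p)"
    then have "\<forall>t\<in>G. \<exists>b. b \<in> colon J (t * f) \<and> b \<notin> p" by blast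
    then obtain a where a: "\<And>t. t \<in> G \<Longrightarrow> a t \<in> colon J (t * f)" "\<And>t. t \<in> G \<Longrightarrow> a t \<notin> p"
      by metis
    have "(\<Prod>t\<in>G. a t) \<in> p"
      unfolding p_iff
    proof
      fix t assume t: "t \<in> G"
      then have "(\<Prod>t\<in>G. a t) = a t * (\<Prod>t\<in>G - {t}. a t)" using \<open>finite G\<close> by (rule prod.remove[rotated])
      then show "(\<Prod>t\<in>G. a t) \<in> colon J (t * f)"
        using a(1)[OF t] cideal_mult'[OF cideal_colon[OF J]] by metis
    qed
    moreover have "(\<Prod>t\<in>H. a t) \<notin> p" if "finite H" "H \<subseteq> G" for H
      using that by (induction H rule: finite_induct) (use p(1) a(2) in \<open>auto simp: cprime_iff\<close>)
    ultimately show False using \<open>finite G\<close> by blast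
  qed
  then obtain t where t: "t \<in> G" "colon J (t * f) \<subseteq> p" by blast
  then have "p = colon J (t * f)" using p_iff by blast
  then show "p \<in> Ass J" using p(1) unfolding Ass_def by blast
qed

text \<open>An iterated colon ideal being the whole ring means that the product of the listed primes
  lies in \<open>I\<close>. A maximal proper iterated colon \<open>J\<close> would have an
  associated prime \<open>q = colon J f\<close>, and \<open>f\<close> would then enlarge it.\<close>

lemma Ass_filtration:
  fixes I :: "('n::finite, 'k::field) mpol set"
  assumes I: "cideal I" and fin: "\<And>q. q \<in> Ass I \<Longrightarrow> \<exists>G. finite G \<and> q = gen G"
  obtains qs where "set qs \<subseteq> Ass I" "foldl colon_set I qs = UNIV"
proof -
  have ideal: "cideal (foldl colon_set I qs)" for qs
    by (induction qs rule: rev_induct) (auto intro: I cideal_colon_set)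
  have sub: "set qs \<subseteq> Ass I \<Longrightarrow> Ass (foldl colon_set I qs) \<subseteq> Ass I" for qs
  proof (induction qs rule: rev_induct)
    case (snoc q qs)
    then obtain G where "finite G" "q = gen G" using fin by auto
    then have "Ass (foldl colon_set I (qs @ [q])) \<subseteq> Ass (foldl colon_set I qs)"
      using Ass_colon_set[OF ideal] colon_set_gen[OF ideal] by simp
    with snoc show ?case by auto
  qed auto
  let ?F = "{foldl colon_set I qs | qs. set qs \<subseteq> Ass I}"
  have "foldl colon_set I [] \<in> ?F" by (intro CollectI exI[of _ "[]"]) simp
  then have "?F \<noteq> {}" by blast
  moreover have "cideal J" if "J \<in> ?F" for J using that ideal by blast
  ultimately have "\<exists>J\<in>?F. \<forall>J'\<in>?F. J \<subseteq> J' \<longrightarrow> J' = J" by (rule maximal_ideal_exists)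
  then obtain J where J: "J \<in> ?F" "\<forall>J'\<in>?F. J \<subseteq> J' \<longrightarrow> J' = J" by (rule bexE)
  then obtain qs where qs: "J = foldl colon_set I qs" "set qs \<subseteq> Ass I" by blast
  have "J = UNIV"
  proof (rule ccontr)
    assume "J \<noteq> UNIV"
    then obtain q where q: "q \<in> Ass J" using Ass_nonempty[of J] ideal qs(1) by blast
    then obtain f where f: "cprime q" "q = colon J f" unfolding Ass_def by blast
    have "colon_set J q \<in> ?F"
      by (intro CollectI exI[of _ "qs @ [q]"]) (use q sub[OF qs(2)] qs in auto)
    moreover have "J \<subseteq> colon_set J q"
      using cideal_mult[OF ideal[of qs]] unfolding qs(1) colon_set_def by blast
    ultimately have "colon_set J q = J" using J(2) by blast
    moreover have "f \<in> colon_set J q" using f(2) by (auto simp: colon_set_def colon_def)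
    ultimately have "1 \<in> q" using f(2) by (simp add: colon_def)
    then show False using f(1) by (simp add: cprime_iff)
  qed
  then show ?thesis using that qs by blast
qed

text \<open>Walk back along the iterated colons: if the last prime does not already push
  \<open>u\<close> into \<open>I\<close>, some multiple of \<open>u\<close> outside \<open>I\<close>
  lies one stage earlier.\<close>

lemma filtration_multiple:
  assumes "cideal I" "u \<in> foldl colon_set I qs" "u \<notin> I"
  obtains r q where "q \<in> set qs" "r * u \<notin> I" "\<And>t. t \<in> q \<Longrightarrow> t * (r * u) \<in> I"
  using assms(2,3)
proof (induction qs arbitrary: u thesis rule: rev_induct)
  case (snoc q qs)
  show ?case
  proof (cases "\<forall>t\<in>q. t * u \<in> I")
    case True
    then show ?thesis using snoc.prems(1)[of q 1] snoc.prems(3) by simp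
  next
    case False
    then obtain t where t: "t \<in> q" "t * u \<notin> I" by blast
    then have "t * u \<in> foldl colon_set I qs" using snoc.prems(2) colon_set_def[of "foldl colon_set I qs" q] by auto
    then obtain r q' where "q' \<in> set qs" "r * (t * u) \<notin> I" "\<And>v. v \<in> q' \<Longrightarrow> v * (r * (t * u)) \<in> I"
      using snoc.IH[OF _ _ t(2)] by blast
    then show ?thesis using snoc.prems(1)[of q' "r * t"] by (simp add: mult.assoc)
  qed
qed simp

lemma exponent_split:
  "e \<le> total_deg m \<Longrightarrow> \<exists>m1 m2. m = m1 + m2 \<and> total_deg m1 = e"
proof (induction e arbitrary: m)
  case 0
  have "m = 0 + m \<and> total_deg (0 :: 'a \<Rightarrow>\<^sub>0 nat) = 0" by (simp add: total_deg_0_iff)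
  then show ?case by blast
next
  case (Suc e)
  then obtain m1 m2 where *: "m = m1 + m2" "total_deg m1 = e" by (metis Suc_leD)
  then have "total_deg m2 \<noteq> 0" using Suc.prems by (simp add: total_deg_add)
  then obtain i where i: "Poly_Mapping.lookup m2 i \<noteq> 0" unfolding total_deg_def by (metis sum.neutral)
  let ?s = "Poly_Mapping.single i (1::nat)"
  have "m2 = ?s + (m2 - ?s)"
    by (rule poly_mapping_eqI) (use i in \<open>auto simp: lookup_add lookup_minus lookup_single when_def\<close>)
  then have "m = (m1 + ?s) + (m2 - ?s)" using *(1) by (metis add.assoc)
  moreover have "total_deg (m1 + ?s) = Suc e" by (simp add: total_deg_add *(2) total_deg_single)
  ultimately show ?case by blast
qed

text \<open>A monomial of degree at least \<open>e1 + e2\<close> splits off factors of degrees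
  \<open>e1\<close> and \<open>e2\<close>. So the hypothesis on products reaches all higher
  degrees.\<close>

lemma graded_piece_high:
  assumes X: "cideal X" and prod: "\<And>b c. b \<in> graded_piece (int e1) \<Longrightarrow> c \<in> graded_piece (int e2) \<Longrightarrow> b * c \<in> X"
    and k: "k \<ge> int (e1 + e2)" and a: "a \<in> graded_piece k"
  shows "a \<in> X"
proof -
  have mon: "Poly_Mapping.single m x \<in> X" if deg: "total_deg m \<ge> e1 + e2" for m x
  proof -
    obtain m1 m' where 1: "m = m1 + m'" "total_deg m1 = e1" using exponent_split[of e1 m] deg by auto
    then have "e2 \<le> total_deg m'" using deg by (simp add: total_deg_add)
    then obtain m2 m3 where 2: "m' = m2 + m3" "total_deg m2 = e2" using exponent_split by blast
    have "Poly_Mapping.single m x = Poly_Mapping.single m3 1 * (Poly_Mapping.single m1 x * Poly_Mapping.single m2 1)"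
      unfolding 1(1) 2(1) by (simp add: mult_single ac_simps)
    moreover have "Poly_Mapping.single m1 x * Poly_Mapping.single m2 1 \<in> X"
      by (rule prod) (auto simp: graded_piece_def 1(2) 2(2) split: if_splits)
    ultimately show ?thesis using cideal_mult[OF X] by metis
  qed
  have "(\<Sum>m\<in>Poly_Mapping.keys a. Poly_Mapping.single m (Poly_Mapping.lookup a m)) \<in> X"
    by (intro cideal_sum X mon) (use a k in \<open>fastforce simp: graded_piece_def\<close>)
  then show ?thesis using mpol_eq_sum_keys[of a] by simp
qed

text \<open>If every prime of the product contains, modulo \<open>h\<close>, all forms of some
  degree, these degrees add up along the product. The case \<open>h = 0\<close> detects ideals
  containing a power of the irrelevant ideal; a regular \<open>h\<close> gives the Artinian
  quotient.\<close>

lemma filtration_power: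
  fixes I :: "('n::finite, 'k::field) mpol set"
  assumes I: "cideal I"
    and q: "\<And>q. q \<in> set qs \<Longrightarrow> \<exists>e. \<forall>b\<in>graded_piece (int e). \<exists>r j. b = r * h + j \<and> j \<in> q"
  shows "\<exists>e. \<forall>k a u. k \<ge> int e \<longrightarrow> a \<in> graded_piece k \<longrightarrow> u \<in> foldl colon_set I qs \<longrightarrow>
    a * u \<in> {r * h + j | r j. j \<in> I}"
  using q
proof (induction qs rule: rev_induct)
  case Nil
  have "a * u \<in> {r * h + j | r j. j \<in> I}" if "u \<in> I" for a u
  proof -
    have "a * u = 0 * h + a * u" by simp
    then show ?thesis using cideal_mult[OF I that] by blast
  qed
  then show ?case unfolding foldl_Nil by blast
next
  case (snoc q qs)
  let ?X = "{r * h + j | r j. j \<in> I}"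
  have X: "cideal ?X" by (rule cideal_sum_principal[OF I])
  have "\<exists>e. \<forall>k a u. k \<ge> int e \<longrightarrow> a \<in> graded_piece k \<longrightarrow> u \<in> foldl colon_set I qs \<longrightarrow> a * u \<in> ?X"
    by (rule snoc.IH, rule snoc.prems) simp
  then obtain e1 where e1: "\<forall>k a u. k \<ge> int e1 \<longrightarrow> a \<in> graded_piece k \<longrightarrow> u \<in> foldl colon_set I qs \<longrightarrow> a * u \<in> ?X"
    by (rule exE)
  obtain e2 where e2: "\<forall>b\<in>graded_piece (int e2). \<exists>r j. b = r * h + j \<and> j \<in> q" using snoc.prems[of q] by auto
  have "a * u \<in> ?X" if k: "k \<ge> int (e1 + e2)" "a \<in> graded_piece k" and u: "u \<in> foldl colon_set I (qs @ [q])" for k a u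
  proof -
    have "b * c \<in> colon ?X u" if b: "b \<in> graded_piece (int e1)" and c: "c \<in> graded_piece (int e2)" for b c
    proof -
      obtain r j where rj: "c = r * h + j" "j \<in> q" using e2 c by blast
      then have "j * u \<in> foldl colon_set I qs" using u by (simp add: colon_set_def)
      then have "b * (j * u) \<in> ?X" using e1[rule_format, OF order_refl b] by blast
      moreover have "h \<in> ?X" using cideal_0[OF I] by (intro CollectI exI[of _ 1] exI[of _ 0]) simp
      then have "(b * r * u) * h \<in> ?X" by (rule cideal_mult[OF X])
      ultimately have "b * (j * u) + (b * r * u) * h \<in> ?X" by (rule cideal_add[OF X])
      then show ?thesis unfolding colon_def rj(1) by (simp add: algebra_simps)
    qed
    then have "a \<in> colon ?X u" by (rule graded_piece_high[OF cideal_colon[OF X] _ k])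
    then show ?thesis by (simp add: colon_def)
  qed
  then show ?case by (intro exI[of _ "e1 + e2"] allI impI)
qed

section \<open>Chains of prime ideals have bounded length\<close>

lemma linear_dependence:
  fixes a :: "'x \<Rightarrow> 'y \<Rightarrow> 'k::field"
  assumes "finite Y" "finite X" "card Y < card X"
  shows "\<exists>c. (\<exists>x\<in>X. c x \<noteq> 0) \<and> (\<forall>y\<in>Y. (\<Sum>x\<in>X. c x * a x y) = 0)"
  using assms
proof (induction Y arbitrary: X a rule: finite_induct)
  case empty
  then obtain x where "x \<in> X" by fastforce
  then show ?case by (intro exI[of _ "\<lambda>_. 1"]) auto
next
  case (insert y Y)
  show ?case
  proof (cases "\<forall>x\<in>X. a x y = 0")
    case True
    then show ?thesis using insert.IH[of X a] insert.prems insert.hyps by auto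
  next
    case False
    then obtain x0 where x0: "x0 \<in> X" "a x0 y \<noteq> 0" by blast
    let ?X = "X - {x0}"
    define a' where "a' x z = a x z - (a x y / a x0 y) * a x0 z" for x z
    have "card Y < card ?X" using insert.prems insert.hyps x0(1) by simp
    then obtain c where c: "\<exists>x\<in>?X. c x \<noteq> 0" "\<And>z. z \<in> Y \<Longrightarrow> (\<Sum>x\<in>?X. c x * a' x z) = 0"
      using insert.IH[of ?X a'] insert.prems(1) by auto
    define c' where "c' x = (if x = x0 then - (\<Sum>x\<in>?X. c x * a x y) / a x0 y else c x)" for x
    have sum: "(\<Sum>x\<in>X. c' x * a x z) = - (\<Sum>x\<in>?X. c x * a x y) / a x0 y * a x0 z + (\<Sum>x\<in>?X. c x * a x z)" for z
    proof -
      have "(\<Sum>x\<in>X. c' x * a x z) = c' x0 * a x0 z + (\<Sum>x\<in>?X. c' x * a x z)"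
        by (rule sum.remove) (use insert.prems x0 in auto)
      also have "(\<Sum>x\<in>?X. c' x * a x z) = (\<Sum>x\<in>?X. c x * a x z)"
        by (rule sum.cong) (auto simp: c'_def)
      finally show ?thesis by (simp add: c'_def)
    qed
    have "(\<Sum>x\<in>X. c' x * a x z) = 0" if "z \<in> insert y Y" for z
    proof (cases "z = y")
      case True
      then show ?thesis using x0(2) by (simp add: sum)
    next
      case False
      then have "0 = (\<Sum>x\<in>?X. c x * a' x z)" using c(2) that by auto
      also have "\<dots> = (\<Sum>x\<in>?X. c x * a x z) - (\<Sum>x\<in>?X. c x * a x y * (a x0 z / a x0 y))"
        unfolding sum_subtractf[symmetric] by (rule sum.cong) (auto simp: a'_def algebra_simps)
      also have "\<dots> = (\<Sum>x\<in>?X. c x * a x z) - (\<Sum>x\<in>?X. c x * a x y) * (a x0 z / a x0 y)"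
        by (simp only: sum_distrib_right)
      finally show ?thesis by (simp add: sum)
    qed
    moreover have "\<exists>x\<in>X. c' x \<noteq> 0" using c(1) by (auto simp: c'_def)
    ultimately show ?thesis by blast
  qed
qed

definition list_monomial :: "'a::comm_ring_1 list \<Rightarrow> nat list \<Rightarrow> 'a" where
  "list_monomial fs \<alpha> = prod_list (map2 power fs \<alpha>)"

lemma list_monomial_Cons: "list_monomial (f # fs) (e # \<alpha>) = f ^ e * list_monomial fs \<alpha>"
  by (simp add: list_monomial_def)

lemma list_monomial_degree:
  fixes fs :: "('n::finite, 'k::field) mpol list"
  assumes "\<And>f m. f \<in> set fs \<Longrightarrow> m \<in> Poly_Mapping.keys f \<Longrightarrow> total_deg m \<le> e"
    and "length \<alpha> = length fs" "\<And>a. a \<in> set \<alpha> \<Longrightarrow> a \<le> d" "m \<in> Poly_Mapping.keys (list_monomial fs \<alpha>)"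
  shows "total_deg m \<le> e * d * length fs"
  using assms
proof (induction fs arbitrary: \<alpha> m)
  case Nil
  then show ?case by (simp add: list_monomial_def total_deg_0_iff)
next
  case (Cons f fs)
  then obtain a \<beta> where \<alpha>: "\<alpha> = a # \<beta>" by (metis length_Suc_conv)
  have pow: "total_deg m' \<le> e * n" if "m' \<in> Poly_Mapping.keys (f ^ n)" for n m'
    using that
  proof (induction n arbitrary: m')
    case 0
    then show ?case by (simp add: total_deg_0_iff)
  next
    case (Suc n)
    then obtain m1 m2 where "m' = m1 + m2" "m1 \<in> Poly_Mapping.keys f" "m2 \<in> Poly_Mapping.keys (f ^ n)"
      using keys_mult[of f "f ^ n"] by auto
    then show ?case using Suc.IH Cons.prems(1)[of f m1] by (fastforce simp: total_deg_add)
  qed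
  obtain m1 m2 where m: "m = m1 + m2" "m1 \<in> Poly_Mapping.keys (f ^ a)" "m2 \<in> Poly_Mapping.keys (list_monomial fs \<beta>)"
    using Cons.prems(4) keys_mult[of "f ^ a" "list_monomial fs \<beta>"] by (auto simp: \<alpha> list_monomial_Cons)
  have "total_deg m2 \<le> e * d * length fs" by (rule Cons.IH[of \<beta>]) (use Cons.prems m \<alpha> in auto)
  moreover have "total_deg m1 \<le> e * d"
    using pow[OF m(2)] Cons.prems(3)[of a] \<alpha> by (meson le_trans list.set_intros(1) mult_le_mono2)
  ultimately show ?case by (simp add: m(1) total_deg_add)
qed

lemma card_bounded_exponents:
  "finite {m :: 'n::finite \<Rightarrow>\<^sub>0 nat. total_deg m \<le> E}"
  "card {m :: 'n::finite \<Rightarrow>\<^sub>0 nat. total_deg m \<le> E} \<le> (E + 1) ^ card (UNIV :: 'n set)"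
proof -
  let ?Y = "{m :: 'n \<Rightarrow>\<^sub>0 nat. total_deg m \<le> E}" and ?T = "PiE (UNIV :: 'n set) (\<lambda>_. {..E})"
  have "Poly_Mapping.lookup m i \<le> total_deg m" for m :: "'n \<Rightarrow>\<^sub>0 nat" and i
    unfolding total_deg_def by (rule member_le_sum) auto
  then have sub: "Poly_Mapping.lookup ` ?Y \<subseteq> ?T" using le_trans by fastforce
  have inj: "inj_on Poly_Mapping.lookup ?Y" by (rule inj_onI) (rule poly_mapping_eq_iff[THEN iffD2])
  have fin: "finite ?T" by (rule finite_PiE) auto
  show "finite ?Y" using inj_on_finite[OF inj sub fin] .
  have "card ?Y \<le> card ?T" by (rule card_inj_on_le[OF inj sub fin])
  then show "card ?Y \<le> (E + 1) ^ card (UNIV :: 'n set)" by (simp add: card_PiE)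
qed

text \<open>Counting suffices: with \<open>n\<close> the length of \<open>fs\<close>, the products
  with exponents below \<open>D\<close> number \<open>D ^ n\<close>, while their supports lie in a
  set of size polynomial in \<open>D\<close> of degree \<open>s < n\<close>.\<close>

lemma algebraic_dependence:
  fixes fs :: "('n::finite, 'k::field) mpol list"
  assumes len: "card (UNIV :: 'n set) < length fs"
  shows "\<exists>X c. finite X \<and> (\<forall>\<alpha>\<in>X. length \<alpha> = length fs) \<and>
    (\<Sum>\<alpha>\<in>X. cst (c \<alpha>) * list_monomial fs \<alpha>) = 0 \<and> (\<exists>\<alpha>\<in>X. c \<alpha> \<noteq> 0)"
proof -
  let ?s = "card (UNIV :: 'n set)" and ?n = "length fs"
  have fin: "finite (\<Union>f\<in>set fs. total_deg ` Poly_Mapping.keys f)" by auto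
  define e where "e = Max (insert 0 (\<Union>f\<in>set fs. total_deg ` Poly_Mapping.keys f))"
  have e: "total_deg m \<le> e" if "f \<in> set fs" "m \<in> Poly_Mapping.keys f" for f m
    unfolding e_def by (rule Max_ge) (use that in auto)
  \<comment> \<open>Chosen to exceed \<open>(e * n + 1) ^ s\<close>, where \<open>n\<close> is the
    length of \<open>fs\<close>, so that
    \<open>((e * n + 1) * D) ^ s < D ^ (s + 1) \<le> D ^ n\<close>.\<close>
  define D where "D = Suc ((e * ?n + 1) ^ ?s)"
  define X where "X = {\<alpha>. set \<alpha> \<subseteq> {..<D} \<and> length \<alpha> = ?n}"
  define Y where "Y = {m :: 'n \<Rightarrow>\<^sub>0 nat. total_deg m \<le> e * D * ?n}"
  have X: "finite X" "card X = D ^ ?n"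
    unfolding X_def using finite_lists_length_eq[of "{..<D}"] card_lists_length_eq[of "{..<D}"] by auto
  have "card Y \<le> (e * D * ?n + 1) ^ ?s" unfolding Y_def by (rule card_bounded_exponents)
  also have "\<dots> \<le> ((e * ?n + 1) * D) ^ ?s"
    by (rule power_mono) (auto simp: D_def algebra_simps)
  also have "\<dots> = (e * ?n + 1) ^ ?s * D ^ ?s" by (rule power_mult_distrib)
  also have "\<dots> < D * D ^ ?s" by (rule mult_strict_right_mono) (auto simp: D_def)
  also have "\<dots> = D ^ Suc ?s" by simp
  also have "\<dots> \<le> D ^ ?n" by (rule power_increasing) (use len in \<open>auto simp: D_def\<close>)
  finally have "card Y < card X" using X by simp
  then obtain c where c: "\<exists>\<alpha>\<in>X. c \<alpha> \<noteq> 0"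
    "\<And>m. m \<in> Y \<Longrightarrow> (\<Sum>\<alpha>\<in>X. c \<alpha> * Poly_Mapping.lookup (list_monomial fs \<alpha>) m) = 0"
    using linear_dependence[of Y X "\<lambda>\<alpha>. Poly_Mapping.lookup (list_monomial fs \<alpha>)"] X(1)
      card_bounded_exponents(1) unfolding Y_def by blast
  have lk: "Poly_Mapping.lookup (cst x * f) m = x * Poly_Mapping.lookup f m" for x m and f :: "('n, 'k) mpol"
  proof (cases "x = 0")
    case False
    then have "Poly_Mapping.keys (cst x :: ('n, 'k) mpol) = {0}" by simp
    then show ?thesis unfolding lookup_mult_sum by (auto simp: in_keys_iff)
  qed simp
  have "(\<Sum>\<alpha>\<in>X. cst (c \<alpha>) * list_monomial fs \<alpha>) = 0"
  proof (rule poly_mapping_eqI)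
    fix m
    have "(\<Sum>\<alpha>\<in>X. c \<alpha> * Poly_Mapping.lookup (list_monomial fs \<alpha>) m) = 0"
    proof (cases "m \<in> Y")
      case False
      have "Poly_Mapping.lookup (list_monomial fs \<alpha>) m = 0" if "\<alpha> \<in> X" for \<alpha>
      proof (rule ccontr)
        assume "Poly_Mapping.lookup (list_monomial fs \<alpha>) m \<noteq> 0"
        then have "total_deg m \<le> e * D * ?n"
          using list_monomial_degree[of fs e \<alpha> D m] e that by (force simp: in_keys_iff X_def)
        then show False using False by (simp add: Y_def)
      qed
      then show ?thesis by simp
    qed (use c(2) in auto)
    then show "Poly_Mapping.lookup (\<Sum>\<alpha>\<in>X. cst (c \<alpha>) * list_monomial fs \<alpha>) m = Poly_Mapping.lookup 0 m"
      by (simp add: lookup_sum lk)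
  qed
  moreover have "\<forall>\<alpha>\<in>X. length \<alpha> = ?n" by (simp add: X_def)
  ultimately show ?thesis using X(1) c(1) by (intro exI[of _ X] exI[of _ c] conjI)
qed

lemma cst_notin_proper:
  fixes P :: "('n::finite, 'k::field) mpol set"
  assumes P: "cideal P" "1 \<notin> P" "cst c \<in> P"
  shows "c = 0"
proof (rule ccontr)
  assume "c \<noteq> 0"
  then have "cst (1 / c) * cst c = (1 :: ('n, 'k) mpol)" by (simp add: mult_single)
  then show False using cideal_mult[OF P(1,3), of "cst (1 / c)"] P(2) by simp
qed

text \<open>Dividing a relation by the lowest power of the first element moves it one step up the chain.\<close>

lemma prime_chain_independent:
  fixes fs :: "('n::finite, 'k::field) mpol list" and Q :: "nat \<Rightarrow> ('n, 'k) mpol set"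
  assumes "\<And>i. i \<le> length fs \<Longrightarrow> cprime (Q i)" "\<And>i. i < length fs \<Longrightarrow> Q i \<subseteq> Q (Suc i)"
    "\<And>i. i < length fs \<Longrightarrow> fs ! i \<in> Q (Suc i) - Q i"
    "finite X" "\<And>\<alpha>. \<alpha> \<in> X \<Longrightarrow> length \<alpha> = length fs"
    "(\<Sum>\<alpha>\<in>X. cst (c \<alpha>) * list_monomial fs \<alpha>) \<in> Q 0" "\<beta> \<in> X"
  shows "c \<beta> = 0"
  using assms
proof (induction fs arbitrary: Q X c \<beta>)
  case Nil
  then have "X = {[]}" "\<beta> = []" by auto
  then have "cst (c \<beta>) \<in> Q 0" using Nil.prems(6) by (simp add: list_monomial_def)
  then show ?case using cst_notin_proper[of "Q 0" "c \<beta>"] Nil.prems(1)[of 0] by (auto simp: cprime_iff)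
next
  case (Cons f fs)
  show ?case
  proof (rule ccontr)
    assume "c \<beta> \<noteq> 0"
    define X' where "X' = {\<alpha> \<in> X. c \<alpha> \<noteq> 0}"
    have X': "finite X'" "\<beta> \<in> X'" "X' \<subseteq> X" using Cons.prems \<open>c \<beta> \<noteq> 0\<close> by (auto simp: X'_def)
    define \<mu> where "\<mu> = Min (hd ` X')"
    have "\<mu> \<in> hd ` X'" unfolding \<mu>_def by (rule Min_in) (use X' in auto)
    then obtain \<gamma> where \<gamma>: "\<gamma> \<in> X'" "hd \<gamma> = \<mu>" by auto
    have le: "\<mu> \<le> hd \<alpha>" if "\<alpha> \<in> X'" for \<alpha> unfolding \<mu>_def by (rule Min_le) (use X' that in auto)
    have cons: "\<alpha> = hd \<alpha> # tl \<alpha>" "length (tl \<alpha>) = length fs" if "\<alpha> \<in> X" for \<alpha>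
      using Cons.prems(5)[OF that] by (cases \<alpha>; simp)+
    have Q0: "cprime (Q 0)" and Q1: "cprime (Q 1)" and Q01: "Q 0 \<subseteq> Q 1" and f: "f \<in> Q 1" "f \<notin> Q 0"
      using Cons.prems(1)[of 0] Cons.prems(1)[of 1] Cons.prems(2)[of 0] Cons.prems(3)[of 0] by auto
    let ?R = "\<Sum>\<alpha>\<in>X'. cst (c \<alpha>) * f ^ (hd \<alpha> - \<mu>) * list_monomial fs (tl \<alpha>)"
    have "(\<Sum>\<alpha>\<in>X. cst (c \<alpha>) * list_monomial (f # fs) \<alpha>) = (\<Sum>\<alpha>\<in>X'. cst (c \<alpha>) * list_monomial (f # fs) \<alpha>)"
      by (rule sum.mono_neutral_right) (use Cons.prems in \<open>auto simp: X'_def\<close>)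
    also have "\<dots> = (\<Sum>\<alpha>\<in>X'. f ^ \<mu> * (cst (c \<alpha>) * f ^ (hd \<alpha> - \<mu>) * list_monomial fs (tl \<alpha>)))"
    proof (rule sum.cong[OF refl])
      fix \<alpha> assume \<alpha>: "\<alpha> \<in> X'"
      have "list_monomial (f # fs) \<alpha> = f ^ hd \<alpha> * list_monomial fs (tl \<alpha>)"
        using cons(1)[of \<alpha>] \<alpha> X'(3) list_monomial_Cons by (metis subsetD)
      also have "f ^ hd \<alpha> = f ^ \<mu> * f ^ (hd \<alpha> - \<mu>)" using le[OF \<alpha>] by (simp add: power_add[symmetric])
      finally show "cst (c \<alpha>) * list_monomial (f # fs) \<alpha> = f ^ \<mu> * (cst (c \<alpha>) * f ^ (hd \<alpha> - \<mu>) * list_monomial fs (tl \<alpha>))"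
        by (simp add: ac_simps)
    qed
    also have "\<dots> = f ^ \<mu> * ?R" by (simp add: sum_distrib_left)
    finally have "f ^ \<mu> * ?R \<in> Q 0" using Cons.prems(6) by simp
    then have R: "?R \<in> Q 1" using Q0 Q01 f(2) cprime_power[OF Q0, of f \<mu>] by (auto simp: cprime_iff)
    \<comment> \<open>Terms in \<open>?B\<close> keep a factor \<open>f\<close> and lie in
      \<open>Q 1\<close>; those in \<open>?A\<close> have lost \<open>f\<close> altogether, so they
      form a relation in the remaining elements that starts at \<open>Q 1\<close>.\<close>
    let ?A = "{\<alpha> \<in> X'. hd \<alpha> = \<mu>}" and ?B = "{\<alpha> \<in> X'. hd \<alpha> \<noteq> \<mu>}"
    let ?t = "\<lambda>\<alpha>. cst (c \<alpha>) * f ^ (hd \<alpha> - \<mu>) * list_monomial fs (tl \<alpha>)"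
    have "X' = ?A \<union> ?B" by blast
    moreover have "sum ?t (?A \<union> ?B) = sum ?t ?A + sum ?t ?B" by (rule sum.union_disjoint) (use X' in auto)
    ultimately have split: "?R = sum ?t ?A + sum ?t ?B" by simp
    have "sum ?t ?B \<in> Q 1"
    proof (rule cideal_sum[OF cprime_ideal[OF Q1]])
      fix \<alpha> assume "\<alpha> \<in> ?B"
      then obtain k where "hd \<alpha> - \<mu> = Suc k" using le by (metis (mono_tags, lifting) Suc_diff_Suc le_neq_implies_less mem_Collect_eq)
      then have "?t \<alpha> = (cst (c \<alpha>) * f ^ k * list_monomial fs (tl \<alpha>)) * f" by (simp add: ac_simps)
      then show "?t \<alpha> \<in> Q 1" using cideal_mult[OF cprime_ideal[OF Q1] f(1)] by metis
    qed
    then have "sum ?t ?A \<in> Q 1"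
      using cideal_diff[OF cprime_ideal[OF Q1] R, of "sum ?t ?B"] unfolding split by simp
    moreover have "sum ?t ?A = (\<Sum>\<alpha>\<in>tl ` ?A. cst (c (\<mu> # \<alpha>)) * list_monomial fs \<alpha>)"
    proof (subst sum.reindex)
      show "inj_on tl ?A" using cons(1) X'(3) by (intro inj_onI) (metis (mono_tags, lifting) mem_Collect_eq subsetD)
      show "sum ?t ?A = sum ((\<lambda>\<alpha>. cst (c (\<mu> # \<alpha>)) * list_monomial fs \<alpha>) \<circ> tl) ?A"
      proof (rule sum.cong[OF refl])
        fix \<alpha> assume "\<alpha> \<in> ?A"
        then have "\<mu> # tl \<alpha> = \<alpha>" "hd \<alpha> = \<mu>" using cons(1)[of \<alpha>] X'(3) by auto
        then show "?t \<alpha> = ((\<lambda>\<alpha>. cst (c (\<mu> # \<alpha>)) * list_monomial fs \<alpha>) \<circ> tl) \<alpha>" by simp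
      qed
    qed
    ultimately have mem: "(\<Sum>\<alpha>\<in>tl ` ?A. cst (c (\<mu> # \<alpha>)) * list_monomial fs \<alpha>) \<in> Q (Suc 0)" by simp
    have "c (\<mu> # tl \<gamma>) = 0"
    proof (rule Cons.IH[of "\<lambda>i. Q (Suc i)" "tl ` ?A" "\<lambda>\<alpha>. c (\<mu> # \<alpha>)" "tl \<gamma>", OF _ _ _ _ _ mem])
      show "cprime (Q (Suc i))" if "i \<le> length fs" for i using Cons.prems(1)[of "Suc i"] that by simp
      show "Q (Suc i) \<subseteq> Q (Suc (Suc i))" if "i < length fs" for i using Cons.prems(2)[of "Suc i"] that by simp
      show "fs ! i \<in> Q (Suc (Suc i)) - Q (Suc i)" if "i < length fs" for i using Cons.prems(3)[of "Suc i"] that by simp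
      show "finite (tl ` ?A)" using X'(1) by simp
      show "length \<alpha> = length fs" if "\<alpha> \<in> tl ` ?A" for \<alpha> using that cons(2) X'(3) by auto
      show "tl \<gamma> \<in> tl ` ?A" using \<gamma> by blast
    qed
    moreover have "\<mu> # tl \<gamma> = \<gamma>" using cons(1)[of \<gamma>] \<gamma> X'(3) by auto
    ultimately show False using \<gamma>(1) by (simp add: X'_def)
  qed
qed

text \<open>Elements picked from the successive differences of a chain are algebraically
  independent, and there are at most as many of those as variables.\<close>

lemma prime_chain_length:
  fixes P :: "nat \<Rightarrow> ('n::finite, 'k::field) mpol set"
  assumes "prime_chain class_ring n P"
  shows "n \<le> card (UNIV :: 'n set)"
proof (rule ccontr)
  assume n: "\<not> ?thesis"
  have P: "\<And>i. i \<le> n \<Longrightarrow> cprime (P i)" "\<And>i. i < n \<Longrightarrow> P i \<subset> P (Suc i)"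
    using assms unfolding prime_chain_def by auto
  then have "\<forall>i. \<exists>f. i < n \<longrightarrow> f \<in> P (Suc i) - P i" by blast
  then obtain f where f: "\<And>i. i < n \<Longrightarrow> f i \<in> P (Suc i) - P i" by metis
  define fs where "fs = map f [0..<n]"
  have len: "length fs = n" by (simp add: fs_def)
  have "card (UNIV :: 'n set) < length fs" using n len by simp
  then obtain X c where X: "finite X" "\<forall>\<alpha>\<in>X. length \<alpha> = length fs"
    "(\<Sum>\<alpha>\<in>X. cst (c \<alpha>) * list_monomial fs \<alpha>) = 0" "\<exists>\<alpha>\<in>X. c \<alpha> \<noteq> 0"
    using algebraic_dependence[of fs] by blast
  have "c \<beta> = 0" if "\<beta> \<in> X" for \<beta>
    by (rule prime_chain_independent[of fs P X c]) (use P f len X that cideal_0[OF cprime_ideal[OF P(1)[of 0]]] in \<open>auto simp: fs_def\<close>)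
  then show False using X(4) by blast
qed

text \<open>Appending \<open>p\<close> to a longest chain ending at \<open>q\<close> raises the
  height. A longest chain exists only because lengths are bounded; two infinite heights would be
  equal.\<close>

lemma prime_height_strict_mono:
  fixes p q :: "('n::finite, 'k::field) mpol set"
  assumes "cprime p" "cprime q" "q \<subset> p"
  shows "prime_height class_ring q \<noteq> prime_height class_ring p"
proof -
  let ?N = "\<lambda>p :: ('n, 'k) mpol set. {n. \<exists>P. prime_chain class_ring n P \<and> P n = p}"
  have fin: "finite (?N p)" for p
    by (rule finite_subset[of _ "{..card (UNIV :: 'n set)}"]) (use prime_chain_length in auto)
  have ne: "0 \<in> ?N q" using assms(2) by (intro CollectI exI[of _ "\<lambda>_. q"]) (simp add: prime_chain_def)
  define k where "k = Max (?N q)"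
  have k: "k \<in> ?N q" unfolding k_def using Max_in[OF fin] ne by blast
  then obtain P where P: "prime_chain class_ring k P" "P k = q" by blast
  have "prime_chain class_ring (Suc k) (P(Suc k := p))"
    unfolding prime_chain_def
  proof (intro conjI allI impI)
    fix i show "i \<le> Suc k \<Longrightarrow> cprime ((P(Suc k := p)) i)"
      using P assms(1) by (auto simp: prime_chain_def le_Suc_eq)
    show "i < Suc k \<Longrightarrow> (P(Suc k := p)) i \<subset> (P(Suc k := p)) (Suc i)"
      using P assms(3) by (cases "i = k") (auto simp: prime_chain_def less_Suc_eq)
  qed
  then have "Suc k \<in> ?N p" by (intro CollectI exI[of _ "P(Suc k := p)"]) simp
  then have "enat (Suc k) \<le> prime_height class_ring p"
    unfolding prime_height_def by (intro Sup_upper) blast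
  moreover have "prime_height class_ring q \<le> enat k"
    unfolding prime_height_def
  proof (rule Sup_least)
    fix x assume "x \<in> {enat n |n. \<exists>P. prime_chain class_ring n P \<and> P n = q}"
    then obtain n where "x = enat n" "n \<in> ?N q" by blast
    then show "x \<le> enat k" unfolding k_def using Max_ge[OF fin] by simp
  qed
  ultimately have "\<not> prime_height class_ring p \<le> prime_height class_ring q"
    using order_trans[of "enat (Suc k)" _ "enat k"] by (meson enat_ord_simps(1) not_less_eq_eq order_refl order_trans)
  then show ?thesis by auto
qed

section \<open>Ideals generated by linear forms\<close>

lemma cst_mult: "cst (a * b) = cst a * cst b"
  by (simp add: mult_single)

lemma cst_add: "cst (a + b) = cst a + cst b"
  by (simp add: single_add)

lemma cst_sum: "cst (sum f A) = (\<Sum>x\<in>A. cst (f x))"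
  by (induction A rule: infinite_finite_induct) (auto simp: cst_add)

lemma cst_power: "cst (a ^ n) = cst a ^ n"
  by (induction n) (auto simp: cst_mult)

lemma variable_ne_0: "variable i \<noteq> 0"
  unfolding variable_def by (metis lookup_single_eq lookup_zero zero_neq_one)

lemma cideal_subst_kernel: "cideal {f. subst a f = 0}"
  by (rule cprime_ideal[OF cprime_subst_kernel])

text \<open>\<open>B\<close> is a largest set of variables that is linearly independent modulo the
  ideal, and \<open>a\<close> rewrites every variable in terms of \<open>B\<close>. A generator is
  rewritten to a combination of \<open>B\<close> lying in the ideal, hence to zero.\<close>

lemma linear_normal_form:
  fixes L :: "('n::finite, 'k::field) mpol set"
  assumes L: "L \<subseteq> graded_piece 1"
  obtains B a A where "gen L = {f. subst a f = 0}"
    "\<And>i. a i = (\<Sum>b\<in>B. cst (A i b) * variable b)" "\<And>b. b \<in> B \<Longrightarrow> a b = variable b"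
proof -
  let ?J = "gen L"
  define indep where "indep B \<longleftrightarrow> (\<forall>c. (\<Sum>b\<in>B. cst (c b) * variable b) \<in> ?J \<longrightarrow> (\<forall>b\<in>B. c b = 0))" for B
  have "indep {}" by (simp add: indep_def)
  moreover have "\<forall>B. indep B \<longrightarrow> card B < Suc (card (UNIV :: 'n set))"
    by (simp add: card_mono less_Suc_eq_le)
  ultimately obtain B where B: "indep B" "\<And>B'. indep B' \<Longrightarrow> card B' \<le> card B"
    using ex_has_greatest_nat[of indep "{}" card] by blast
  have dep: "\<exists>\<alpha>. variable i - (\<Sum>b\<in>B. cst (\<alpha> b) * variable b) \<in> ?J" if "i \<notin> B" for i
  proof -
    have "\<not> indep (insert i B)" using B(2)[of "insert i B"] that by fastforce
    then obtain c where c: "(\<Sum>b\<in>insert i B. cst (c b) * variable b) \<in> ?J" "\<exists>b\<in>insert i B. c b \<noteq> 0"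
      unfolding indep_def by blast
    have sum: "(\<Sum>b\<in>insert i B. cst (c b) * variable b) = cst (c i) * variable i + (\<Sum>b\<in>B. cst (c b) * variable b)"
      using that by (simp add: sum.insert[OF finite])
    have ci: "c i \<noteq> 0"
    proof
      assume "c i = 0"
      then have "(\<Sum>b\<in>B. cst (c b) * variable b) \<in> ?J" using c(1) sum by simp
      then show False using B(1) c(2) \<open>c i = 0\<close> unfolding indep_def by auto
    qed
    have "cst (1 / c i) * (\<Sum>b\<in>insert i B. cst (c b) * variable b) \<in> ?J"
      by (rule cideal_mult[OF cideal_gen c(1)])
    also have "cst (1 / c i) * (\<Sum>b\<in>insert i B. cst (c b) * variable b) =
        variable i - (\<Sum>b\<in>B. cst (- c b / c i) * variable b)"
    proof -
      have "(\<Sum>b\<in>B. cst (- c b / c i) * variable b) = - (cst (1 / c i) * (\<Sum>b\<in>B. cst (c b) * variable b))"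
        unfolding sum_distrib_left sum_negf[symmetric]
        by (rule sum.cong) (auto simp: mult.assoc[symmetric] mult_single single_uminus)
      moreover have "cst (1 / c i) * cst (c i) = (1 :: ('n, 'k) mpol)"
        using ci by (simp add: mult_single)
      ultimately show ?thesis unfolding sum by (simp add: distrib_left mult.assoc[symmetric])
    qed
    finally show ?thesis by (rule exI[of _ "\<lambda>b. - c b / c i"])
  qed
  define \<alpha> where "\<alpha> i = (SOME \<alpha>. variable i - (\<Sum>b\<in>B. cst (\<alpha> b) * variable b) \<in> ?J)" for i
  have \<alpha>: "variable i - (\<Sum>b\<in>B. cst (\<alpha> i b) * variable b) \<in> ?J" if "i \<notin> B" for i
    unfolding \<alpha>_def by (rule someI_ex[OF dep[OF that]])
  define A where "A i b = (if i \<in> B then (if b = i then 1 else 0) else \<alpha> i b)" for i b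
  define a where "a i = (\<Sum>b\<in>B. cst (A i b) * variable b)" for i
  have aB: "a b = variable b" if "b \<in> B" for b
  proof -
    have "a b = (\<Sum>b'\<in>B. if b' = b then variable b' else 0)"
      unfolding a_def by (rule sum.cong) (use that in \<open>auto simp: A_def\<close>)
    then show ?thesis using that by simp
  qed
  have aJ: "variable i - a i \<in> ?J" for i
  proof (cases "i \<in> B")
    case True
    then show ?thesis using aB cideal_0[OF cideal_gen] by simp
  next
    case False
    then show ?thesis using \<alpha>[OF False] by (simp add: a_def A_def)
  qed
  have ker: "?J = {f. subst a f = 0}"
  proof
    show "?J \<subseteq> {f. subst a f = 0}"
    proof (rule gen_minimal[OF cideal_subst_kernel], clarify)
      fix v assume v: "v \<in> L"
      then obtain c where c: "v = (\<Sum>i\<in>UNIV. cst (c i) * variable i)" using linear_form L by blast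
      define w where "w b = (\<Sum>i\<in>UNIV. c i * A i b)" for b
      have "subst a v = (\<Sum>i\<in>UNIV. \<Sum>b\<in>B. cst (c i * A i b) * variable b)"
        by (simp add: c subst_sum subst_mult a_def sum_distrib_left cst_mult mult.assoc)
      also have "\<dots> = (\<Sum>b\<in>B. cst (w b) * variable b)"
        unfolding w_def cst_sum sum_distrib_right by (rule sum.swap)
      finally have sv: "subst a v = (\<Sum>b\<in>B. cst (w b) * variable b)" .
      have "v \<in> ?J" using v by (rule gen_incl)
      then have "subst a v \<in> ?J"
        using cideal_cong[OF cideal_gen subst_congruent[OF cideal_gen aJ, of v]] by blast
      then have "\<forall>b\<in>B. w b = 0" using B(1) unfolding indep_def sv by blast
      then show "subst a v = 0" unfolding sv by simp
    qed
    show "{f. subst a f = 0} \<subseteq> ?J"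
    proof clarify
      fix f assume "subst a f = 0"
      then show "f \<in> ?J" using subst_congruent[OF cideal_gen aJ, of f] by simp
    qed
  qed
  show ?thesis by (rule that[OF ker _ aB]) (simp_all add: a_def)
qed

lemma cprime_linear: "L \<subseteq> graded_piece 1 \<Longrightarrow> cprime (gen L)"
  by (rule linear_normal_form[of L]) (simp_all add: cprime_subst_kernel)

text \<open>\<open>L\<close> may be infinite, whereas the argument for associated primes of colon
  ideals needs finitely many generators; the differences \<open>variable i - a i\<close> provide
  them.\<close>

lemma linear_finite_generators:
  fixes L :: "('n::finite, 'k::field) mpol set"
  assumes L: "L \<subseteq> graded_piece 1"
  shows "\<exists>G. finite G \<and> gen L = gen G"
proof -
  obtain B a A where n: "gen L = {f. subst a f = 0}"
    "\<And>i. a i = (\<Sum>b\<in>B. cst (A i b) * variable b)" "\<And>b. b \<in> B \<Longrightarrow> a b = variable b"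
    by (rule linear_normal_form[OF L]) blast
  have fix_a: "subst a (a i) = a i" for i
    unfolding n(2)[of i] subst_sum subst_mult by (rule sum.cong) (use n(3) in auto)
  let ?G = "range (\<lambda>i. variable i - a i)"
  have "gen L \<subseteq> gen ?G"
  proof
    fix f assume "f \<in> gen L"
    then have "subst a f = 0" using n(1) by blast
    then show "f \<in> gen ?G" using subst_congruent[OF cideal_gen[of ?G], of a f] gen_incl[of _ ?G] by auto
  qed
  moreover have "gen ?G \<subseteq> gen L"
    by (rule gen_minimal[OF cideal_gen]) (auto simp: n(1) subst_diff fix_a)
  ultimately show ?thesis by (intro exI[of _ ?G]) auto
qed

lemma irrelevant_variable: "variable i \<in> irrelevant_ideal"
  unfolding irrelevant_ideal_def by (rule gen_incl) simp

lemma cideal_irrelevant: "cideal irrelevant_ideal"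
  unfolding irrelevant_ideal_def by (rule cideal_gen)

lemma cprime_irrelevant: "cprime irrelevant_ideal"
  unfolding irrelevant_ideal_def by (rule cprime_linear) (use graded_piece_variable in auto)

lemma irrelevant_minimal: "cideal J \<Longrightarrow> (\<And>i. variable i \<in> J) \<Longrightarrow> irrelevant_ideal \<subseteq> J"
  unfolding irrelevant_ideal_def by (rule gen_minimal) auto

lemma graded_piece_irrelevant: "d > 0 \<Longrightarrow> graded_piece d \<subseteq> irrelevant_ideal"
proof
  fix f assume "d > 0" "f \<in> graded_piece d"
  then have "total_deg m \<noteq> 0" if "m \<in> Poly_Mapping.keys f" for m using that by (auto simp: graded_piece_def)
  then have "0 \<notin> Poly_Mapping.keys f" using total_deg_0_iff by blast
  then have "Poly_Mapping.lookup f 0 = 0" by (simp add: in_keys_iff)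
  then show "f \<in> irrelevant_ideal" by (simp add: irrelevant_iff)
qed

lemma irrelevant_maximal:
  fixes J :: "('n::finite, 'k::field) mpol set"
  assumes J: "cideal J" "irrelevant_ideal \<subset> J"
  shows "J = UNIV"
proof -
  obtain f where f: "f \<in> J" "f \<notin> irrelevant_ideal" using J by blast
  then have nz: "Poly_Mapping.lookup f 0 \<noteq> 0" by (simp add: irrelevant_iff)
  have "f - cst (Poly_Mapping.lookup f 0) \<in> irrelevant_ideal"
    unfolding irrelevant_iff by (simp add: lookup_minus)
  then have "cst (Poly_Mapping.lookup f 0) \<in> J" using cideal_cong[OF J(1)] f(1) J(2) by blast
  then have "1 \<in> J" using cst_notin_proper[OF J(1)] nz by blast
  then show ?thesis using cideal_one J(1) by blast
qed

text \<open>This disposes of degree 0: were an associated prime the colon ideal of a constant, it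
  would be \<open>I\<close> itself.\<close>

lemma colon_constant:
  fixes J :: "('n::finite, 'k::field) mpol set"
  assumes J: "cideal J" and f: "f \<in> graded_piece 0"
  shows "colon J f = UNIV \<or> colon J f = J"
proof -
  obtain c where c: "f = cst c" using graded_piece_zero_cst[OF f] by blast
  show ?thesis
  proof (cases "c = 0")
    case True
    then show ?thesis using c cideal_0[OF J] by (auto simp: colon_def)
  next
    case False
    have "h \<in> colon J f \<longleftrightarrow> h \<in> J" for h
    proof -
      have "cst (1 / c) * f = 1" using False by (simp add: c mult_single)
      then have "h = cst (1 / c) * (h * f)" by (simp add: mult.left_commute[of _ h])
      then show ?thesis using cideal_mult[OF J, of "h * f" "cst (1 / c)"]
        cideal_mult'[OF J, of h f] by (auto simp: colon_def)
    qed
    then show ?thesis by blast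
  qed
qed

section \<open>Primes of the quotient ring\<close>

lemma coset_class_ring: "I +>\<^bsub>class_ring\<^esub> x = {i + x | i. i \<in> I}"
  by (auto simp: a_r_coset_def r_coset_def)

lemma quotient_prime_vimage:
  fixes I :: "'a::comm_ring_1 set"
  assumes I: "cideal I" and P: "primeideal P (class_ring Quot I)"
  shows "cprime {x. I +>\<^bsub>class_ring\<^esub> x \<in> P}" "I \<subseteq> {x. I +>\<^bsub>class_ring\<^esub> x \<in> P}"
proof -
  interpret ideal I class_ring by (rule I)
  interpret h: ring_hom_ring class_ring "class_ring Quot I" "(+>\<^bsub>class_ring\<^esub>) I" by (rule rcos_ring_hom_ring)
  have "primeideal {r \<in> carrier class_ring. I +>\<^bsub>class_ring\<^esub> r \<in> P} class_ring"
    by (rule h.primeideal_vimage[OF class_cring.is_cring P])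
  then show "cprime {x. I +>\<^bsub>class_ring\<^esub> x \<in> P}" by simp
  interpret P: primeideal P "class_ring Quot I" by (rule P)
  have "I \<in> P" using P.zero_closed by (simp add: FactRing_def)
  then show "I \<subseteq> {x. I +>\<^bsub>class_ring\<^esub> x \<in> P}" using ring.a_rcos_zero[OF class_ring.ring_axioms I] by auto
qed

lemma quotient_prime_image:
  fixes I :: "'a::comm_ring_1 set"
  assumes I: "cideal I" and Q: "cprime Q" "I \<subseteq> Q"
  shows "primeideal ((+>\<^bsub>class_ring\<^esub>) I ` Q) (class_ring Quot I)"
    and "I +>\<^bsub>class_ring\<^esub> x \<in> (+>\<^bsub>class_ring\<^esub>) I ` Q \<longleftrightarrow> x \<in> Q"
proof -
  interpret ideal I class_ring by (rule I)
  interpret h: ring_hom_ring class_ring "class_ring Quot I" "(+>\<^bsub>class_ring\<^esub>) I" by (rule rcos_ring_hom_ring)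
  note Qi = cprime_ideal[OF Q(1)]
  have mem: "I +>\<^bsub>class_ring\<^esub> x \<in> (+>\<^bsub>class_ring\<^esub>) I ` Q \<longleftrightarrow> x \<in> Q" for x
  proof
    assume "I +>\<^bsub>class_ring\<^esub> x \<in> (+>\<^bsub>class_ring\<^esub>) I ` Q"
    then obtain q where q: "q \<in> Q" "{i + x | i. i \<in> I} = {i + q | i. i \<in> I}"
      unfolding coset_class_ring by auto
    have "x \<in> {i + x | i. i \<in> I}" using cideal_0[OF I] by force
    then obtain i where "x = i + q" "i \<in> I" using q(2) by blast
    then show "x \<in> Q" using cideal_add[OF Qi] Q(2) q(1) by blast
  qed blast
  then show "I +>\<^bsub>class_ring\<^esub> x \<in> (+>\<^bsub>class_ring\<^esub>) I ` Q \<longleftrightarrow> x \<in> Q" .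
  have carrier: "X \<in> carrier (class_ring Quot I) \<longleftrightarrow> (\<exists>x. X = I +>\<^bsub>class_ring\<^esub> x)" for X
    by (auto simp: FactRing_def A_RCOSETS_def')
  show "primeideal ((+>\<^bsub>class_ring\<^esub>) I ` Q) (class_ring Quot I)"
  proof (rule primeidealI)
    show "ideal ((+>\<^bsub>class_ring\<^esub>) I ` Q) (class_ring Quot I)" by (rule ring.ring_ideal_imp_quot_ideal[OF class_ring.ring_axioms I Qi])
    show "cring (class_ring Quot I)" by (rule quotient_is_cring[OF class_cring.is_cring])
    show "carrier (class_ring Quot I) \<noteq> (+>\<^bsub>class_ring\<^esub>) I ` Q"
      using carrier mem[of 1] Q(1) by (metis cprime_iff)
    fix X Y assume X: "X \<in> carrier (class_ring Quot I)" and Y: "Y \<in> carrier (class_ring Quot I)"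
      and XY: "X \<otimes>\<^bsub>class_ring Quot I\<^esub> Y \<in> (+>\<^bsub>class_ring\<^esub>) I ` Q"
    obtain x y where xy: "X = I +>\<^bsub>class_ring\<^esub> x" "Y = I +>\<^bsub>class_ring\<^esub> y" using X Y carrier by auto
    have "X \<otimes>\<^bsub>class_ring Quot I\<^esub> Y = I +>\<^bsub>class_ring\<^esub> (x * y)"
      using h.hom_mult[of x y] by (simp add: xy)
    then have "x * y \<in> Q" using XY mem by simp
    then show "X \<in> (+>\<^bsub>class_ring\<^esub>) I ` Q \<or> Y \<in> (+>\<^bsub>class_ring\<^esub>) I ` Q"
      using Q(1) mem unfolding xy cprime_iff by blast
  qed
qed

lemma krull_dim_one_chain:
  fixes I :: "'a::comm_ring_1 set"
  assumes I: "cideal I" and dim: "krull_dim (class_ring Quot I) = 1"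
  shows "\<exists>P Q. cprime P \<and> cprime Q \<and> I \<subseteq> P \<and> P \<subset> Q"
    and "\<lbrakk>cprime P; cprime Q; cprime R; I \<subseteq> P; P \<subset> Q; Q \<subset> R\<rbrakk> \<Longrightarrow> False"
proof -
  let ?R = "class_ring Quot I"
  have "\<exists>n P. prime_chain ?R n P \<and> n \<ge> 1"
  proof (rule ccontr)
    assume "\<not> ?thesis"
    then have "enat n \<le> 0" if "prime_chain ?R n P" for n P using that by (fastforce simp: zero_enat_def)
    then have "krull_dim ?R \<le> 0" unfolding krull_dim_def by (intro Sup_least) blast
    then show False using dim by simp
  qed
  then obtain n P where P: "prime_chain ?R n P" "n \<ge> 1" by blast
  then have pr: "primeideal (P 0) ?R" "primeideal (P 1) ?R" "P 0 \<subset> P 1"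
    unfolding prime_chain_def by auto
  let ?v = "\<lambda>P. {x. I +>\<^bsub>class_ring\<^esub> x \<in> P}"
  obtain X where X: "X \<in> P 1" "X \<notin> P 0" using pr(3) by blast
  interpret P1: primeideal "P 1" ?R by (rule pr(2))
  have "X \<in> carrier ?R" using X(1) P1.a_subset by blast
  then obtain x where "X = I +>\<^bsub>class_ring\<^esub> x" by (auto simp: FactRing_def A_RCOSETS_def')
  then have "?v (P 0) \<subset> ?v (P 1)" using X pr(3) by blast
  then show "\<exists>P Q. cprime P \<and> cprime Q \<and> I \<subseteq> P \<and> P \<subset> Q"
    using quotient_prime_vimage[OF I pr(1)] quotient_prime_vimage[OF I pr(2)] by blast
next
  assume P: "cprime P" "I \<subseteq> P" and Q: "cprime Q" "P \<subset> Q" and R: "cprime R" "Q \<subset> R"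
  let ?R = "class_ring Quot I" and ?h = "(+>\<^bsub>class_ring\<^esub>) I"
  have IQ: "I \<subseteq> Q" "I \<subseteq> R" using P Q R by auto
  define c where "c i = (if i = 0 then ?h ` P else if i = 1 then ?h ` Q else ?h ` R)" for i :: nat
  have "prime_chain ?R 2 c"
    unfolding prime_chain_def
  proof (intro conjI allI impI)
    fix i :: nat
    show "primeideal (c i) ?R"
      using quotient_prime_image(1)[OF I] P Q R IQ by (simp add: c_def)
    assume "i < 2"
    then consider "i = 0" | "i = 1" by linarith
    then show "c i \<subset> c (Suc i)"
    proof cases
      case 1
      obtain x where "x \<in> Q" "x \<notin> P" using Q by blast
      then have "?h x \<in> ?h ` Q" "?h x \<notin> ?h ` P" using quotient_prime_image(2)[OF I P] by auto
      then show ?thesis using Q by (auto simp: c_def 1)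
    next
      case 2
      obtain x where "x \<in> R" "x \<notin> Q" using R by blast
      then have "?h x \<in> ?h ` R" "?h x \<notin> ?h ` Q" using quotient_prime_image(2)[OF I Q(1) IQ(1)] by auto
      then show ?thesis using R by (auto simp: c_def 2)
    qed
  qed
  then have "enat 2 \<le> krull_dim ?R" unfolding krull_dim_def by (intro Sup_upper) blast
  then show False using dim by (simp add: one_enat_def)
qed

section \<open>Geramita ideals\<close>

lemma Ass_D: "p \<in> Ass I \<Longrightarrow> cprime p" "p \<in> Ass I \<Longrightarrow> \<exists>f. p = colon I f"
  by (auto simp: Ass_def)

context
  fixes I :: "('n::finite, 'k::field) mpol set"
  assumes geramita: "geramita_ideal I"
begin

lemma geramita_cideal: "cideal I"
  and geramita_graded: "graded_ideal I"
  and geramita_linear: "p \<in> Ass I \<Longrightarrow> \<exists>L. L \<subseteq> graded_piece 1 \<and> p = gen L"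
  and geramita_dim: "krull_dim (class_ring Quot I) = 1"
  using geramita unfolding geramita_ideal_def graded_ideal_def by auto

lemma Ass_incomparable: "p \<in> Ass I \<Longrightarrow> q \<in> Ass I \<Longrightarrow> q \<subseteq> p \<Longrightarrow> q = p"
  using geramita prime_height_strict_mono[of p q] Ass_D(1)[of p I] Ass_D(1)[of q I]
  unfolding geramita_ideal_def unmixed_def by blast

lemma geramita_filtration:
  obtains qs where "set qs \<subseteq> Ass I" "foldl colon_set I qs = UNIV"
  using Ass_filtration[OF geramita_cideal] linear_finite_generators geramita_linear by metis

text \<open>Every associated prime lies in the irrelevant ideal, so by incomparability the latter
  would be the only one. A product of copies of it then lies in \<open>I\<close>, and every prime
  above \<open>I\<close> is maximal, against dimension one.\<close>

lemma irrelevant_not_Ass: "irrelevant_ideal \<notin> Ass I"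
proof
  assume m: "irrelevant_ideal \<in> Ass I"
  have all: "q = irrelevant_ideal" if q: "q \<in> Ass I" for q
  proof -
    obtain L where L: "L \<subseteq> graded_piece 1" "q = gen L" using geramita_linear[OF q] by blast
    have "q \<subseteq> irrelevant_ideal" unfolding L(2)
      by (rule gen_minimal[OF cideal_irrelevant]) (use L(1) graded_piece_irrelevant[of 1] in auto)
    then show ?thesis using Ass_incomparable m q by blast
  qed
  obtain qs where qs: "set qs \<subseteq> Ass I" "foldl colon_set I qs = UNIV" by (rule geramita_filtration)
  have "\<exists>e. \<forall>b\<in>graded_piece (int e). \<exists>r j. b = r * 0 + j \<and> j \<in> q" if "q \<in> set qs" for q
  proof (rule exI[of _ 1], rule ballI)
    fix b :: "('n, 'k) mpol" assume "b \<in> graded_piece (int 1)"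
    then have "b \<in> q" using all[of q] that qs(1) graded_piece_irrelevant[of 1] by auto
    then show "\<exists>r j. b = r * 0 + j \<and> j \<in> q" by auto
  qed
  then have "\<exists>e. \<forall>k a u. k \<ge> int e \<longrightarrow> a \<in> graded_piece k \<longrightarrow> u \<in> foldl colon_set I qs \<longrightarrow>
    a * u \<in> {r * 0 + j | r j. j \<in> I}"
    by (rule filtration_power[OF geramita_cideal])
  then obtain e where e: "\<forall>k a u. k \<ge> int e \<longrightarrow> a \<in> graded_piece k \<longrightarrow> u \<in> foldl colon_set I qs \<longrightarrow>
    a * u \<in> {r * 0 + j | r j. j \<in> I}"
    by (rule exE)
  have pow: "variable i ^ e \<in> I" for i
    using e[rule_format, of "int e" "variable i ^ e" 1] graded_piece_power[OF graded_piece_variable, of i e] qs(2) by auto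
  obtain P Q where PQ: "cprime P" "cprime Q" "I \<subseteq> P" "P \<subset> Q"
    using krull_dim_one_chain(1)[OF geramita_cideal geramita_dim] by blast
  have "variable i \<in> P" for i using cprime_power[OF PQ(1)] pow PQ(3) by blast
  then have "irrelevant_ideal \<subseteq> P" using irrelevant_minimal cprime_ideal[OF PQ(1)] by blast
  then have "Q = UNIV" using irrelevant_maximal[OF cprime_ideal[OF PQ(2)]] PQ(4) by blast
  then show False using PQ(2) by (auto simp: cprime_iff)
qed

lemma depth_positive:
  assumes "\<And>i. variable i * u \<in> I"
  shows "u \<in> I"
proof (rule ccontr)
  assume u: "u \<notin> I"
  have c: "cideal (colon I u)" by (rule cideal_colon[OF geramita_cideal])
  have "irrelevant_ideal \<subseteq> colon I u"
    by (rule irrelevant_minimal[OF c]) (use assms in \<open>simp add: colon_def\<close>)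
  moreover have "colon I u \<noteq> UNIV" using colon_UNIV_iff[OF geramita_cideal] u by blast
  ultimately have "irrelevant_ideal = colon I u" using irrelevant_maximal[OF c] by blast
  then have "irrelevant_ideal \<in> Ass I" using cprime_irrelevant unfolding Ass_def by blast
  then show False using irrelevant_not_Ass by blast
qed

lemma depth_positive_power:
  assumes "\<And>a. a \<in> graded_piece (int e) \<Longrightarrow> a * u \<in> I"
  shows "u \<in> I"
  using assms
proof (induction e arbitrary: u)
  case 0
  show ?case using 0[of 1] graded_piece_cst[of 1] by simp
next
  case (Suc e)
  show ?case
  proof (rule depth_positive, rule Suc.IH)
    fix i and a :: "('n, 'k) mpol" assume "a \<in> graded_piece (int e)"
    then have "a * variable i \<in> graded_piece (int (Suc e))"
      using graded_piece_mult[OF _ graded_piece_variable, of a "int e" i] by (simp add: add.commute)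
    then have "(a * variable i) * u \<in> I" by (rule Suc.prems)
    then show "a * (variable i * u) \<in> I" by (simp add: mult.assoc)
  qed
qed

text \<open>These primes are ideals of rational points of projective space: the \<open>c i\<close>
  are homogeneous coordinates, normalised to 1 at a variable outside \<open>p\<close>. The set
  \<open>B\<close> of independent variables must be a singleton.\<close>

lemma Ass_point:
  assumes p: "p \<in> Ass I"
  obtains i0 c where "variable i0 \<notin> p" "c i0 = 1" "p = {f. subst (\<lambda>i. cst (c i) * variable i0) f = 0}"
proof -
  obtain L where L: "L \<subseteq> graded_piece 1" "p = gen L" using geramita_linear[OF p] by blast
  obtain B a A where n: "gen L = {f. subst a f = 0}"
    "\<And>i. a i = (\<Sum>b\<in>B. cst (A i b) * variable b)" "\<And>b. b \<in> B \<Longrightarrow> a b = variable b"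
    by (rule linear_normal_form[OF L(1)]) blast
  have pc: "cprime p" "I \<subseteq> p" using Ass_D[OF p] colon_incl[OF geramita_cideal] by auto
  have notin: "variable b \<notin> p" if "b \<in> B" for b
    using n(3)[OF that] variable_ne_0 by (simp add: L(2) n(1))
  have "B \<noteq> {}"
  proof
    assume "B = {}"
    then have "variable i \<in> p" for i using n(2) by (simp add: L(2) n(1))
    then have "irrelevant_ideal \<subseteq> p" using irrelevant_minimal cprime_ideal[OF pc(1)] by blast
    then have "p = irrelevant_ideal"
      using irrelevant_maximal[OF cprime_ideal[OF pc(1)]] pc(1) by (auto simp: cprime_iff)
    then show False using irrelevant_not_Ass p by simp
  qed
  then obtain b where b: "b \<in> B" by blast
  have "b' = b" if b': "b' \<in> B" for b'
  proof (rule ccontr)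
    assume ne: "b' \<noteq> b"
    \<comment> \<open>A second independent variable \<open>b'\<close> would give the chain of primes
      \<open>p\<close>, \<open>p\<close> plus \<open>b\<close>, irrelevant ideal, of length two
      above \<open>I\<close>. The ideal \<open>?K\<close>, obtained by setting \<open>b\<close> to
      zero after \<open>a\<close>, shows that \<open>b'\<close> is not in the middle one.\<close>
    let ?L = "insert (variable b) L"
    have L': "?L \<subseteq> graded_piece 1" using L(1) graded_piece_variable by auto
    let ?\<sigma> = "\<lambda>j. if j = b then 0 else variable j"
    let ?K = "{f. subst ?\<sigma> (subst a f) = 0}"
    have K: "cideal ?K" unfolding cideal_iff by (auto simp: subst_add subst_mult)
    have "?L \<subseteq> ?K" using n(1) gen_incl[of _ L] n(3)[OF b] by auto
    then have "gen ?L \<subseteq> ?K" by (rule gen_minimal[OF K])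
    moreover have "variable b' \<notin> ?K" using n(3)[OF b'] ne variable_ne_0 by simp
    ultimately have b'n: "variable b' \<notin> gen ?L" by blast
    have 1: "p \<subset> gen ?L"
    proof
      show "p \<subseteq> gen ?L" unfolding L(2) by (rule gen_minimal[OF cideal_gen]) (auto intro: gen_incl)
      show "p \<noteq> gen ?L" using notin[OF b] gen_incl[of "variable b" ?L] by auto
    qed
    have 2: "gen ?L \<subset> irrelevant_ideal"
    proof
      show "gen ?L \<subseteq> irrelevant_ideal"
        by (rule gen_minimal[OF cideal_irrelevant]) (use L' graded_piece_irrelevant[of 1] in auto)
      show "gen ?L \<noteq> irrelevant_ideal" using b'n irrelevant_variable by blast
    qed
    show False
      by (rule krull_dim_one_chain(2)[OF geramita_cideal geramita_dim pc(1) cprime_linear[OF L'] cprime_irrelevant pc(2) 1 2])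
  qed
  then have B: "B = {b}" using b by blast
  let ?c = "(\<lambda>i. A i b)(b := 1)"
  have "a = (\<lambda>i. cst (?c i) * variable b)" using n(2) n(3)[OF b] by (auto simp: B)
  then show ?thesis using that[of b ?c] notin[OF b] n(1) L(2) by simp
qed

lemma subst_line:
  fixes f x :: "('n, 'k) mpol"
  assumes "f \<in> graded_piece (int e)"
  obtains \<beta> where "subst (\<lambda>i. cst (c i) * x) f = cst \<beta> * x ^ e"
proof -
  have "(\<Prod>i\<in>UNIV. (cst (c i) * x) ^ Poly_Mapping.lookup m i) =
      cst (\<Prod>i\<in>UNIV. c i ^ Poly_Mapping.lookup m i) * x ^ e" if m: "m \<in> Poly_Mapping.keys f" for m
  proof -
    have "total_deg m = e" using assms m by (auto simp: graded_piece_def)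
    then have "(\<Prod>i\<in>UNIV. x ^ Poly_Mapping.lookup m i) = x ^ e"
      using power_sum[of x "Poly_Mapping.lookup m" UNIV] by (simp add: total_deg_def)
    moreover have "(\<Prod>i\<in>A. cst (c i) ^ Poly_Mapping.lookup m i :: ('n, 'k) mpol) = cst (\<Prod>i\<in>A. c i ^ Poly_Mapping.lookup m i)" for A :: "'n set"
      by (induction A rule: infinite_finite_induct) (auto simp: cst_mult cst_power)
    ultimately show ?thesis by (simp add: power_mult_distrib prod.distrib)
  qed
  then have "subst (\<lambda>i. cst (c i) * x) f = (\<Sum>m\<in>Poly_Mapping.keys f.
      cst (Poly_Mapping.lookup f m * (\<Prod>i\<in>UNIV. c i ^ Poly_Mapping.lookup m i)) * x ^ e)"
    unfolding subst_def by (intro sum.cong) (auto simp: cst_mult mult.assoc)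
  also have "\<dots> = cst (\<Sum>m\<in>Poly_Mapping.keys f. Poly_Mapping.lookup f m * (\<Prod>i\<in>UNIV. c i ^ Poly_Mapping.lookup m i)) * x ^ e"
    by (simp add: cst_sum sum_distrib_right)
  finally show ?thesis by (rule that)
qed

text \<open>Modulo \<open>p\<close> the ring is a polynomial ring in one variable, so forms of
  degree \<open>e\<close> span at most a line, and any \<open>h\<close> outside \<open>p\<close>
  spans it.\<close>

lemma Ass_plus_form:
  assumes p: "p \<in> Ass I" and h: "h \<in> graded_piece (int e)" "h \<notin> p" and b: "b \<in> graded_piece (int e)"
  shows "\<exists>r j. b = r * h + j \<and> j \<in> p"
proof -
  obtain i0 c where n: "p = {f. subst (\<lambda>i. cst (c i) * variable i0) f = 0}"
    by (rule Ass_point[OF p]) blast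
  let ?s = "subst (\<lambda>i. cst (c i) * variable i0)"
  obtain \<gamma> where \<gamma>: "?s h = cst \<gamma> * variable i0 ^ e" using subst_line[OF h(1)] by blast
  obtain \<beta> where \<beta>: "?s b = cst \<beta> * variable i0 ^ e" using subst_line[OF b] by blast
  have "\<gamma> \<noteq> 0" using h(2) \<gamma> n by auto
  then have "?s (b - cst (\<beta> / \<gamma>) * h) = 0"
    by (simp add: subst_diff subst_mult \<gamma> \<beta> mult.assoc[symmetric] mult_single)
  then have "b = cst (\<beta> / \<gamma>) * h + (b - cst (\<beta> / \<gamma>) * h) \<and> b - cst (\<beta> / \<gamma>) * h \<in> p" using n by simp
  then show ?thesis by blast
qed

text \<open>Prime avoidance by forms, valid over finite fields: if \<open>h\<close> falls into the
  new prime \<open>q\<close>, incomparability gives each earlier prime a linear form outside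
  \<open>q\<close>. Their product \<open>g\<close> lies in all earlier primes but not in
  \<open>q\<close>, and powers of \<open>h\<close> and \<open>g\<close> of equal degree are
  added.\<close>

lemma avoiding_form:
  assumes "set qs \<subseteq> Ass I"
  shows "\<exists>e h. e \<ge> 1 \<and> h \<in> graded_piece (int e) \<and> (\<forall>q\<in>set qs. h \<notin> q)"
  using assms
proof (induction qs)
  case Nil
  show ?case using graded_piece_variable by (intro exI[of _ 1] exI[of _ "variable undefined"]) auto
next
  case (Cons q qs)
  then obtain e h where h: "e \<ge> 1" "h \<in> graded_piece (int e)" "\<forall>q\<in>set qs. h \<notin> q" by auto
  show ?case
  proof (cases "h \<in> q")
    case False
    then show ?thesis using h by auto
  next
    case True
    have q: "q \<in> Ass I" and cq: "cprime q" using Cons.prems Ass_D by auto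
    have "\<exists>lf. lf \<in> graded_piece 1 \<and> lf \<in> q' \<and> lf \<notin> q" if q': "q' \<in> set qs" for q'
    proof (rule ccontr)
      assume no: "\<not> ?thesis"
      have q'A: "q' \<in> Ass I" using q' Cons.prems by auto
      then obtain L where L: "L \<subseteq> graded_piece 1" "q' = gen L" using geramita_linear by blast
      then have "L \<subseteq> q" using no gen_incl by blast
      then have "q' \<subseteq> q" unfolding L(2) by (rule gen_minimal[OF cprime_ideal[OF cq]])
      then have "q' = q" using Ass_incomparable q q'A by blast
      then show False using True h(3) q' by blast
    qed
    then obtain lf where lf: "\<And>q'. q' \<in> set qs \<Longrightarrow> lf q' \<in> graded_piece 1 \<and> lf q' \<in> q' \<and> lf q' \<notin> q" by metis
    obtain i0 where i0: "variable i0 \<notin> q" by (rule Ass_point[OF q]) blast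
    \<comment> \<open>The extra variable makes the degree of \<open>g\<close> positive even for an
      empty list; that degree is the exponent of \<open>h\<close>, which must be nonzero for the
      power to lie in \<open>q\<close>.\<close>
    define g where "g = variable i0 * prod_list (map lf qs)"
    have "prod_list (map lf xs) \<in> graded_piece (int (length xs)) \<and> prod_list (map lf xs) \<notin> q \<and>
        (\<forall>q'\<in>set xs. prod_list (map lf xs) \<in> q')" if "set xs \<subseteq> set qs" for xs
      using that
    proof (induction xs)
      case Nil
      show ?case using graded_piece_cst[of 1] cq by (auto simp: cprime_iff)
    next
      case (Cons y ys)
      have "lf y * prod_list (map lf ys) \<in> graded_piece (1 + int (length ys))"
        by (rule graded_piece_mult) (use Cons lf in auto)
      moreover have "cideal q'" if "q' \<in> set qs" for q'
        using that \<open>set (q # qs) \<subseteq> Ass I\<close> Ass_D(1) cprime_ideal by auto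
      ultimately show ?case using Cons lf[of y] cq by (auto simp: cprime_iff intro: cideal_mult cideal_mult')
    qed
    from this[of qs] have g1: "prod_list (map lf qs) \<in> graded_piece (int (length qs))"
      "prod_list (map lf qs) \<notin> q" "\<forall>q'\<in>set qs. prod_list (map lf qs) \<in> q'" by auto
    let ?n = "Suc (length qs)"
    have g: "g \<in> graded_piece (int ?n)" "g \<notin> q"
      using graded_piece_mult[OF graded_piece_variable g1(1), of i0] i0 g1(2) cq
      by (auto simp: g_def cprime_iff)
    have gq: "g \<in> q'" if "q' \<in> set qs" for q'
      using that g1(3) Cons.prems Ass_D(1)[of q' I] cprime_ideal[of q'] cideal_mult[of q'] unfolding g_def by auto
    let ?h = "h ^ ?n + g ^ e"
    have "?h \<in> graded_piece (int (e * ?n))"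
      using graded_piece_power[OF h(2), of ?n] graded_piece_power[OF g(1), of e]
      by (intro graded_piece_add) (simp_all only: of_nat_mult mult.commute)
    moreover have "?h \<notin> q'" if q': "q' \<in> set (q # qs)" for q'
    proof -
      have c: "cprime q'" using q' Cons.prems Ass_D(1) by auto
      note ci = cprime_ideal[OF c]
      show ?thesis
      proof (cases "h \<in> q'")
        case True
        then have "q' = q" using q' h(3) by auto
        then have "g ^ e \<notin> q'" using g(2) cprime_power[OF c] by blast
        moreover have "h ^ ?n \<in> q'" using True cideal_mult'[OF ci] by simp
        ultimately show ?thesis using cideal_diff[OF ci, of ?h "h ^ ?n"] by auto
      next
        case False
        then have "h ^ ?n \<notin> q'" using cprime_power[OF c] by blast
        moreover have "g \<in> q'" using False q' gq \<open>h \<in> q\<close> by auto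
        then have "g ^ e \<in> q'" using h(1) cideal_mult'[OF ci] by (cases e) auto
        ultimately show ?thesis using cideal_diff[OF ci, of ?h "g ^ e"] by auto
      qed
    qed
    moreover have "e * ?n \<ge> 1" using h(1) by simp
    ultimately show ?thesis by blast
  qed
qed

lemma geramita_parameter:
  obtains e h N where "e \<ge> 1" "h \<in> graded_piece (int e)" "\<And>u. h * u \<in> I \<Longrightarrow> u \<in> I"
    "\<And>k a. k \<ge> int N \<Longrightarrow> a \<in> graded_piece k \<Longrightarrow> \<exists>r j. a = r * h + j \<and> j \<in> I"
proof -
  obtain qs where qs: "set qs \<subseteq> Ass I" "foldl colon_set I qs = UNIV" by (rule geramita_filtration)
  obtain e h where h: "e \<ge> 1" "h \<in> graded_piece (int e)" "\<forall>q\<in>set qs. h \<notin> q"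
    using avoiding_form[OF qs(1)] by blast
  have plus: "\<exists>r j. b = r * h + j \<and> j \<in> q" if "q \<in> set qs" "b \<in> graded_piece (int e)" for q b
    using Ass_plus_form[of q h e b] qs(1) h that by blast
  then have "\<exists>e. \<forall>b\<in>graded_piece (int e). \<exists>r j. b = r * h + j \<and> j \<in> q" if "q \<in> set qs" for q
    using that by blast
  then have "\<exists>N. \<forall>k a u. k \<ge> int N \<longrightarrow> a \<in> graded_piece k \<longrightarrow> u \<in> foldl colon_set I qs \<longrightarrow>
    a * u \<in> {r * h + j | r j. j \<in> I}"
    by (rule filtration_power[OF geramita_cideal])
  then obtain N where N: "\<forall>k a u. k \<ge> int N \<longrightarrow> a \<in> graded_piece k \<longrightarrow> u \<in> foldl colon_set I qs \<longrightarrow>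
    a * u \<in> {r * h + j | r j. j \<in> I}"
    by (rule exE)
  have nzd: "u \<in> I" if hu: "h * u \<in> I" for u
  proof (rule ccontr)
    assume "u \<notin> I"
    then obtain r q where r: "q \<in> set qs" "r * u \<notin> I" "\<And>t. t \<in> q \<Longrightarrow> t * (r * u) \<in> I"
      using filtration_multiple[OF geramita_cideal, of u qs] qs(2) by (metis UNIV_I)
    \<comment> \<open>Modulo \<open>h\<close>, which kills \<open>u\<close>, each form of degree
      \<open>e\<close> lies in \<open>q\<close>, which kills \<open>r * u\<close>. So all of them
      kill \<open>r * u\<close>, contradicting positive depth.\<close>
    have "b * (r * u) \<in> I" if b: "b \<in> graded_piece (int e)" for b
    proof -
      obtain r' j where "b = r' * h + j" "j \<in> q" using plus[OF r(1) b] by blast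
      then have "b * (r * u) = (r' * r) * (h * u) + j * (r * u)" by (simp add: algebra_simps)
      then show ?thesis
        using cideal_add[OF geramita_cideal cideal_mult[OF geramita_cideal hu] r(3)[OF \<open>j \<in> q\<close>]] by simp
    qed
    then show False using depth_positive_power r(2) by blast
  qed
  show ?thesis
  proof (rule that[OF h(1,2) nzd])
    fix k and a :: "('n, 'k) mpol" assume "int N \<le> k" "a \<in> graded_piece k"
    then show "\<exists>r j. a = r * h + j \<and> j \<in> I" using N[rule_format, of k a 1] qs(2) by auto
  qed
qed

text \<open>As \<open>p\<close> is generated by linear forms, it kills every homogeneous component
  of a witness \<open>f\<close>. Conversely \<open>p\<close> contains the intersection of the
  finitely many colon ideals of the components, hence one of them.\<close>

lemma Ass_homogeneous:
  assumes p: "p \<in> Ass I" and np: "\<not> cprime I"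
  obtains d f where "d \<ge> 1" "f \<in> graded_piece (int d)" "colon I f = p"
proof -
  obtain f where f: "p = colon I f" using Ass_D(2)[OF p] by blast
  have cp: "cprime p" by (rule Ass_D(1)[OF p])
  obtain L where L: "L \<subseteq> graded_piece 1" "p = gen L" using geramita_linear[OF p] by blast
  have sub: "p \<subseteq> colon I (hpart d f)" for d
    unfolding L(2)
  proof (rule gen_minimal[OF cideal_colon[OF geramita_cideal]])
    show "L \<subseteq> colon I (hpart d f)"
    proof
      fix l assume l: "l \<in> L"
      then have "l * f \<in> I" using f L(2) gen_incl[OF l] by (auto simp: colon_def)
      then have "hpart (d + 1) (l * f) \<in> I" by (rule graded_ideal_hpart[OF geramita_graded])
      moreover have "l \<in> graded_piece 1" using l L(1) by blast
      ultimately show "l \<in> colon I (hpart d f)" by (simp add: hpart_mult colon_def)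
    qed
  qed
  obtain E where E: "finite E" "f = (\<Sum>e\<in>E. hpart (int e) f)" by (rule sum_hpart)
  have "\<exists>e\<in>E. colon I (hpart (int e) f) \<subseteq> p"
  proof (rule ccontr)
    assume "\<not> ?thesis"
    then have "\<forall>e\<in>E. \<exists>a. a \<in> colon I (hpart (int e) f) \<and> a \<notin> p" by blast
    then obtain a where a: "\<And>e. e \<in> E \<Longrightarrow> a e \<in> colon I (hpart (int e) f)" "\<And>e. e \<in> E \<Longrightarrow> a e \<notin> p" by metis
    have "(\<Prod>e\<in>E. a e) * hpart (int e) f \<in> I" if e: "e \<in> E" for e
    proof -
      have "(\<Prod>e\<in>E. a e) = a e * (\<Prod>e\<in>E - {e}. a e)" by (rule prod.remove[OF E(1) e])
      then show ?thesis using a(1)[OF e] cideal_mult[OF geramita_cideal, of "a e * hpart (int e) f" "\<Prod>e\<in>E - {e}. a e"]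
        by (simp add: colon_def ac_simps)
    qed
    then have "(\<Prod>e\<in>E. a e) * (\<Sum>e\<in>E. hpart (int e) f) \<in> I"
      unfolding sum_distrib_left by (intro cideal_sum geramita_cideal)
    then have "(\<Prod>e\<in>E. a e) \<in> p" using f E(2) by (simp add: colon_def)
    moreover have "(\<Prod>e\<in>H. a e) \<notin> p" if "finite H" "H \<subseteq> E" for H
      using that by (induction H rule: finite_induct) (use cp a(2) in \<open>auto simp: cprime_iff\<close>)
    ultimately show False using E(1) by blast
  qed
  then obtain d where d: "colon I (hpart (int d) f) = p" using sub by blast
  have "d \<noteq> 0"
  proof
    assume "d = 0"
    then have "p = UNIV \<or> p = I" using colon_constant[OF geramita_cideal hpart_graded, of f] d by simp
    then show False using cp np cprime_iff[of p] by auto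
  qed
  then show ?thesis using that[of d "hpart (int d) f"] hpart_graded d by auto
qed

end

section \<open>Graded resolutions\<close>

locale linear_system =
  fixes L :: "nat \<Rightarrow> ('n::finite, 'k::field) mpol" and s :: nat
  assumes L_linear: "L r \<in> graded_piece 1"
    and L_regular: "k < s \<Longrightarrow> L k * a \<in> gen (L ` {..<k}) \<Longrightarrow> a \<in> gen (L ` {..<k})"
    and L_span: "gen (L ` {..<s}) = irrelevant_ideal"
begin

section \<open>Graded pieces of the ideals generated by the first linear forms\<close>

primrec lin_part :: "nat \<Rightarrow> int \<Rightarrow> ('n, 'k) mpol set" where
  "lin_part 0 j = {0}"
| "lin_part (Suc k) j = {b + L k * w | b w. b \<in> lin_part k j \<and> w \<in> graded_piece (j - 1)}"

lemma lin_part_Suc_I: "b \<in> lin_part k j \<Longrightarrow> w \<in> graded_piece (j - 1) \<Longrightarrow> b + L k * w \<in> lin_part (Suc k) j"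
  by auto

lemma lin_part_0: "0 \<in> lin_part k j"
proof (induction k)
  case (Suc k)
  show ?case using lin_part_Suc_I[OF Suc graded_piece_0] by simp
qed simp

lemma lin_part_add: "a \<in> lin_part k j \<Longrightarrow> b \<in> lin_part k j \<Longrightarrow> a + b \<in> lin_part k j"
proof (induction k arbitrary: a b)
  case (Suc k)
  then obtain a' v b' w where *: "a = a' + L k * v" "b = b' + L k * w" "a' \<in> lin_part k j" "b' \<in> lin_part k j"
    "v \<in> graded_piece (j - 1)" "w \<in> graded_piece (j - 1)" by auto
  have "a + b = (a' + b') + L k * (v + w)" by (simp add: * algebra_simps)
  then show ?case using lin_part_Suc_I[OF Suc.IH[OF *(3,4)] graded_piece_add[OF *(5,6)]] by simp
qed simp

lemma lin_part_mult: "a \<in> graded_piece d \<Longrightarrow> b \<in> lin_part k j \<Longrightarrow> a * b \<in> lin_part k (d + j)"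
proof (induction k arbitrary: b)
  case (Suc k)
  then obtain b' w where *: "b = b' + L k * w" "b' \<in> lin_part k j" "w \<in> graded_piece (j - 1)" by auto
  have "a * b = a * b' + L k * (a * w)" by (simp add: * algebra_simps)
  moreover have "a * w \<in> graded_piece (d + j - 1)" using graded_piece_mult[OF Suc.prems(1) *(3)] by (simp add: algebra_simps)
  ultimately show ?case using lin_part_Suc_I[OF Suc.IH[OF Suc.prems(1) *(2)]] by simp
qed simp

lemma lin_part_mono: "k \<le> k' \<Longrightarrow> a \<in> lin_part k j \<Longrightarrow> a \<in> lin_part k' j"
proof (induction rule: dec_induct)
  case (step m)
  then show ?case using lin_part_Suc_I[OF _ graded_piece_0] by fastforce
qed

lemma L_lin_part: "r < k \<Longrightarrow> L r \<in> lin_part k 1"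
  using lin_part_Suc_I[OF lin_part_0, of 1 1 r] graded_piece_cst[of 1]
    lin_part_mono[of "Suc r" k "L r" 1] by auto

lemma lin_part_sum: "(\<And>x. x \<in> A \<Longrightarrow> f x \<in> lin_part k j) \<Longrightarrow> sum f A \<in> lin_part k j"
  by (induction A rule: infinite_finite_induct) (auto intro: lin_part_0 lin_part_add simp del: lin_part.simps)

text \<open>For the inclusion from right to left: the polynomials all of whose components lie in the
  respective \<open>lin_part\<close> form an ideal containing the generators.\<close>

lemma lin_part_iff: "a \<in> lin_part k j \<longleftrightarrow> a \<in> graded_piece j \<and> a \<in> gen (L ` {..<k})"
proof
  show "a \<in> lin_part k j \<Longrightarrow> a \<in> graded_piece j \<and> a \<in> gen (L ` {..<k})"
  proof (induction k arbitrary: a)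
    case 0
    then show ?case using graded_piece_0 cideal_0[OF cideal_gen] by auto
  next
    case (Suc k)
    then obtain b w where *: "a = b + L k * w" "b \<in> lin_part k j" "w \<in> graded_piece (j - 1)" by auto
    have "L k * w \<in> graded_piece j" using graded_piece_mult[OF L_linear *(3)] by simp
    moreover have "gen (L ` {..<k}) \<subseteq> gen (L ` {..<Suc k})"
      by (rule gen_minimal[OF cideal_gen]) (auto intro: gen_incl)
    moreover have "L k * w \<in> gen (L ` {..<Suc k})"
      by (rule cideal_mult'[OF cideal_gen gen_incl]) auto
    ultimately show ?case
      unfolding *(1) using Suc.IH[OF *(2)] graded_piece_add cideal_add[OF cideal_gen] by blast
  qed
next
  let ?X = "{f. \<forall>d. hpart d f \<in> lin_part k d}"
  have "cideal ?X"
    unfolding cideal_iff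
  proof (intro conjI ballI allI)
    show "0 \<in> ?X" by (simp add: lin_part_0)
    show "x + y \<in> ?X" if "x \<in> ?X" "y \<in> ?X" for x y using that by (simp add: hpart_add lin_part_add)
    fix x r :: "('n, 'k) mpol" assume x: "x \<in> ?X"
    obtain E where E: "r = (\<Sum>e\<in>E. hpart (int e) r)" using sum_hpart by blast
    have "hpart d (\<Sum>e\<in>E. hpart (int e) r * x) \<in> lin_part k d" for d
      unfolding hpart_sum
    proof (rule lin_part_sum)
      fix e
      have "hpart (d - int e) x \<in> lin_part k (d - int e)" using x by blast
      then show "hpart d (hpart (int e) r * x) \<in> lin_part k d"
        using lin_part_mult[OF hpart_graded, of "hpart (d - int e) x" k "d - int e" "int e" r]
        by (simp add: hpart_mult[OF hpart_graded])
    qed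
    moreover have "r * x = (\<Sum>e\<in>E. hpart (int e) r * x)"
      using arg_cong[OF E, of "\<lambda>r. r * x"] unfolding sum_distrib_right .
    ultimately show "r * x \<in> ?X" by simp
  qed
  moreover have "L ` {..<k} \<subseteq> ?X"
  proof (rule image_subsetI)
    fix r assume "r \<in> {..<k}"
    then have "hpart d (L r) \<in> lin_part k d" for d
      using hpart_same[OF L_linear] hpart_other[OF L_linear] L_lin_part lin_part_0 by (cases "d = 1") auto
    then show "L r \<in> ?X" by simp
  qed
  ultimately have sub: "gen (L ` {..<k}) \<subseteq> ?X" by (rule gen_minimal)
  assume a: "a \<in> graded_piece j \<and> a \<in> gen (L ` {..<k})"
  then have "hpart j a \<in> lin_part k j" using sub by blast
  then show "a \<in> lin_part k j" using hpart_same a by metis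
qed

lemma lin_part_regular: "k < s \<Longrightarrow> a \<in> graded_piece j \<Longrightarrow> L k * a \<in> lin_part k (j + 1) \<Longrightarrow> a \<in> lin_part k j"
  unfolding lin_part_iff using L_regular by blast

lemma lin_part_irrelevant: "a \<in> lin_part s j \<longleftrightarrow> a \<in> graded_piece j \<and> Poly_Mapping.lookup a 0 = 0"
  unfolding lin_part_iff L_span irrelevant_iff ..

end

text \<open>The forms are the variables other than \<open>i0\<close>, each corrected to vanish at
  the point \<open>c\<close>, followed by \<open>variable i0\<close>. The first \<open>k\<close> of
  them generate the kernel of \<open>\<sigma> k\<close>, a prime, so regularity of the next one only
  requires that \<open>\<sigma> k\<close> does not kill it.\<close>

lemma adapted_linear_system:
  fixes c :: "'n::finite \<Rightarrow> 'k::field" and i0 :: 'n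
  assumes c: "c i0 = 1" and s: "card (UNIV :: 'n set) = Suc n"
  obtains L where "linear_system L (Suc n)" "L n = variable i0"
    "gen (L ` {..<n}) = {f. subst (\<lambda>i. cst (c i) * variable i0) f = 0}"
proof -
  have "card {..<n} = card (UNIV - {i0})" using s by simp
  then obtain ix0 :: "nat \<Rightarrow> 'n" where ix0: "bij_betw ix0 {..<n} (UNIV - {i0})"
    using finite_same_card_bij[of "{..<n}" "UNIV - {i0}"] by auto
  define ix where "ix r = (if r < n then ix0 r else i0)" for r
  have inj: "inj_on ix {..<Suc n}"
    using ix0 unfolding bij_betw_def inj_on_def ix_def by (auto simp: less_Suc_eq)
  have onto: "\<exists>r<Suc n. ix r = i" for i
  proof (cases "i = i0")
    case False
    then have "i \<in> ix0 ` {..<n}" using ix0 by (simp add: bij_betw_def)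
    then show ?thesis by (auto simp: ix_def less_SucI)
  qed (auto simp: ix_def)
  have ixn: "ix r \<noteq> i0" if "r < n" for r using that ix0 by (auto simp: ix_def bij_betw_def)
  define x :: "('n, 'k) mpol" where "x = variable i0"
  define L :: "nat \<Rightarrow> ('n, 'k) mpol" where "L r = (if r < n then variable (ix r) - cst (c (ix r)) * x else x)" for r
  have cx: "cst a * x \<in> graded_piece 1" for a
    using graded_piece_mult[OF graded_piece_cst graded_piece_variable] unfolding x_def by simp
  have lin: "L r \<in> graded_piece 1" for r
    using cx by (auto simp: L_def x_def graded_piece_variable intro: graded_piece_diff)
  define \<sigma> where "\<sigma> k i = (if i \<in> ix ` {..<k} then cst (c i) * x else variable i)" for k i
  have \<sigma>0: "\<sigma> k i0 = x" if "k \<le> n" for k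
  proof -
    have "i0 \<notin> ix ` {..<k}"
    proof
      assume "i0 \<in> ix ` {..<k}"
      then obtain r where "r < k" "ix r = i0" by auto
      then show False using ixn[of r] that by simp
    qed
    then show ?thesis by (simp add: \<sigma>_def x_def)
  qed
  have sx: "subst (\<sigma> k) x = x" if "k \<le> n" for k using \<sigma>0[OF that] by (simp add: x_def)
  have ker: "gen (L ` {..<k}) = {f. subst (\<sigma> k) f = 0}" if k: "k \<le> n" for k
  proof
    show "gen (L ` {..<k}) \<subseteq> {f. subst (\<sigma> k) f = 0}"
    proof (rule gen_minimal[OF cideal_subst_kernel], rule image_subsetI)
      fix r assume "r \<in> {..<k}"
      then show "L r \<in> {f. subst (\<sigma> k) f = 0}"
        using k sx[OF k] by (simp add: L_def subst_diff subst_mult \<sigma>_def)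
    qed
    show "{f. subst (\<sigma> k) f = 0} \<subseteq> gen (L ` {..<k})"
    proof clarify
      fix f assume f: "subst (\<sigma> k) f = 0"
      have "variable i - \<sigma> k i \<in> gen (L ` {..<k})" for i
      proof (cases "i \<in> ix ` {..<k}")
        case True
        then obtain r where r: "r < k" "i = ix r" by auto
        then have "variable i - \<sigma> k i = L r" using k by (simp add: \<sigma>_def L_def)
        then show ?thesis using r(1) by (auto intro: gen_incl)
      qed (simp add: \<sigma>_def cideal_0[OF cideal_gen])
      then show "f \<in> gen (L ` {..<k})" using subst_congruent[OF cideal_gen, of "\<sigma> k" _ f] f by simp
    qed
  qed
  have "linear_system L (Suc n)"
  proof
    show "L r \<in> graded_piece 1" for r by (rule lin)
    show "a \<in> gen (L ` {..<k})" if k: "k < Suc n" and La: "L k * a \<in> gen (L ` {..<k})" for k a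
    proof -
      have kn: "k \<le> n" using k by simp
      have nz: "subst (\<sigma> k) (L k) \<noteq> 0"
      proof (cases "k < n")
        case True
        then have "ix k \<notin> ix ` {..<k}" using inj_onD[OF inj, of k] by fastforce
        then have sL: "subst (\<sigma> k) (L k) = variable (ix k) - cst (c (ix k)) * x"
          using True sx[OF kn] by (simp add: L_def subst_diff subst_mult \<sigma>_def)
        have "Poly_Mapping.lookup (variable (ix k) - cst (c (ix k)) * x) (Poly_Mapping.single (ix k) 1) = 1"
          using ixn[OF True] by (simp add: x_def variable_def mult_single lookup_minus lookup_single when_def)
            (metis lookup_single_eq lookup_single_not_eq zero_neq_one One_nat_def)
        then show ?thesis unfolding sL by (metis lookup_zero zero_neq_one)
      next
        case False
        then show ?thesis using sx[OF kn] variable_ne_0 by (simp add: L_def x_def)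
      qed
      then show ?thesis using La unfolding ker[OF kn] by (simp add: subst_mult mpol_mult_eq_0)
    qed
    show "gen (L ` {..<Suc n}) = irrelevant_ideal"
    proof
      show "gen (L ` {..<Suc n}) \<subseteq> irrelevant_ideal"
        by (rule gen_minimal[OF cideal_irrelevant]) (use lin graded_piece_irrelevant[of 1] in auto)
      have x: "x \<in> gen (L ` {..<Suc n})" by (rule gen_incl) (force simp: L_def)
      show "irrelevant_ideal \<subseteq> gen (L ` {..<Suc n})"
      proof (rule irrelevant_minimal[OF cideal_gen])
        fix i
        obtain r where r: "r < Suc n" "ix r = i" using onto by blast
        show "variable i \<in> gen (L ` {..<Suc n})"
        proof (cases "r < n")
          case True
          have "L r \<in> gen (L ` {..<Suc n})" by (rule gen_incl) (use r in auto)
          then have "L r + cst (c i) * x \<in> gen (L ` {..<Suc n})"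
            using cideal_add[OF cideal_gen] cideal_mult[OF cideal_gen x] by blast
          then show ?thesis using True r(2) by (simp add: L_def)
        next
          case False
          then show ?thesis using r x by (simp add: ix_def x_def)
        qed
      qed
    qed
  qed
  moreover have "L n = variable i0" by (simp add: L_def x_def)
  moreover have "\<sigma> n = (\<lambda>i. cst (c i) * variable i0)"
  proof
    fix i
    show "\<sigma> n i = cst (c i) * variable i0"
    proof (cases "i = i0")
      case True
      then show ?thesis using \<sigma>0[of n] c by (simp add: x_def)
    next
      case False
      then obtain r where "r < n" "ix r = i" using onto[of i] by (auto simp: ix_def less_Suc_eq)
      then show ?thesis by (auto simp: \<sigma>_def x_def)
    qed
  qed
  then have "gen (L ` {..<n}) = {f. subst (\<lambda>i. cst (c i) * variable i0) f = 0}"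
    using ker[of n] by simp
  ultimately show ?thesis by (rule that)
qed

locale graded_resolution = linear_system L s
  for L :: "nat \<Rightarrow> ('n::finite, 'k::field) mpol" and s +
  fixes I :: "('n, 'k) mpol set" and g :: nat and F :: "nat \<Rightarrow> int list"
    and \<phi> :: "nat \<Rightarrow> ('n, 'k) mpol mat"
  assumes resolution: "minimal_graded_free_resolution I g F \<phi>"
    and graded: "graded_ideal I"
begin

lemma F_0: "F 0 = [0]"
  and F_nonempty: "F i \<noteq> [] \<longleftrightarrow> i \<le> g"
  and phi_carrier: "\<phi> (Suc i) \<in> carrier_mat (length (F i)) (length (F (Suc i)))"
  and phi_degree: "r < length (F i) \<Longrightarrow> c < length (F (Suc i)) \<Longrightarrow> \<phi> (Suc i) $$ (r, c) \<in> graded_piece (F (Suc i) ! c - F i ! r)"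
  and phi_I: "(\<lambda>v. v $ 0) ` mat_image (\<phi> 1) = I"
  and phi_exact: "mat_kernel (\<phi> (Suc i)) = mat_image (\<phi> (Suc (Suc i)))"
  and phi_minimal: "r < length (F i) \<Longrightarrow> c < length (F (Suc i)) \<Longrightarrow> \<phi> (Suc i) $$ (r, c) \<in> irrelevant_ideal"
  using resolution unfolding minimal_graded_free_resolution_def by auto

text \<open>Functions vanishing beyond the rank replace vectors: the abstract complex needs a single
  additive group containing the modules of all ranks, and the cone uses pairs from it.\<close>

definition free :: "nat \<Rightarrow> int \<Rightarrow> (nat \<Rightarrow> ('n, 'k) mpol) set" where
  "free i j = {v. (\<forall>r<length (F i). v r \<in> graded_piece (j - F i ! r)) \<and> (\<forall>r\<ge>length (F i). v r = 0)}"

definition diff :: "nat \<Rightarrow> (nat \<Rightarrow> ('n, 'k) mpol) \<Rightarrow> nat \<Rightarrow> ('n, 'k) mpol" where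
  "diff i v r = (if r < length (F i) then \<Sum>c<length (F (Suc i)). \<phi> (Suc i) $$ (r, c) * v c else 0)"

definition scale :: "('n, 'k) mpol \<Rightarrow> (nat \<Rightarrow> ('n, 'k) mpol) \<Rightarrow> nat \<Rightarrow> ('n, 'k) mpol" where
  "scale a v r = a * v r"

lemma diff_mat: "r < length (F i) \<Longrightarrow> v \<in> carrier_vec (length (F (Suc i))) \<Longrightarrow>
    (\<phi> (Suc i) *\<^sub>v v) $ r = diff i (\<lambda>c. v $ c) r"
  using phi_carrier[of i] by (auto simp: diff_def scalar_prod_def atLeast0LessThan)

lemma diff_cong: "(\<And>c. c < length (F (Suc i)) \<Longrightarrow> v c = w c) \<Longrightarrow> diff i v = diff i w"
  by (rule ext) (auto simp: diff_def intro: sum.cong)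

lemma diff_hpart:
  assumes r: "r < length (F i)"
  shows "diff i (\<lambda>c. hpart (j - F (Suc i) ! c) (v c)) r = hpart (j - F i ! r) (diff i v r)"
proof -
  have "hpart (j - F i ! r) (\<phi> (Suc i) $$ (r, c) * v c) = \<phi> (Suc i) $$ (r, c) * hpart (j - F (Suc i) ! c) (v c)"
    if "c < length (F (Suc i))" for c
    using hpart_mult[OF phi_degree[OF r that], of "j - F i ! r" "v c"] by simp
  then show ?thesis using r by (simp add: diff_def hpart_sum)
qed

text \<open>Exactness is given for ungraded vectors only. The components of a preimage in the right
  degrees are again a preimage, because the matrices preserve degrees.\<close>

lemma free_exact:
  assumes x: "x \<in> free (Suc i) j" and dx: "diff i x = 0"
  shows "\<exists>y\<in>free (Suc (Suc i)) j. x = diff (Suc i) y"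
proof -
  let ?n = "length (F (Suc i))"
  have dims: "dim_row (\<phi> (Suc i)) = length (F i)" "dim_col (\<phi> (Suc i)) = ?n"
    "dim_col (\<phi> (Suc (Suc i))) = length (F (Suc (Suc i)))"
    using phi_carrier[of i] phi_carrier[of "Suc i"] by auto
  let ?v = "Matrix.vec ?n x"
  have eq: "diff i (\<lambda>c. ?v $ c) = diff i x" by (rule diff_cong) simp
  have "\<phi> (Suc i) *\<^sub>v ?v = 0\<^sub>v (length (F i))"
  proof (rule eq_vecI)
    fix r assume r: "r < dim_vec (0\<^sub>v (length (F i)) :: ('n, 'k) mpol vec)"
    then have "(\<phi> (Suc i) *\<^sub>v ?v) $ r = diff i (\<lambda>c. ?v $ c) r" by (intro diff_mat) auto
    then show "(\<phi> (Suc i) *\<^sub>v ?v) $ r = 0\<^sub>v (length (F i)) $ r" using r dx unfolding eq by simp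
  qed (simp add: dims)
  then have "?v \<in> mat_kernel (\<phi> (Suc i))" by (simp add: mat_kernel_def dims)
  then obtain w where w: "?v = \<phi> (Suc (Suc i)) *\<^sub>v w" "w \<in> carrier_vec (length (F (Suc (Suc i))))"
    unfolding phi_exact mat_image_def dims by blast
  define y where "y c = (if c < length (F (Suc (Suc i))) then hpart (j - F (Suc (Suc i)) ! c) (w $ c) else 0)" for c
  have "y \<in> free (Suc (Suc i)) j" by (auto simp: free_def y_def hpart_graded)
  moreover have "x r = diff (Suc i) y r" for r
  proof (cases "r < ?n")
    case True
    have "diff (Suc i) y = diff (Suc i) (\<lambda>c. hpart (j - F (Suc (Suc i)) ! c) (w $ c))"
      by (rule diff_cong) (simp add: y_def)
    then have "diff (Suc i) y r = hpart (j - F (Suc i) ! r) (diff (Suc i) (\<lambda>c. w $ c) r)"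
      using diff_hpart[OF True] by simp
    also have "diff (Suc i) (\<lambda>c. w $ c) r = x r"
      using diff_mat[OF True w(2)] w(1) True by (metis index_vec)
    also have "hpart (j - F (Suc i) ! r) (x r) = x r" using x True by (intro hpart_same) (simp add: free_def)
    finally show ?thesis by simp
  next
    case False
    then show ?thesis using x by (simp add: free_def diff_def)
  qed
  ultimately show ?thesis by blast
qed

lemma diff_diff: "diff i (diff (Suc i) x) = 0"
proof
  fix r
  show "diff i (diff (Suc i) x) r = 0 r"
  proof (cases "r < length (F i)")
    case True
    let ?v = "Matrix.vec (length (F (Suc (Suc i)))) x"
    have v: "?v \<in> carrier_vec (length (F (Suc (Suc i))))" by simp
    let ?w = "\<phi> (Suc (Suc i)) *\<^sub>v ?v"
    have "?w \<in> mat_image (\<phi> (Suc (Suc i)))" using phi_carrier[of "Suc i"] v unfolding mat_image_def by auto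
    then have k: "?w \<in> carrier_vec (length (F (Suc i)))" "\<phi> (Suc i) *\<^sub>v ?w = 0\<^sub>v (length (F i))"
      using phi_carrier[of i] unfolding phi_exact[symmetric] mat_kernel_def by auto
    have "diff i (diff (Suc i) x) = diff i (\<lambda>c. ?w $ c)"
    proof (rule diff_cong)
      fix c assume c: "c < length (F (Suc i))"
      have "diff (Suc i) x = diff (Suc i) (\<lambda>c. ?v $ c)" by (rule diff_cong) simp
      then show "diff (Suc i) x c = ?w $ c" using diff_mat[OF c v] by simp
    qed
    then have "diff i (diff (Suc i) x) r = 0" using diff_mat[OF True k(1)] k(2) True by simp
    then show ?thesis by simp
  qed (simp add: diff_def)
qed

sublocale graded_complex free diff "\<lambda>r. scale (L r)"
proof
  show "0 \<in> free i j" for i j by (simp add: free_def graded_piece_0)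
  show "x - y \<in> free i j" if "x \<in> free i j" "y \<in> free i j" for x y i j
    using that by (simp add: free_def graded_piece_diff)
  show "diff i x \<in> free i j" if x: "x \<in> free (Suc i) j" for x i j
  proof -
    have "\<phi> (Suc i) $$ (r, c) * x c \<in> graded_piece (j - F i ! r)"
      if "r < length (F i)" "c < length (F (Suc i))" for r c
      using graded_piece_mult[OF phi_degree[OF that], of "x c" "j - F (Suc i) ! c"] x that(2)
      by (simp add: free_def)
    then show ?thesis by (auto simp: free_def diff_def intro!: graded_piece_sum)
  qed
  show "scale (L r) x \<in> free i (j + 1)" if x: "x \<in> free i j" for x i j r
  proof -
    have "L r * x q \<in> graded_piece (j + 1 - F i ! q)" if "q < length (F i)" for q
      using graded_piece_mult[OF L_linear, of "x q" "j - F i ! q" r] x that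
      by (simp add: free_def algebra_simps)
    then show ?thesis using x by (simp add: free_def scale_def)
  qed
  show "diff i (x - y) = diff i x - diff i y" for i x y
    by (rule ext) (simp add: diff_def right_diff_distrib sum_subtractf)
  show "scale (L r) (x - y) = scale (L r) x - scale (L r) y" for r x y
    by (rule ext) (simp add: scale_def right_diff_distrib)
  show "diff i (scale (L r) x) = scale (L r) (diff i x)" for i r x
    by (rule ext) (simp add: diff_def scale_def sum_distrib_left mult.left_commute)
  show "scale (L q) (scale (L r) x) = scale (L r) (scale (L q) x)" for q r x
    by (rule ext) (simp add: scale_def mult.left_commute)
qed

lemma B_iff: "v \<in> B k i j \<longleftrightarrow> (\<forall>r<length (F i). v r \<in> lin_part k (j - F i ! r)) \<and> (\<forall>r\<ge>length (F i). v r = 0)"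
proof (induction k arbitrary: v)
  case 0
  show ?case by (auto simp: fun_eq_iff) (metis not_le)
next
  case (Suc k)
  show ?case
  proof
    assume "v \<in> B (Suc k) i j"
    then obtain b w where *: "v = b + scale (L k) w" "b \<in> B k i j" "w \<in> free i (j - 1)" by auto
    have "b r + L k * w r \<in> lin_part (Suc k) (j - F i ! r)" if "r < length (F i)" for r
      by (rule lin_part_Suc_I) (use that * Suc.IH[of b] in \<open>auto simp: free_def algebra_simps simp del: lin_part.simps\<close>)
    then show "(\<forall>r<length (F i). v r \<in> lin_part (Suc k) (j - F i ! r)) \<and> (\<forall>r\<ge>length (F i). v r = 0)"
      using * Suc.IH[of b] by (auto simp: scale_def free_def simp del: lin_part.simps)
  next
    assume v: "(\<forall>r<length (F i). v r \<in> lin_part (Suc k) (j - F i ! r)) \<and> (\<forall>r\<ge>length (F i). v r = 0)"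
    then have "\<forall>r. \<exists>b w. r < length (F i) \<longrightarrow> v r = b + L k * w \<and> b \<in> lin_part k (j - F i ! r) \<and> w \<in> graded_piece (j - F i ! r - 1)"
      by auto
    then obtain b w where bw: "\<And>r. r < length (F i) \<Longrightarrow> v r = b r + L k * w r \<and> b r \<in> lin_part k (j - F i ! r) \<and> w r \<in> graded_piece (j - F i ! r - 1)"
      by metis
    let ?b = "\<lambda>r. if r < length (F i) then b r else 0" and ?w = "\<lambda>r. if r < length (F i) then w r else 0"
    show "v \<in> B (Suc k) i j"
    proof (rule B_SucI)
      show "v = ?b + scale (L k) ?w" using bw v by (auto simp: fun_eq_iff scale_def)
      show "?b \<in> B k i j" using bw Suc.IH by auto
      show "?w \<in> free i (j - 1)" using bw by (auto simp: free_def algebra_simps)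
    qed
  qed
qed

sublocale minimal_complex free diff "\<lambda>r. scale (L r)" s
proof
  show "diff i (diff (Suc i) x) = 0" for x i by (rule diff_diff)
  show "\<exists>y\<in>free (Suc (Suc i)) j. x = diff (Suc i) y" if "x \<in> free (Suc i) j" "diff i x = 0" for x i j
    using free_exact that by blast
  show "x \<in> B k i j" if "k < s" "x \<in> free i j" "scale (L k) x \<in> B k i (j + 1)" for k x i j
    using that lin_part_regular[of k] unfolding B_iff by (auto simp: free_def scale_def algebra_simps)
  show "diff i x \<in> B s i j" if x: "x \<in> free (Suc i) j" for x i j
  proof -
    have "\<phi> (Suc i) $$ (r, c) * x c \<in> lin_part s (j - F i ! r)"
      if rc: "r < length (F i)" "c < length (F (Suc i))" for r c
    proof -
      have "\<phi> (Suc i) $$ (r, c) \<in> lin_part s (F (Suc i) ! c - F i ! r)"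
        using phi_degree[OF rc] phi_minimal[OF rc] by (simp add: lin_part_irrelevant irrelevant_iff)
      then show ?thesis
        using lin_part_mult[of "x c" "j - F (Suc i) ! c"] x rc(2) by (fastforce simp: free_def mult.commute)
    qed
    then show ?thesis by (auto simp: B_iff diff_def intro: lin_part_sum)
  qed
qed

text \<open>Modulo the irrelevant ideal a free module becomes a vector space on its basis; an entry
  contributes there only through its constant term, which forces its degree to be 0.\<close>

lemma generator_iff: "j \<in> set (F i) \<longleftrightarrow> (\<exists>z\<in>free i j. z \<notin> B s i j)"
proof
  assume "j \<in> set (F i)"
  then obtain r where r: "r < length (F i)" "F i ! r = j" by (metis in_set_conv_nth)
  let ?z = "\<lambda>q. if q = r then 1 else 0 :: ('n, 'k) mpol"
  have "?z \<in> free i j" using r graded_piece_cst[of 1] by (auto simp: free_def graded_piece_0)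
  moreover have "?z \<notin> B s i j" using r(1) by (auto simp: B_iff lin_part_irrelevant)
  ultimately show "\<exists>z\<in>free i j. z \<notin> B s i j" by blast
next
  assume "\<exists>z\<in>free i j. z \<notin> B s i j"
  then obtain z r where z: "z \<in> free i j" "r < length (F i)" "z r \<notin> lin_part s (j - F i ! r)"
    unfolding B_iff by (auto simp: free_def)
  then have zr: "z r \<in> graded_piece (j - F i ! r)" "Poly_Mapping.lookup (z r) 0 \<noteq> 0"
    by (auto simp: free_def lin_part_irrelevant)
  then have "0 \<in> Poly_Mapping.keys (z r)" by (simp add: in_keys_iff)
  with zr(1) have "int (total_deg (0 :: 'n \<Rightarrow>\<^sub>0 nat)) = j - F i ! r" by (simp add: graded_piece_def)
  then have "j = F i ! r" by (simp add: total_deg_def)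
  then show "j \<in> set (F i)" using z(2) by simp
qed

section \<open>The quotient by \<open>I\<close> as the cokernel in homological degree zero\<close>

definition embed :: "('n, 'k) mpol \<Rightarrow> nat \<Rightarrow> ('n, 'k) mpol" where
  "embed u r = (if r = 0 then u else 0)"

lemma embed_free: "embed u \<in> free 0 j \<longleftrightarrow> u \<in> graded_piece j"
  by (auto simp: free_def embed_def F_0)

lemma free_0: "v \<in> free 0 j \<Longrightarrow> v = embed (v 0)"
  by (auto simp: free_def embed_def F_0 fun_eq_iff)

lemma embed_image:
  assumes u: "u \<in> graded_piece j"
  shows "(\<exists>w\<in>free (Suc 0) j. embed u = diff 0 w) \<longleftrightarrow> u \<in> I"
proof
  assume "\<exists>w\<in>free (Suc 0) j. embed u = diff 0 w"
  then obtain w where w: "embed u = diff 0 w" by blast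
  let ?v = "Matrix.vec (length (F (Suc 0))) w"
  have v: "?v \<in> carrier_vec (length (F (Suc 0)))" by simp
  have "diff 0 w = diff 0 (\<lambda>c. ?v $ c)" by (rule diff_cong) simp
  then have "(\<phi> (Suc 0) *\<^sub>v ?v) $ 0 = diff 0 w 0" using diff_mat[OF _ v, of 0] by (simp add: F_0)
  also have "\<dots> = u" using fun_cong[OF w, of 0] by (simp add: embed_def)
  finally have "(\<phi> (Suc 0) *\<^sub>v ?v) $ 0 = u" .
  moreover have "\<phi> (Suc 0) *\<^sub>v ?v \<in> mat_image (\<phi> 1)" using phi_carrier[of 0] v unfolding mat_image_def by auto
  ultimately show "u \<in> I" unfolding phi_I[symmetric] by blast
next
  assume "u \<in> I"
  then obtain v where v: "v \<in> carrier_vec (length (F (Suc 0)))" "u = (\<phi> (Suc 0) *\<^sub>v v) $ 0"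
    using phi_carrier[of 0] unfolding phi_I[symmetric] mat_image_def by auto
  define w where "w c = (if c < length (F (Suc 0)) then hpart (j - F (Suc 0) ! c) (v $ c) else 0)" for c
  have "diff 0 w 0 = diff 0 (\<lambda>c. hpart (j - F (Suc 0) ! c) (v $ c)) 0"
    by (rule fun_cong[OF diff_cong]) (simp add: w_def)
  also have "\<dots> = hpart j (diff 0 (\<lambda>c. v $ c) 0)" using diff_hpart[of 0 0 j "\<lambda>c. v $ c"] by (simp add: F_0)
  also have "diff 0 (\<lambda>c. v $ c) 0 = u" using diff_mat[of 0 0 v] v by (simp add: F_0)
  also have "hpart j u = u" by (rule hpart_same[OF u])
  finally have "embed u = diff 0 w" by (auto simp: fun_eq_iff embed_def diff_def F_0)
  moreover have "w \<in> free (Suc 0) j" by (auto simp: free_def w_def hpart_graded)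
  ultimately show "\<exists>w\<in>free (Suc 0) j. embed u = diff 0 w" by blast
qed

lemma free_0_image: "v \<in> free 0 j \<Longrightarrow> (\<exists>w\<in>free (Suc 0) j. v = diff 0 w) \<longleftrightarrow> v 0 \<in> I"
  using embed_image[of "v 0" j] free_0[of v j] embed_free[of "v 0" j] by metis

lemma N_iff: "v \<in> N k j \<longleftrightarrow> v \<in> free 0 j \<and> (\<forall>r<k. L r * v 0 \<in> I)"
proof -
  have "(\<exists>u\<in>free (Suc 0) (j + 1). scale (L r) v = diff 0 u) \<longleftrightarrow> L r * v 0 \<in> I" if "v \<in> free 0 j" for r
    using free_0_image[OF l_C[OF that, of r]] by (simp add: scale_def)
  then show ?thesis unfolding N_def by blast
qed

end

section \<open>The bounds for the v-number\<close>

theorem theorem4p10: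
  fixes I p :: "('n::finite, 'k::field) mpol set"
    and g :: nat
    and F :: "nat \<Rightarrow> int list"
    and \<phi> :: "nat \<Rightarrow> ('n, 'k) mpol mat"
  assumes "geramita_ideal I"
    and "p \<in> Ass I"
    and "minimal_graded_free_resolution I g F \<phi>"
    and "\<not> primeideal I class_ring"
  shows "min_socle_degree g F \<le> int (local_v_number p I) \<and>
         int (local_v_number p I) \<le> regularity F \<and>
         (level I g F \<longrightarrow>
            min_socle_degree g F = int (local_v_number p I) \<and>
            int (local_v_number p I) = regularity F)"
proof -
  note ger = assms(1)
  note I = geramita_cideal[OF ger]
  obtain n where n: "card (UNIV :: 'n set) = Suc n" by (metis card_gt_0_iff finite UNIV_not_empty gr0_implies_Suc)
  obtain i0 c where pt: "c i0 = 1" "p = {f. subst (\<lambda>i. cst (c i) * variable i0) f = 0}"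
    by (rule Ass_point[OF ger assms(2)]) blast
  obtain L where L: "linear_system L (Suc n)" "L n = variable i0" "p = gen (L ` {..<n})"
    unfolding pt(2) by (rule adapted_linear_system[of c i0, OF pt(1) n]) blast
  have cp: "cprime p" by (rule Ass_D(1)[OF assms(2)])
  interpret graded_resolution L "Suc n" I g F \<phi>
    by (intro graded_resolution.intro graded_resolution_axioms.intro L(1) assms(3) geramita_graded[OF ger])
  define d where "d = local_v_number p I"
  have "\<exists>d. 1 \<le> d \<and> (\<exists>f\<in>graded_piece (int d). colon I f = p)"
    using Ass_homogeneous[OF ger assms(2,4)] by metis
  then have "1 \<le> d \<and> (\<exists>f\<in>graded_piece (int d). colon I f = p)"
    unfolding d_def local_v_number_def by (rule LeastI_ex)
  then obtain f where d1: "1 \<le> d" and f: "f \<in> graded_piece (int d)" "colon I f = p" by blast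
  have least: "d \<le> d'" if "1 \<le> d'" "f' \<in> graded_piece (int d')" "colon I f' = p" for d' f'
    unfolding d_def local_v_number_def by (rule Least_le) (use that in blast)

  \<comment> \<open>A generator in homological degree \<open>n + 1\<close>, the number of variables,
    would produce an element outside \<open>I\<close> that all variables multiply into
    \<open>I\<close>.\<close>
  have top: "z \<in> B (Suc n) (Suc n) j" if z: "z \<in> free (Suc n) j" for z j
  proof (rule ccontr)
    assume "z \<notin> B (Suc n) (Suc n) j"
    then obtain v where v: "v \<in> N (Suc n) (j - int (Suc n))"
      "\<not> (\<exists>w\<in>free (Suc 0) (j - int (Suc n)). v = diff 0 w)"
      using top_homology_socle[of z "j - int (Suc n)"] z by (auto simp: minimal_Z minimal_Bd simp del: B.simps)
    have "irrelevant_ideal \<subseteq> colon I (v 0)"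
      unfolding L_span[symmetric]
      by (rule gen_minimal[OF cideal_colon[OF I]]) (use v(1) in \<open>auto simp: N_iff colon_def\<close>)
    then have "variable i \<in> colon I (v 0)" for i using irrelevant_variable[of i] by (rule subsetD)
    then have "variable i * v 0 \<in> I" for i by (simp add: colon_def)
    then have "v 0 \<in> I" by (rule depth_positive[OF ger])
    then show False using v free_0_image by (simp add: N_iff)
  qed
  \<comment> \<open>Homological degree \<open>n + 1\<close> is excluded by \<open>top\<close>, and
    all higher ones by acyclicity, as only \<open>n + 1\<close> forms are available.\<close>
  have gn: "g \<le> n"
  proof (rule ccontr)
    assume "\<not> g \<le> n"
    obtain j where "j \<in> set (F g)" using F_nonempty[of g] by (metis last_in_set order_refl)
    then obtain z where z: "z \<in> free g j" "z \<notin> B (Suc n) g j" using generator_iff by blast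
    then show False
      using top[of z j] acyclic_above_length[of "Suc n" g z j] \<open>\<not> g \<le> n\<close>
      by (cases "g = Suc n") (auto simp: minimal_Z minimal_Bd simp del: B.simps)
  qed

  have embed_f: "embed f \<in> N n (int d)"
    using f gen_incl[of _ "L ` {..<n}"] by (auto simp: N_iff embed_free embed_def L(3) colon_def)
  have "\<not> (\<exists>w\<in>free (Suc 0) (int d). embed f - scale (L n) u = diff 0 w)" if u: "u \<in> N n (int d - 1)" for u
  proof
    assume w: "\<exists>w\<in>free (Suc 0) (int d). embed f - scale (L n) u = diff 0 w"
    have uf: "u \<in> free 0 (int d - 1)" using u by (simp add: N_iff)
    have "embed f - scale (L n) u \<in> free 0 (int d)"
      using diff_C[OF _ l_C'[OF uf, of n]] embed_free f(1) by blast
    from free_0_image[OF this] have "(embed f - scale (L n) u) 0 \<in> I" using w by blast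
    then have fu: "f - L n * u 0 \<in> I" by (simp add: embed_def scale_def)
    \<comment> \<open>If \<open>a * u 0\<close> is in \<open>I\<close>, so is
      \<open>a * L n * u 0\<close>, and with it \<open>a * f\<close>; hence \<open>a\<close> is in
      \<open>p\<close>. Thus \<open>u 0\<close> is a witness for \<open>p\<close> of degree
      \<open>d - 1\<close>.\<close>
    have "colon I (u 0) = p"
    proof
      show "p \<subseteq> colon I (u 0)" unfolding L(3)
        by (rule gen_minimal[OF cideal_colon[OF I]]) (use u in \<open>auto simp: N_iff colon_def\<close>)
      show "colon I (u 0) \<subseteq> p"
      proof
        fix a assume "a \<in> colon I (u 0)"
        then have "L n * (a * u 0) \<in> I" using cideal_mult[OF I] by (simp add: colon_def)
        then have "a * (f - L n * u 0) + L n * (a * u 0) \<in> I" using cideal_add[OF I] cideal_mult[OF I fu] by blast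
        then have "a * f \<in> I" by (simp add: algebra_simps)
        then show "a \<in> p" unfolding f(2)[symmetric] by (simp add: colon_def)
      qed
    qed
    moreover have u0: "u 0 \<in> graded_piece (int (d - 1))"
      using uf embed_free[of "u 0" "int d - 1"] free_0[OF uf] d1 by (simp add: of_nat_diff)
    \<comment> \<open>Only witnesses of positive degree compete in the definition of the v-number,
      so the minimality of \<open>d\<close> leaves the case of a constant
      \<open>u 0\<close>.\<close>
    ultimately have "d = 1" using least[of "d - 1" "u 0"] d1 by force
    then have "p = UNIV \<or> p = I" using colon_constant[OF I, of "u 0"] u0 \<open>colon I (u 0) = p\<close> by simp
    then show False using cp assms(4) cprime_iff[of p] by auto
  qed
  then obtain z where "z \<in> Z (Suc n) n (int d + int n)" "z \<notin> Bd (Suc n) n (int d + int n)"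
    using colon_homology[OF refl embed_f] by blast
  then have gen: "int d + int n \<in> set (F n)"
    unfolding generator_iff by (auto simp: minimal_Z minimal_Bd simp del: B.simps)
  then have "n \<le> g" using F_nonempty[of n] by auto
  then have g: "g = n" using gn by simp

  have betti: "betti F i j \<noteq> 0 \<longleftrightarrow> j \<in> set (F i)" for i j
    by (simp add: betti_def count_list_0_iff)
  have socle: "min_socle_degree g F = Min ((\<lambda>j. j - int g) ` set (F g))"
    unfolding min_socle_degree_def betti by (rule arg_cong[where f = Min]) blast
  have le1: "min_socle_degree g F \<le> int d"
    unfolding socle by (rule Min_le) (use gen g in \<open>auto intro: rev_image_eqI\<close>)
  let ?R = "{j - int i | i j. betti F i j \<noteq> 0}"
  have "?R \<subseteq> (\<Union>i\<le>g. (\<lambda>j. j - int i) ` set (F i))"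
    using F_nonempty unfolding betti by fastforce
  then have fin: "finite ?R" by (rule finite_subset) auto
  have dR: "int d \<in> ?R" unfolding betti using gen by (intro CollectI exI[of _ n] exI[of _ "int d + int n"]) auto
  have le2: "int d \<le> regularity F" unfolding regularity_def by (rule Max_ge[OF fin dR])
  have lev: "min_socle_degree g F = int d \<and> int d = regularity F" if "level I g F"
  proof
    have "\<exists>!j. j \<in> set (F g)" using that unfolding level_def betti by blast
    \<comment> \<open>The shift found above is one of the last shifts, so uniqueness identifies it
      as the only one.\<close>
    then have uniq: "j = int d + int n" if "j \<in> set (F g)" for j using gen g that by blast
    then have "set (F g) = {int d + int n}" using gen g by blast
    then show "min_socle_degree g F = int d" unfolding socle by (simp add: g)
    obtain e h M where h: "e \<ge> 1" "h \<in> graded_piece (int e)" "\<And>u. h * u \<in> I \<Longrightarrow> u \<in> I"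
      and M: "\<And>k a. k \<ge> int M \<Longrightarrow> a \<in> graded_piece k \<Longrightarrow> \<exists>r j. a = r * h + j \<and> j \<in> I"
      by (rule geramita_parameter[OF ger]) blast
    have hm: "h \<in> lin_part (Suc n) (int e)"
      unfolding lin_part_irrelevant irrelevant_iff[symmetric]
      using h(1,2) graded_piece_irrelevant[of "int e"] by auto
    have hC: "scale h x \<in> free i (j + int e)" if "x \<in> free i j" for x i j
      using that graded_piece_mult[OF h(2)] by (fastforce simp: free_def scale_def algebra_simps)
    interpret parameter_complex free diff "\<lambda>r. scale (L r)" "Suc n" "scale h" "int e"
    proof
      show "scale h (x - y) = scale h x - scale h y" for x y by (rule ext) (simp add: scale_def right_diff_distrib)
      show "scale h (diff i x) = diff i (scale h x)" for i x
        by (rule ext) (simp add: diff_def scale_def sum_distrib_left mult.left_commute)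
      show "scale h (scale (L r) x) = scale (L r) (scale h x)" for r x
        by (rule ext) (simp add: scale_def mult.left_commute)
      show "scale h x \<in> free i (j + int e)" if "x \<in> free i j" for x i j by (rule hC[OF that])
      show "scale h x \<in> B (Suc n) i (j + int e)" if x: "x \<in> free i j" for x i j
        unfolding B_iff
      proof (intro conjI allI impI)
        fix r assume "r < length (F i)"
        then have "x r \<in> graded_piece (j - F i ! r)" using x by (simp add: free_def)
        from lin_part_mult[OF this hm] show "scale h x r \<in> lin_part (Suc n) (j + int e - F i ! r)"
          by (simp add: scale_def algebra_simps del: lin_part.simps)
      qed (use x in \<open>auto simp: scale_def free_def\<close>)
      show "\<exists>v\<in>free (Suc 0) j. x = diff 0 v"
        if x: "x \<in> free 0 j" "u \<in> free (Suc 0) (j + int e)" "scale h x = diff 0 u" for x u j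
      proof -
        have "scale h x 0 \<in> I" using free_0_image[OF hC[OF x(1)]] x(2,3) by blast
        then have "h * x 0 \<in> I" by (simp add: scale_def)
        then show ?thesis using free_0_image[OF x(1)] h(3) by blast
      qed
    qed
    have bound: "j - int i \<le> int d" if j: "j \<in> set (F i)" for i j
    proof -
      obtain z where z: "z \<in> free i j" "z \<notin> B (Suc n) i j" using j generator_iff by blast
      show ?thesis
      proof (rule generator_degree_bound[OF refl _ _ _ z])
        show "free (Suc n) j \<subseteq> B (Suc n) (Suc n) j" for j using top by blast
        show "j = int n + int d" if "z \<in> free n j" "z \<notin> B (Suc n) n j" for j z
        proof -
          have "j \<in> set (F n)" using generator_iff[of j n] that by blast
          then show ?thesis using uniq[of j] g by simp
        qed
        fix j x assume j: "int M \<le> j" and x: "x \<in> free 0 j"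
        have x0: "x 0 \<in> graded_piece j" using x embed_free free_0 by metis
        obtain r a where ra: "x 0 = r * h + a" "a \<in> I" using M[OF j x0] by blast
        \<comment> \<open>The equation \<open>x 0 = r * h + a\<close> need not be homogeneous;
          taking its degree \<open>j\<close> part replaces both terms by homogeneous ones, and
          \<open>a\<close> stays in the graded ideal \<open>I\<close>.\<close>
        have "x 0 = hpart j (h * r + a)" using hpart_same[OF x0] ra(1) by (simp add: mult.commute)
        then have eq: "x 0 = h * hpart (j - int e) r + hpart j a" by (simp add: hpart_add hpart_mult[OF h(2)])
        have "hpart j a \<in> I" by (rule graded_ideal_hpart[OF geramita_graded[OF ger] ra(2)])
        then obtain w where w: "w \<in> free (Suc 0) j" "embed (hpart j a) = diff 0 w"
          using embed_image[OF hpart_graded] by blast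
        have "x = diff 0 w + scale h (embed (hpart (j - int e) r))"
          using free_0[OF x] unfolding w(2)[symmetric] by (auto simp: fun_eq_iff embed_def scale_def eq)
        moreover have "embed (hpart (j - int e) r) \<in> free 0 (j - int e)" by (simp add: embed_free hpart_graded)
        ultimately show "\<exists>u\<in>free (Suc 0) j. \<exists>y\<in>free 0 (j - int e). x = diff 0 u + scale h y" using w(1) by blast
      qed
    qed
    have "?R \<noteq> {}" using dR by blast
    moreover have "a \<le> int d" if "a \<in> ?R" for a using that bound unfolding betti by blast
    ultimately have "regularity F \<le> int d" unfolding regularity_def by (rule Max.boundedI[OF fin])
    then show "int d = regularity F" using le2 by simp
  qed
  show ?thesis using le1 le2 lev unfolding d_def by blast
qed

end
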